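(* Let $d\ge1$. A graph $G=(V,E)$ is $d$-joined if and only if $\mathrm{cl}^*_d(G)$ is $d$-connected, every $d$-separator of $\mathrm{cl}^*_d(G)$ is a clique in $\mathrm{cl}^*_d(G)$, and every $(d+1)$-block of $\mathrm{cl}^*_d(G)$ is a clique in $\mathrm{cl}^*_d(G)$.
   Context: A $d$-dimensional realization of $G$ is a pair $(G,p)$ with $p:V\to\mathbb{R}^d$; it is generic if the $d|V|$ coordinates of $p$ are algebraically independent over $\mathbb{Q}$. $(G,p),(G,q)$ are equivalent if $\|p(x)-p(y)\|=\|q(x)-q(y)\|$ for all edges $xy$, congruent if this holds for all pairs of vertices. $G$ is rigid in $\mathbb{R}^d$ if for a generic realization $(G,p)$ there is $\varepsilon>0$ such that every equivalent $(G,q)$ with $\|p(x)-q(x)\|<\varepsilon$ for all $x$ is congruent to $(G,p)$. A pair $\{x,y\}$ is globally linked in $G$ in $\mathbb{R}^d$ if for every generic realization $(G,p)$ in $\mathbb{R}^d$ and every equivalent realization $(G,q)$ in $\mathbb{R}^d$, $\|p(x)-p(y)\|=\|q(x)-q(y)\|$. $\kappa(G,x,y)$ is the maximum number of internally vertex-disjoint $x$–$y$ paths. $G$ is $d$-joined if $|V|\ge d+1$, $G$ is rigid in $\mathbb{R}^d$, and for all $x,y\in V$: $\{x,y\}$ is globally linked iff $xy\in E$ or $\kappa(G,x,y)\ge d+1$. $\mathrm{cl}^*_d(G)$ (the globally linked closure) is the graph obtained from $G$ by adding the edge $xy$ for every pair $\{x,y\}$ globally linked in $G$ in $\mathbb{R}^d$.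 A graph $H$ is $d$-connected if it has at least $d+1$ vertices and no separator (vertex set whose removal disconnects $H$) of size at most $d-1$; a $d$-separator is a separator of size $d$. A clique is a vertex set inducing a complete subgraph. A $(d+1)$-block of $H$ is an inclusion-wise maximal vertex set $B$ such that for all $x,y\in B$, either $xy\in E(H)$ or $\kappa(H,x,y)\ge d+1$. *)

theory Defs
  imports
    "HOL-Analysis.Analysis"
    "HOL-Library.Poly_Mapping"
    "Graph_Theory.Graph_Theory"
begin

text \<open>
  A finite simple graph is a \<^const>\<open>pair_graph\<close>: a finite vertex set together with a symmetric,
  irreflexive set of arcs \<open>(x, y)\<close>; the edge \<open>xy\<close> is represented by the two arcs
  \<open>(x, y)\<close> and \<open>(y, x)\<close>.
  The dimension \<open>d\<close> of the ambient space \<open>real ^ 'd\<close> is \<open>CARD('d)\<close>, which is automatically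
  at least 1. Notions that depend on the dimension only through realizations take an argument
  of type \<open>'d itself\<close>.
\<close>


section \<open>Generic realizations\<close>

text \<open>
  A polynomial over the rationals in variables indexed by \<open>'i\<close> is a finitely supported map from
  monomials to coefficients, and a monomial is a finitely supported map from variables to
  exponents.
\<close>

type_synonym 'i rat_mpoly = "('i \<Rightarrow>\<^sub>0 nat) \<Rightarrow>\<^sub>0 rat"

definition mpoly_eval :: "('i \<Rightarrow> real) \<Rightarrow> 'i rat_mpoly \<Rightarrow> real" where
  "mpoly_eval a f =
     (\<Sum>m\<in>Poly_Mapping.keys f. of_rat (Poly_Mapping.lookup f m) *
        (\<Prod>i\<in>Poly_Mapping.keys m. a i ^ Poly_Mapping.lookup m i))"

definition algebraically_independent :: "'i set \<Rightarrow> ('i \<Rightarrow> real) \<Rightarrow> bool" where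
  "algebraically_independent I a \<longleftrightarrow>
     (\<forall>f :: 'i rat_mpoly. (\<forall>m\<in>Poly_Mapping.keys f. Poly_Mapping.keys m \<subseteq> I) \<longrightarrow>
        mpoly_eval a f = 0 \<longrightarrow> f = 0)"

text \<open>
  A realization of \<open>G\<close> is a function on the whole vertex type, of which only the values on
  \<^term>\<open>pverts G\<close> are ever used.
\<close>

definition generic :: "'a pair_pre_digraph \<Rightarrow> ('a \<Rightarrow> real ^ 'd::finite) \<Rightarrow> bool" where
  "generic G p \<longleftrightarrow>
     algebraically_independent (pverts G \<times> (UNIV :: 'd set)) (\<lambda>(v, i). p v $ i)"


section \<open>Rigidity and globally linked pairs\<close>

definition equivalent ::
  "'a pair_pre_digraph \<Rightarrow> ('a \<Rightarrow> real ^ 'd::finite) \<Rightarrow> ('a \<Rightarrow> real ^ 'd) \<Rightarrow> bool" where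
  "equivalent G p q \<longleftrightarrow> (\<forall>(x, y)\<in>parcs G. norm (p x - p y) = norm (q x - q y))"

definition congruent_real ::
  "'a pair_pre_digraph \<Rightarrow> ('a \<Rightarrow> real ^ 'd::finite) \<Rightarrow> ('a \<Rightarrow> real ^ 'd) \<Rightarrow> bool" where
  "congruent_real G p q \<longleftrightarrow>
     (\<forall>x\<in>pverts G. \<forall>y\<in>pverts G. norm (p x - p y) = norm (q x - q y))"

text \<open>
  Local rigidity is a generic property, so asking for it at every generic realization or at
  some generic realization is the same; the former is taken as the definition.
\<close>

definition rigid :: "'d::finite itself \<Rightarrow> 'a pair_pre_digraph \<Rightarrow> bool" where
  "rigid _ G \<longleftrightarrow>
     (\<forall>p :: 'a \<Rightarrow> real ^ 'd. generic G p \<longrightarrow>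
        (\<exists>\<epsilon>>0. \<forall>q. equivalent G p q \<and> (\<forall>x\<in>pverts G. norm (p x - q x) < \<epsilon>) \<longrightarrow>
           congruent_real G p q))"

definition globally_linked ::
  "'d::finite itself \<Rightarrow> 'a pair_pre_digraph \<Rightarrow> 'a \<Rightarrow> 'a \<Rightarrow> bool" where
  "globally_linked _ G x y \<longleftrightarrow>
     (\<forall>p q :: 'a \<Rightarrow> real ^ 'd. generic G p \<and> equivalent G p q \<longrightarrow>
        norm (p x - p y) = norm (q x - q y))"

definition gl_closure ::
  "'d::finite itself \<Rightarrow> 'a pair_pre_digraph \<Rightarrow> 'a pair_pre_digraph" where
  "gl_closure D G =
     \<lparr>pverts = pverts G,
      parcs = parcs G \<union>
        {(x, y). x \<in> pverts G \<and> y \<in> pverts G \<and> x \<noteq> y \<and> globally_linked D G x y}\<rparr>"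


section \<open>Connectivity\<close>

definition disjoint_path_family ::
  "'a pair_pre_digraph \<Rightarrow> 'a \<Rightarrow> 'a \<Rightarrow> 'a list set \<Rightarrow> bool" where
  "disjoint_path_family H x y P \<longleftrightarrow>
     (\<forall>p\<in>P. vpath p (with_proj H) \<and> hd p = x \<and> last p = y) \<and>
     (\<forall>p\<in>P. \<forall>q\<in>P. p \<noteq> q \<longrightarrow> set p \<inter> set q = {x, y})"

text \<open>
  \<open>\<kappa>(H, x, y)\<close> for distinct vertices of a finite graph; the path consisting of the single edge
  \<open>xy\<close>, if present, counts as one path.
\<close>

definition kappa :: "'a pair_pre_digraph \<Rightarrow> 'a \<Rightarrow> 'a \<Rightarrow> nat" where
  "kappa H x y = Max (card ` {P. disjoint_path_family H x y P})"

definition clique :: "'a pair_pre_digraph \<Rightarrow> 'a set \<Rightarrow> bool" where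
  "clique H K \<longleftrightarrow> K \<subseteq> pverts H \<and> (\<forall>x\<in>K. \<forall>y\<in>K. x \<noteq> y \<longrightarrow> (x, y) \<in> parcs H)"

text \<open>
  The inclusion is proper because \<^const>\<open>Digraph_Component.connected\<close> is false for the graph
  without vertices.
\<close>

definition separator :: "'a pair_pre_digraph \<Rightarrow> 'a set \<Rightarrow> bool" where
  "separator H S \<longleftrightarrow>
     S \<subset> pverts H \<and> \<not> Digraph_Component.connected (with_proj H \<restriction> (pverts H - S))"

definition k_connected :: "nat \<Rightarrow> 'a pair_pre_digraph \<Rightarrow> bool" where
  "k_connected k H \<longleftrightarrow>
     k + 1 \<le> card (pverts H) \<and> \<not> (\<exists>S. separator H S \<and> card S < k)"

definition k_separator :: "nat \<Rightarrow> 'a pair_pre_digraph \<Rightarrow> 'a set \<Rightarrow> bool" where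
  "k_separator k H S \<longleftrightarrow> separator H S \<and> card S = k"

definition pairwise_k_linked :: "nat \<Rightarrow> 'a pair_pre_digraph \<Rightarrow> 'a set \<Rightarrow> bool" where
  "pairwise_k_linked k H B \<longleftrightarrow> B \<subseteq> pverts H \<and>
     (\<forall>x\<in>B. \<forall>y\<in>B. x \<noteq> y \<longrightarrow> (x, y) \<in> parcs H \<or> k \<le> kappa H x y)"

definition k_block :: "nat \<Rightarrow> 'a pair_pre_digraph \<Rightarrow> 'a set \<Rightarrow> bool" where
  "k_block k H B \<longleftrightarrow> pairwise_k_linked k H B \<and>
     (\<forall>B'. pairwise_k_linked k H B' \<and> B \<subseteq> B' \<longrightarrow> B' = B)"

definition d_joined :: "'d::finite itself \<Rightarrow> 'a pair_pre_digraph \<Rightarrow> bool" where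
  "d_joined D G \<longleftrightarrow>
     CARD('d) + 1 \<le> card (pverts G) \<and> rigid D G \<and>
     (\<forall>x\<in>pverts G. \<forall>y\<in>pverts G. x \<noteq> y \<longrightarrow>
        (globally_linked D G x y \<longleftrightarrow> (x, y) \<in> parcs G \<or> CARD('d) + 1 \<le> kappa G x y))"

end

theory Submission
  imports Defs
begin

text \<open>
  If \<open>G\<close> is rigid, every separator of \<open>G\<close> has at least \<open>d\<close> vertices, because one side of a smaller
  one could be rotated about it, and no two separators of size \<open>d\<close> cross, because the four corners
  of a crossing pair would move as a four-bar linkage. Both flexes are explicit infinitesimal motions
  depending continuously on the realization; Euler polygons and a compactness argument turn them into
  genuine flexes. If \<open>x\<close> and \<open>y\<close> are not adjacent in the closure of a \<open>d\<close>-joined graph, then by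
  Menger's theorem at most \<open>d\<close> vertices separate them in \<open>G\<close>; no edge of the closure crosses this
  separation. So no \<open>(d + 1)\<close>-block contains both, and if both were in a \<open>d\<close>-separator, this
  separator and the separation would cross.

  Conversely, under the three conditions two nonadjacent vertices of the closure are separated by a
  clique of size \<open>d\<close>, so the closure, and with it \<open>G\<close>, is rigid as it is glued from complete graphs
  along cliques spanning hyperplanes. That globally linked pairs are adjacent or \<open>(d + 1)\<close>-linked
  follows by reflecting one side of a separation of order at most \<open>d\<close>.
\<close>

section \<open>Generic points and general position\<close>

text \<open>The predicate \<open>rigid\<close> speaks of actual nearby realizations, so a
  first-order flex at a single realization refutes nothing by itself. A rank argument at regular
  points of the length map is avoided: the velocities are given by formulas that preserve the edge
  lengths to first order at every realization near the generic one. Integrating them uses continuity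
  at that one point only, so no differential equation is solved. The formulas interpolate affine
  functionals at \<open>d + 1\<close> vertices, and general position of these vertices is what
  genericity supplies. Both \<open>rigid\<close> and \<open>globally_linked\<close> quantify over
  all generic realizations, so refuting either requires that one exists. Rigidity passes from the
  closure down to \<open>G\<close> because at a generic realization globally linked pairs keep their
  lengths in every equivalent realization; thus both graphs admit the same equivalent
  realizations.\<close>

abbreviation monomial_eval :: "('i \<Rightarrow> real) \<Rightarrow> ('i \<Rightarrow>\<^sub>0 nat) \<Rightarrow> real" where
  "monomial_eval a m \<equiv> (\<Prod>i\<in>Poly_Mapping.keys m. a i ^ Poly_Mapping.lookup m i)"

section \<open>Evaluation of polynomials as a ring homomorphism\<close>

lemma monomial_eval_superset:
  assumes "finite K" "Poly_Mapping.keys m \<subseteq> K"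
  shows "monomial_eval a m = (\<Prod>i\<in>K. a i ^ Poly_Mapping.lookup m i)"
  using assms by (intro prod.mono_neutral_left) (auto simp: in_keys_iff)

lemma monomial_eval_add: "monomial_eval a (m + n) = monomial_eval a m * monomial_eval a n"
proof -
  let ?K = "Poly_Mapping.keys m \<union> Poly_Mapping.keys n"
  have "monomial_eval a (m + n) = (\<Prod>i\<in>?K. a i ^ Poly_Mapping.lookup (m + n) i)"
    by (rule monomial_eval_superset) (auto simp: Poly_Mapping.keys_add)
  also have "\<dots> = (\<Prod>i\<in>?K. a i ^ Poly_Mapping.lookup m i) * (\<Prod>i\<in>?K. a i ^ Poly_Mapping.lookup n i)"
    by (simp add: lookup_add power_add prod.distrib)
  also have "\<dots> = monomial_eval a m * monomial_eval a n"
    using monomial_eval_superset[of ?K m a] monomial_eval_superset[of ?K n a] by simp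
  finally show ?thesis .
qed

lemma mpoly_eval_superset:
  assumes "finite K" "Poly_Mapping.keys f \<subseteq> K"
  shows "mpoly_eval a f = (\<Sum>m\<in>K. of_rat (Poly_Mapping.lookup f m) * monomial_eval a m)"
  unfolding mpoly_eval_def using assms
  by (intro sum.mono_neutral_left) (auto simp: in_keys_iff)

lemma mpoly_eval_zero [simp]: "mpoly_eval a 0 = 0"
  by (simp add: mpoly_eval_def)

lemma mpoly_eval_add: "mpoly_eval a (f + g) = mpoly_eval a f + mpoly_eval a g"
proof -
  let ?K = "Poly_Mapping.keys f \<union> Poly_Mapping.keys g"
  have "mpoly_eval a (f + g) =
      (\<Sum>m\<in>?K. of_rat (Poly_Mapping.lookup (f + g) m) * monomial_eval a m)"
    by (rule mpoly_eval_superset) (use Poly_Mapping.keys_add[of f g] in auto)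
  also have "\<dots> = mpoly_eval a f + mpoly_eval a g"
    by (simp add: mpoly_eval_superset[of ?K f] mpoly_eval_superset[of ?K g] lookup_add of_rat_add
        algebra_simps sum.distrib)
  finally show ?thesis .
qed

lemma mpoly_eval_sum: "mpoly_eval a (\<Sum>x\<in>A. f x) = (\<Sum>x\<in>A. mpoly_eval a (f x))"
  by (induction A rule: infinite_finite_induct) (simp_all add: mpoly_eval_add)

lemma mpoly_eval_single: "mpoly_eval a (Poly_Mapping.single m c) = of_rat c * monomial_eval a m"
  by (subst mpoly_eval_superset[where K = "{m}"]) auto

lemma poly_mapping_sum_singles:
  "(\<Sum>m\<in>Poly_Mapping.keys f. Poly_Mapping.single m (Poly_Mapping.lookup f m)) = f"
  by (rule poly_mapping_eqI) (auto simp: lookup_sum lookup_single when_def in_keys_iff)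

lemma mpoly_eval_mult: "mpoly_eval a (f * g) = mpoly_eval a f * mpoly_eval a g"
proof -
  have "f * g = (\<Sum>m\<in>Poly_Mapping.keys f. \<Sum>n\<in>Poly_Mapping.keys g.
      Poly_Mapping.single (m + n) (Poly_Mapping.lookup f m * Poly_Mapping.lookup g n))"
    unfolding mult_single[symmetric] sum_product[symmetric] poly_mapping_sum_singles ..
  then have "mpoly_eval a (f * g) = (\<Sum>m\<in>Poly_Mapping.keys f. \<Sum>n\<in>Poly_Mapping.keys g.
      (of_rat (Poly_Mapping.lookup f m) * monomial_eval a m) *
      (of_rat (Poly_Mapping.lookup g n) * monomial_eval a n))"
    by (simp only: mpoly_eval_sum mpoly_eval_single monomial_eval_add of_rat_mult mult_ac)
  then show ?thesis
    by (simp only: mpoly_eval_def sum_product)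
qed

section \<open>Rational polynomial functions\<close>

text \<open>Functions in place of polynomial mappings: closure rules alone then show that a
  determinant in the coordinates is polynomial.\<close>

definition poly_funs :: "'i set \<Rightarrow> (('i \<Rightarrow> real) \<Rightarrow> real) set" where
  "poly_funs I =
     {F. \<exists>f. (\<forall>m\<in>Poly_Mapping.keys f. Poly_Mapping.keys m \<subseteq> I) \<and> F = (\<lambda>a. mpoly_eval a f)}"

lemma poly_funs_const: "(\<lambda>a. of_rat c) \<in> poly_funs I"
  unfolding poly_funs_def
  by (auto intro!: exI[where x = "Poly_Mapping.single 0 c"] simp: mpoly_eval_single
      split: if_splits)

lemma poly_funs_of_int: "(\<lambda>a. of_int c) \<in> poly_funs I"
  using poly_funs_const[of "of_int c" I] by simp

lemma poly_funs_var: "i \<in> I \<Longrightarrow> (\<lambda>a. a i) \<in> poly_funs I"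
  unfolding poly_funs_def
  by (auto intro!: exI[where x = "Poly_Mapping.single (Poly_Mapping.single i 1) 1"]
      simp: mpoly_eval_single)

lemma poly_funs_add:
  assumes "F \<in> poly_funs I" "F' \<in> poly_funs I"
  shows "(\<lambda>a. F a + F' a) \<in> poly_funs I"
proof -
  obtain f f' where "\<forall>m\<in>Poly_Mapping.keys f. Poly_Mapping.keys m \<subseteq> I" "F = (\<lambda>a. mpoly_eval a f)"
    "\<forall>m\<in>Poly_Mapping.keys f'. Poly_Mapping.keys m \<subseteq> I" "F' = (\<lambda>a. mpoly_eval a f')"
    using assms by (auto simp: poly_funs_def)
  moreover have "Poly_Mapping.keys (f + f') \<subseteq> Poly_Mapping.keys f \<union> Poly_Mapping.keys f'"
    by (rule Poly_Mapping.keys_add)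
  ultimately show ?thesis
    unfolding poly_funs_def by (auto intro!: exI[where x = "f + f'"] simp: mpoly_eval_add)
qed

lemma poly_funs_mult:
  assumes "F \<in> poly_funs I" "F' \<in> poly_funs I"
  shows "(\<lambda>a. F a * F' a) \<in> poly_funs I"
proof -
  obtain f f' where f: "\<forall>m\<in>Poly_Mapping.keys f. Poly_Mapping.keys m \<subseteq> I" "F = (\<lambda>a. mpoly_eval a f)"
    "\<forall>m\<in>Poly_Mapping.keys f'. Poly_Mapping.keys m \<subseteq> I" "F' = (\<lambda>a. mpoly_eval a f')"
    using assms by (auto simp: poly_funs_def)
  have "Poly_Mapping.keys m \<subseteq> I" if m: "m \<in> Poly_Mapping.keys (f * f')" for m
  proof -
    obtain u v where "m = u + v" "u \<in> Poly_Mapping.keys f" "v \<in> Poly_Mapping.keys f'"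
      using m Poly_Mapping.keys_mult[of f f'] by blast
    then show ?thesis
      using f Poly_Mapping.keys_add[of u v] by blast
  qed
  then show ?thesis
    unfolding poly_funs_def using f
    by (auto intro!: exI[where x = "f * f'"] simp: mpoly_eval_mult)
qed

lemma poly_funs_diff:
  assumes "F \<in> poly_funs I" "F' \<in> poly_funs I"
  shows "(\<lambda>a. F a - F' a) \<in> poly_funs I"
  using poly_funs_add[OF assms(1) poly_funs_mult[OF poly_funs_of_int[of "-1"] assms(2)]] by simp

lemma poly_funs_sum: "(\<And>x. x \<in> A \<Longrightarrow> F x \<in> poly_funs I) \<Longrightarrow> (\<lambda>a. \<Sum>x\<in>A. F x a) \<in> poly_funs I"
  using poly_funs_of_int[of 0 I]
  by (induction A rule: infinite_finite_induct) (auto intro: poly_funs_add)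

lemma poly_funs_prod: "(\<And>x. x \<in> A \<Longrightarrow> F x \<in> poly_funs I) \<Longrightarrow> (\<lambda>a. \<Prod>x\<in>A. F x a) \<in> poly_funs I"
  using poly_funs_of_int[of 1 I]
  by (induction A rule: infinite_finite_induct) (auto intro: poly_funs_mult)

lemma poly_funs_det:
  fixes M :: "('i \<Rightarrow> real) \<Rightarrow> real ^ 'n ^ 'n"
  assumes "\<And>i j. (\<lambda>a. M a $ i $ j) \<in> poly_funs I"
  shows "(\<lambda>a. det (M a)) \<in> poly_funs I"
  unfolding det_def
  by (intro poly_funs_sum poly_funs_mult poly_funs_prod poly_funs_of_int assms)

text \<open>Vanishing at an algebraically independent point forces the zero polynomial, hence
  vanishing everywhere. One convenient point \<open>b\<close> therefore settles the matter for all
  generic points.\<close>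

lemma algebraically_independent_nonzero:
  assumes "algebraically_independent I a" "F \<in> poly_funs I" "F b \<noteq> 0"
  shows "F a \<noteq> 0"
proof
  assume "F a = 0"
  obtain f where f: "\<forall>m\<in>Poly_Mapping.keys f. Poly_Mapping.keys m \<subseteq> I" "F = (\<lambda>a. mpoly_eval a f)"
    using assms(2) by (auto simp: poly_funs_def)
  with assms(1) \<open>F a = 0\<close> have "f = 0"
    by (auto simp: algebraically_independent_def)
  with f(2) assms(3) show False by simp
qed

section \<open>Existence of algebraically independent points\<close>

text \<open>A finitely supported map is a sum of singles and so is coded by a finite list of pairs.
  This is applied twice, to monomials and to polynomials over them.\<close>

lemma countable_poly_mappings:
  fixes K :: "'k set"
  assumes "countable K" "countable (UNIV :: 'c set)"
  shows "countable {f :: 'k \<Rightarrow>\<^sub>0 'c::comm_monoid_add. Poly_Mapping.keys f \<subseteq> K}"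
proof (rule countable_subset)
  let ?s = "\<lambda>l. sum_list (map (\<lambda>(k, c). Poly_Mapping.single k (c :: 'c)) l)"
  show "countable (?s ` lists (K \<times> UNIV))"
    using assms by (intro countable_image countable_lists) auto
  show "{f :: 'k \<Rightarrow>\<^sub>0 'c. Poly_Mapping.keys f \<subseteq> K} \<subseteq> ?s ` lists (K \<times> UNIV)"
  proof
    fix f :: "'k \<Rightarrow>\<^sub>0 'c" assume "f \<in> {f. Poly_Mapping.keys f \<subseteq> K}"
    then have f: "Poly_Mapping.keys f \<subseteq> K" by simp
    obtain ks where ks: "set ks = Poly_Mapping.keys f" "distinct ks"
      using finite_distinct_list[of "Poly_Mapping.keys f"] by auto
    let ?l = "map (\<lambda>k. (k, Poly_Mapping.lookup f k)) ks"
    have "?s ?l = (\<Sum>k\<leftarrow>ks. Poly_Mapping.single k (Poly_Mapping.lookup f k))"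
      by (simp add: comp_def)
    also have "\<dots> = f"
      using ks poly_mapping_sum_singles[of f] by (simp add: sum_list_distinct_conv_sum_set)
    finally show "f \<in> ?s ` lists (K \<times> UNIV)"
      using f ks by (intro image_eqI[where x = ?l]) auto
  qed
qed

lemma countable_rat_mpolys:
  assumes "finite I"
  shows "countable {f :: 'i rat_mpoly. \<forall>m\<in>Poly_Mapping.keys f. Poly_Mapping.keys m \<subseteq> I}"
proof -
  have "countable {m :: 'i \<Rightarrow>\<^sub>0 nat. Poly_Mapping.keys m \<subseteq> I}"
    using assms by (intro countable_poly_mappings) (auto simp: countable_finite)
  then have "countable {f :: 'i rat_mpoly. Poly_Mapping.keys f \<subseteq> {m. Poly_Mapping.keys m \<subseteq> I}}"
    by (rule countable_poly_mappings) auto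
  then show ?thesis
    by (simp add: subset_iff Ball_def)
qed

text \<open>With the old variables fixed at \<open>a\<close>, \<open>f\<close> becomes a polynomial
  in one variable. One of its coefficients is a nonzero polynomial in the old variables evaluated at
  \<open>a\<close>, which independence keeps nonzero, so there are finitely many roots.\<close>

lemma finite_zeros_in_new_variable:
  fixes f :: "'i rat_mpoly"
  assumes indep: "algebraically_independent I a" and j: "j \<notin> I"
    and f: "\<forall>m\<in>Poly_Mapping.keys f. Poly_Mapping.keys m \<subseteq> insert j I" "f \<noteq> 0"
  shows "finite {x. mpoly_eval (a(j := x)) f = 0}"
proof -
  let ?rest = "\<lambda>m. Poly_Mapping.update j 0 (m :: 'i \<Rightarrow>\<^sub>0 nat)"
  let ?k = "\<lambda>m. Poly_Mapping.lookup (m :: 'i \<Rightarrow>\<^sub>0 nat) j"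
  have keys_rest: "Poly_Mapping.keys (?rest m) = Poly_Mapping.keys m - {j}" for m
    by (auto simp: in_keys_iff lookup_update split: if_splits)
  have mono: "monomial_eval (a(j := x)) m = monomial_eval a (?rest m) * x ^ ?k m" for x m
  proof -
    have "monomial_eval (a(j := x)) m =
        (\<Prod>i\<in>insert j (Poly_Mapping.keys m). (a(j := x)) i ^ Poly_Mapping.lookup m i)"
      by (rule monomial_eval_superset) auto
    also have "\<dots> = x ^ ?k m *
        (\<Prod>i\<in>Poly_Mapping.keys m - {j}. (a(j := x)) i ^ Poly_Mapping.lookup m i)"
      by (subst prod.insert_remove) auto
    also have "(\<Prod>i\<in>Poly_Mapping.keys m - {j}. (a(j := x)) i ^ Poly_Mapping.lookup m i) =
        monomial_eval a (?rest m)"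
      unfolding keys_rest by (intro prod.cong) (auto simp: lookup_update)
    finally show ?thesis by simp
  qed
  define P where "P = (\<Sum>m\<in>Poly_Mapping.keys f.
    monom (of_rat (Poly_Mapping.lookup f m) * monomial_eval a (?rest m)) (?k m))"
  have P: "poly P x = mpoly_eval (a(j := x)) f" for x
    unfolding P_def mpoly_eval_def poly_sum poly_monom mono by (simp add: mult.assoc)
  obtain m0 where m0: "m0 \<in> Poly_Mapping.keys f"
    using f(2) by fastforce
  define M where "M = {m \<in> Poly_Mapping.keys f. ?k m = ?k m0}"
  have finM: "finite M" by (simp add: M_def)
  \<comment> \<open>The coefficient of the power \<open>?k m0\<close> of the new variable, as a
    polynomial in the old ones. Monomials in \<open>M\<close> stay distinct when \<open>j\<close> is
    erased, so no terms cancel.\<close>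
  define g where "g = (\<Sum>m\<in>M. Poly_Mapping.single (?rest m) (Poly_Mapping.lookup f m))"
  have rest_inj: "m = m'" if "m \<in> M" "m' \<in> M" "?rest m = ?rest m'" for m m'
  proof (rule poly_mapping_eqI)
    fix i
    show "Poly_Mapping.lookup m i = Poly_Mapping.lookup m' i"
      using that(1,2) that(3)[THEN arg_cong, of "\<lambda>h. Poly_Mapping.lookup h i"]
      by (cases "i = j") (simp_all add: M_def lookup_update)
  qed
  have "Poly_Mapping.lookup g (?rest m0) =
      (\<Sum>m\<in>M. if m = m0 then Poly_Mapping.lookup f m else 0)"
    unfolding g_def lookup_sum
  proof (intro sum.cong refl)
    fix m assume "m \<in> M"
    moreover have "m0 \<in> M" using m0 by (simp add: M_def)
    ultimately have "?rest m = ?rest m0 \<longleftrightarrow> m = m0" using rest_inj by blast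
    then show "Poly_Mapping.lookup (Poly_Mapping.single (?rest m) (Poly_Mapping.lookup f m)) (?rest m0) =
        (if m = m0 then Poly_Mapping.lookup f m else 0)"
      by (simp add: lookup_single when_def)
  qed
  then have "Poly_Mapping.lookup g (?rest m0) = Poly_Mapping.lookup f m0"
    using finM m0 by (simp add: M_def)
  then have "g \<noteq> 0" using m0 by (auto simp: in_keys_iff)
  moreover have "\<forall>m\<in>Poly_Mapping.keys g. Poly_Mapping.keys m \<subseteq> I"
  proof
    fix m assume "m \<in> Poly_Mapping.keys g"
    then have "m \<in> (\<Union>m\<in>M. Poly_Mapping.keys (Poly_Mapping.single (?rest m) (Poly_Mapping.lookup f m)))"
      unfolding g_def by (rule subsetD[OF keys_sum])
    then obtain m' where "m' \<in> M" "m = ?rest m'" by (auto split: if_splits)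
    then show "Poly_Mapping.keys m \<subseteq> I"
      using f(1) keys_rest[of m'] by (auto simp: M_def)
  qed
  ultimately have "mpoly_eval a g \<noteq> 0"
    using indep unfolding algebraically_independent_def by blast
  moreover have "coeff P (?k m0) = mpoly_eval a g"
    unfolding P_def g_def M_def coeff_sum mpoly_eval_sum mpoly_eval_single coeff_monom
    by (rule sum.inter_filter[symmetric]) simp
  ultimately have "P \<noteq> 0" by auto
  then have "finite {x. poly P x = 0}" by (rule poly_roots_finite)
  then show ?thesis by (simp add: P)
qed

text \<open>Coordinates are added one at a time: each of countably many nonzero polynomials excludes
  finitely many values of the new coordinate, and the reals are uncountable.\<close>

lemma algebraically_independent_exists:
  assumes "finite I"
  shows "\<exists>a. algebraically_independent I a"
  using assms
proof (induction I rule: finite_induct)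
  case empty
  show ?case
  proof (intro exI allI impI, unfold algebraically_independent_def, intro allI impI)
    fix f :: "'a rat_mpoly"
    assume f: "\<forall>m\<in>Poly_Mapping.keys f. Poly_Mapping.keys m \<subseteq> {}" "mpoly_eval (\<lambda>_. 0) f = 0"
    have "Poly_Mapping.keys f \<subseteq> {0}"
    proof
      fix m assume "m \<in> Poly_Mapping.keys f"
      with f(1) have "Poly_Mapping.keys m = {}" by simp
      then show "m \<in> {0}" by (simp only: keys_eq_empty) simp
    qed
    then have "mpoly_eval (\<lambda>_. 0) f = of_rat (Poly_Mapping.lookup f 0)"
      by (subst mpoly_eval_superset[where K = "{0}"]) auto
    with f(2) have "Poly_Mapping.lookup f 0 = 0" by simp
    then have "0 \<notin> Poly_Mapping.keys f" by (simp add: in_keys_iff)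
    with \<open>Poly_Mapping.keys f \<subseteq> {0}\<close> have "Poly_Mapping.keys f = {}" by blast
    then show "f = 0" by simp
  qed
next
  case (insert j I)
  then obtain a where a: "algebraically_independent I a" by blast
  let ?F = "{f :: 'a rat_mpoly. \<forall>m\<in>Poly_Mapping.keys f. Poly_Mapping.keys m \<subseteq> insert j I} - {0}"
  have "countable (\<Union>f\<in>?F. {x. mpoly_eval (a(j := x)) f = 0})"
    using insert(1) finite_zeros_in_new_variable[OF a insert(2)]
    by (intro countable_UN countable_Diff countable_rat_mpolys) (auto intro!: countable_finite)
  then have "\<not> UNIV \<subseteq> (\<Union>f\<in>?F. {x. mpoly_eval (a(j := x)) f = 0})"
    using countable_subset[of UNIV "\<Union>f\<in>?F. {x. mpoly_eval (a(j := x)) f = 0}"]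
      uncountable_UNIV_real by argo
  then obtain x where "\<forall>f\<in>?F. mpoly_eval (a(j := x)) f \<noteq> 0" by blast
  then have "algebraically_independent (insert j I) (a(j := x))"
    unfolding algebraically_independent_def by (intro allI impI) (rule ccontr, simp)
  then show ?case by blast
qed

lemma generic_exists:
  assumes "finite (pverts G)"
  shows "\<exists>p :: 'a \<Rightarrow> real ^ 'd::finite. generic G p"
proof -
  obtain a where "algebraically_independent (pverts G \<times> (UNIV :: 'd set)) a"
    using algebraically_independent_exists[of "pverts G \<times> (UNIV :: 'd set)"] assms by auto
  then have "generic G (\<lambda>v. \<chi> i. a (v, i))"
    by (simp add: generic_def case_prod_beta)
  then show ?thesis by blast
qed

section \<open>General position of generic points\<close>

text \<open>The rows are the edge vectors at \<open>v0\<close> of a simplex; the matrix is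
  nonsingular iff the \<open>d + 1\<close> points are affinely independent.\<close>

definition simplex_matrix :: "('a \<Rightarrow> real ^ 'd::finite) \<Rightarrow> 'a \<Rightarrow> ('d \<Rightarrow> 'a) \<Rightarrow> real ^ 'd ^ 'd" where
  "simplex_matrix q v0 \<tau> = (\<chi> i. q (\<tau> i) - q v0)"

lemma generic_det_simplex_matrix:
  fixes p :: "'a \<Rightarrow> real ^ 'd::finite"
  assumes "generic G p" "v0 \<in> pverts G" "range \<tau> \<subseteq> pverts G" "inj \<tau>" "v0 \<notin> range \<tau>"
  shows "det (simplex_matrix p v0 \<tau>) \<noteq> 0"
proof -
  let ?I = "pverts G \<times> (UNIV :: 'd set)"
  let ?p = "\<lambda>b :: 'a \<times> 'd \<Rightarrow> real. \<lambda>v. \<chi> i. b (v, i)"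
  let ?F = "\<lambda>b. det (simplex_matrix (?p b) v0 \<tau>)"
  \<comment> \<open>The standard simplex: \<open>v0\<close> is placed at the origin and
    \<open>\<tau> i\<close> at the unit vector with index \<open>i\<close>.\<close>
  define b where "b = (\<lambda>(v, i). if v = \<tau> i then 1 else 0 :: real)"
  have "simplex_matrix (?p b) v0 \<tau> = mat 1"
    using assms(4,5) by (auto simp: simplex_matrix_def b_def mat_def vec_eq_iff inj_eq)
  then have "?F b \<noteq> 0" by simp
  moreover have "?F \<in> poly_funs ?I"
  proof (rule poly_funs_det)
    fix i j
    show "(\<lambda>b. simplex_matrix (?p b) v0 \<tau> $ i $ j) \<in> poly_funs ?I"
      using assms(2,3) by (auto simp: simplex_matrix_def intro!: poly_funs_diff poly_funs_var)
  qed
  ultimately have "?F (\<lambda>(v, i). p v $ i) \<noteq> 0"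
    using assms(1) algebraically_independent_nonzero unfolding generic_def by blast
  then show ?thesis by simp
qed

section \<open>Affine interpolation at moving points\<close>

text \<open>Affine functionals are coded by their coefficients, so they inherit vector space
  structure and topology from the product, and their convergence makes sense.\<close>

definition aff :: "'b::real_inner \<times> real \<Rightarrow> 'b \<Rightarrow> real" where
  "aff c z = fst c \<bullet> z + snd c"

lemma aff_diff: "aff (c - c') z = aff c z - aff c' z"
  by (simp add: aff_def inner_diff_left)

lemma aff_zero [simp]: "aff 0 z = 0"
  by (simp add: aff_def)

lemma aff_scaleR: "aff (r *\<^sub>R c) z = r * aff c z"
  by (simp add: aff_def algebra_simps)

lemma tendsto_aff:
  "(f \<longlongrightarrow> c) F \<Longrightarrow> (g \<longlongrightarrow> z) F \<Longrightarrow> ((\<lambda>x. aff (f x) (g x)) \<longlongrightarrow> aff c z) F"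
  unfolding aff_def by (intro tendsto_intros)

text \<open>Cramer's rule shows that the interpolating functional depends continuously on the points.\<close>

definition interpol ::
  "('a \<Rightarrow> real ^ 'd::finite) \<Rightarrow> 'a \<Rightarrow> ('d \<Rightarrow> 'a) \<Rightarrow> ('a \<Rightarrow> real) \<Rightarrow> (real ^ 'd) \<times> real" where
  "interpol q v0 \<tau> g =
     (let M = simplex_matrix q v0 \<tau>;
          n = (\<chi> k. det (\<chi> i j. if j = k then g (\<tau> i) - g v0 else M $ i $ j) / det M)
      in (n, g v0 - n \<bullet> q v0))"

lemma simplex_matrix_mult:
  "(simplex_matrix q v0 \<tau> *v n) $ i = n \<bullet> q (\<tau> i) - n \<bullet> q v0"
  by (simp add: simplex_matrix_def matrix_vector_mult_def inner_vec_def algebra_simps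
      sum_subtractf)

lemma aff_interpol:
  assumes "det (simplex_matrix q v0 \<tau>) \<noteq> 0" "v \<in> insert v0 (range \<tau>)"
  shows "aff (interpol q v0 \<tau> g) (q v) = g v"
proof -
  let ?M = "simplex_matrix q v0 \<tau>"
  define n where "n = (\<chi> k. det (\<chi> i j. if j = k then g (\<tau> i) - g v0 else ?M $ i $ j) / det ?M)"
  have "?M *v n = (\<chi> i. g (\<tau> i) - g v0)"
    using cramer[OF assms(1), of n "\<chi> i. g (\<tau> i) - g v0"] by (simp add: n_def cong: if_cong)
  then have "n \<bullet> q (\<tau> i) - n \<bullet> q v0 = g (\<tau> i) - g v0" for i
    unfolding simplex_matrix_mult[symmetric] by simp
  moreover have "interpol q v0 \<tau> g = (n, g v0 - n \<bullet> q v0)"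
    by (simp add: interpol_def n_def Let_def)
  ultimately show ?thesis using assms(2) by (auto simp: aff_def algebra_simps)
qed

lemma aff_eq_0_on_simplex:
  assumes "det (simplex_matrix q v0 \<tau>) \<noteq> 0" "\<And>v. v \<in> insert v0 (range \<tau>) \<Longrightarrow> aff c (q v) = 0"
  shows "c = 0"
proof -
  have "simplex_matrix q v0 \<tau> *v fst c = 0"
    using assms(2) by (auto simp: vec_eq_iff simplex_matrix_mult aff_def algebra_simps
        intro: add_right_imp_eq[of _ "snd c"])
  then have "fst c = 0"
    using assms(1) by (metis invertible_det_nz invertible_def matrix_vector_mul_assoc
        matrix_vector_mul_lid matrix_vector_mult_0_right)
  with assms(2)[of v0] show ?thesis by (simp add: aff_def prod_eq_iff)
qed

lemma tendsto_coordinate: "((\<lambda>q. q v) \<longlongrightarrow> p v) (nhds (p :: 'a \<Rightarrow> 'b::topological_space))"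
proof (rule topological_tendstoI)
  fix U :: "'b set" assume "open U" "p v \<in> U"
  then show "\<forall>\<^sub>F q in nhds p. q v \<in> U"
    using open_vimage[OF \<open>open U\<close> continuous_on_product_coordinates[of v]]
    unfolding eventually_nhds by (intro exI[of _ "(\<lambda>q. q v) -` U"]) auto
qed

lemma tendsto_det:
  fixes M :: "'x \<Rightarrow> real ^ 'n ^ 'n"
  assumes "\<And>i j. ((\<lambda>x. M x $ i $ j) \<longlongrightarrow> A $ i $ j) F"
  shows "((\<lambda>x. det (M x)) \<longlongrightarrow> det A) F"
  unfolding det_def by (intro tendsto_intros assms)

lemma tendsto_interpol:
  fixes p :: "'a \<Rightarrow> real ^ 'd::finite"
  assumes nz: "det (simplex_matrix p v0 \<tau>) \<noteq> 0"
    and g: "\<And>v. v \<in> insert v0 (range \<tau>) \<Longrightarrow> ((\<lambda>q. g q v) \<longlongrightarrow> g p v) (nhds p)"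
  shows "((\<lambda>q. interpol q v0 \<tau> (g q)) \<longlongrightarrow> interpol p v0 \<tau> (g p)) (nhds p)"
proof -
  have M: "((\<lambda>q. simplex_matrix q v0 \<tau> $ i $ j) \<longlongrightarrow> simplex_matrix p v0 \<tau> $ i $ j) (nhds p)" for i j
    unfolding simplex_matrix_def by (auto intro!: tendsto_intros tendsto_coordinate)
  let ?n = "\<lambda>q. \<chi> k. det (\<chi> i j. if j = k then g q (\<tau> i) - g q v0 else simplex_matrix q v0 \<tau> $ i $ j)
      / det (simplex_matrix q v0 \<tau>)"
  have n: "(?n \<longlongrightarrow> ?n p) (nhds p)"
  proof (rule vec_tendstoI)
    fix k
    have "((\<lambda>q. det (\<chi> i j. if j = k then g q (\<tau> i) - g q v0 else simplex_matrix q v0 \<tau> $ i $ j))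
        \<longlongrightarrow> det (\<chi> i j. if j = k then g p (\<tau> i) - g p v0 else simplex_matrix p v0 \<tau> $ i $ j)) (nhds p)"
      using M g by (intro tendsto_det) (auto intro!: tendsto_intros)
    then show "((\<lambda>q. ?n q $ k) \<longlongrightarrow> ?n p $ k) (nhds p)"
      using nz M by (simp add: tendsto_divide tendsto_det)
  qed
  show ?thesis
    unfolding interpol_def Let_def using g
    by (intro tendsto_Pair n tendsto_diff tendsto_inner tendsto_coordinate) auto
qed

lemma frame_exists:
  fixes P :: "'a set"
  assumes "card P = CARD('d::finite) + 1"
  obtains v0 and \<tau> :: "'d::finite \<Rightarrow> 'a" where "inj \<tau>" "v0 \<notin> range \<tau>" "insert v0 (range \<tau>) = P"
proof -
  from assms obtain v0 Q where Q: "P = insert v0 Q" "v0 \<notin> Q" "card Q = CARD('d)" "finite Q"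
    by (metis Suc_eq_plus1 card_Suc_eq card.infinite Zero_not_Suc finite_insert)
  then obtain \<tau> :: "'d \<Rightarrow> 'a" where "bij_betw \<tau> UNIV Q"
    using finite_same_card_bij[of "UNIV :: 'd set" Q] by auto
  with Q that show ?thesis by (metis bij_betw_def)
qed

text \<open>The determinant at \<open>p\<close> is nonzero and stays so nearby, so interpolation
  works at all realizations near \<open>p\<close>, not only at \<open>p\<close>. Letting the
  prescribed values depend on \<open>q\<close> allows one interpolated functional to enter the
  definition of another.\<close>

lemma generic_interpolation:
  fixes p :: "'a \<Rightarrow> real ^ 'd::finite"
  assumes "generic G p" "P \<subseteq> pverts G" "card P = CARD('d) + 1"
  obtains L :: "('a \<Rightarrow> real ^ 'd) \<Rightarrow> ('a \<Rightarrow> real) \<Rightarrow> (real ^ 'd) \<times> real" where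
    "\<forall>\<^sub>F q in nhds p. \<forall>g. \<forall>v\<in>P. aff (L q g) (q v) = g v"
    "\<And>g. (\<And>v. v \<in> P \<Longrightarrow> ((\<lambda>q. g q v) \<longlongrightarrow> g p v) (nhds p)) \<Longrightarrow>
       ((\<lambda>q. L q (g q)) \<longlongrightarrow> L p (g p)) (nhds p)"
proof -
  obtain v0 and \<tau> :: "'d::finite \<Rightarrow> 'a" where \<tau>: "inj \<tau>" "v0 \<notin> range \<tau>" "insert v0 (range \<tau>) = P"
    using frame_exists[OF assms(3)] .
  have nz: "det (simplex_matrix p v0 \<tau>) \<noteq> 0"
    using assms(1,2) \<tau> by (intro generic_det_simplex_matrix) auto
  show ?thesis
  proof (rule that[of "\<lambda>q. interpol q v0 \<tau>"])
    have "((\<lambda>q. det (simplex_matrix q v0 \<tau>)) \<longlongrightarrow> det (simplex_matrix p v0 \<tau>)) (nhds p)"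
      by (intro tendsto_det) (auto simp: simplex_matrix_def intro!: tendsto_intros tendsto_coordinate)
    then have "\<forall>\<^sub>F q in nhds p. det (simplex_matrix q v0 \<tau>) \<noteq> 0"
      using nz by (rule tendsto_imp_eventually_ne)
    then show "\<forall>\<^sub>F q in nhds p. \<forall>g. \<forall>v\<in>P. aff (interpol q v0 \<tau> g) (q v) = g v"
      by eventually_elim (use \<tau>(3) in \<open>auto simp: aff_interpol\<close>)
  next
    fix g :: "('a \<Rightarrow> real ^ 'd) \<Rightarrow> 'a \<Rightarrow> real"
    assume "\<And>v. v \<in> P \<Longrightarrow> ((\<lambda>q. g q v) \<longlongrightarrow> g p v) (nhds p)"
    then show "((\<lambda>q. interpol q v0 \<tau> (g q)) \<longlongrightarrow> interpol p v0 \<tau> (g p)) (nhds p)"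
      using nz \<tau>(3) by (intro tendsto_interpol) auto
  qed
qed

lemma generic_interpolate:
  fixes p :: "'a \<Rightarrow> real ^ 'd::finite"
  assumes "generic G p" "P \<subseteq> pverts G" "card P = CARD('d) + 1"
  obtains c where "\<And>v. v \<in> P \<Longrightarrow> aff c (p v) = g v"
proof (rule generic_interpolation[OF assms])
  fix L assume "\<forall>\<^sub>F q in nhds p. \<forall>g. \<forall>v\<in>P. aff (L q g) (q v) = g v"
  then have "\<forall>g. \<forall>v\<in>P. aff (L p g) (p v) = g v"
    by (rule eventually_nhds_x_imp_x)
  then show thesis by (intro that[of "L p g"]) simp
qed

lemma generic_aff_eq_0:
  fixes p :: "'a \<Rightarrow> real ^ 'd::finite"
  assumes "generic G p" "P \<subseteq> pverts G" "card P = CARD('d) + 1"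
    and "\<And>v. v \<in> P \<Longrightarrow> aff c (p v) = 0"
  shows "c = 0"
proof -
  obtain v0 and \<tau> :: "'d::finite \<Rightarrow> 'a" where \<tau>: "inj \<tau>" "v0 \<notin> range \<tau>" "insert v0 (range \<tau>) = P"
    using frame_exists[OF assms(3)] .
  have "det (simplex_matrix p v0 \<tau>) \<noteq> 0"
    using assms(1,2) \<tau> by (intro generic_det_simplex_matrix) auto
  then show ?thesis
    by (rule aff_eq_0_on_simplex) (use \<tau>(3) assms(4) in blast)
qed

text \<open>The zero set of \<open>c\<close> is the hyperplane through the \<open>d\<close> points
  of \<open>S\<close>, and general position keeps every further vertex off it.\<close>

lemma generic_aff_nonzero:
  fixes p :: "'a \<Rightarrow> real ^ 'd::finite"
  assumes "generic G p" "S \<subseteq> pverts G" "finite S" "card S = CARD('d)"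
    and "\<And>v. v \<in> S \<Longrightarrow> aff c (p v) = 0" "c \<noteq> 0" "x \<in> pverts G" "x \<notin> S"
  shows "aff c (p x) \<noteq> 0"
  using generic_aff_eq_0[of G p "insert x S" c] assms by auto

section \<open>Infinitesimal motions of a generic realization\<close>

text \<open>
  The two-form of a pair of affine functionals, viewed as a skew form in homogeneous coordinates,
  and the associated infinitesimal isometry.
\<close>

definition form2 :: "'b::real_inner \<times> real \<Rightarrow> 'b \<times> real \<Rightarrow> 'b \<Rightarrow> 'b \<Rightarrow> real" where
  "form2 a b z z' = aff a z * aff b z' - aff a z' * aff b z"

definition field2 :: "'b::real_inner \<times> real \<Rightarrow> 'b \<times> real \<Rightarrow> 'b \<Rightarrow> 'b" where
  "field2 a b z = aff a z *\<^sub>R fst b - aff b z *\<^sub>R fst a"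

lemma inner_field2: "(z' - z) \<bullet> field2 a b z = form2 a b z z'"
  by (simp add: field2_def form2_def aff_def inner_diff_left inner_diff_right inner_commute
      algebra_simps)

lemma inner_field2': "(z - z') \<bullet> field2 a b z = - form2 a b z z'"
  by (metis inner_field2 inner_minus_left minus_diff_eq)

text \<open>By \<open>inner_field2\<close> the velocities at both ends have the same component along
  the segment, since \<open>form2\<close> is skew in its two points.\<close>

lemma field2_isometry: "(z - z') \<bullet> (field2 a b z - field2 a b z') = 0"
  by (simp only: inner_diff_right inner_field2 inner_field2' form2_def)

lemma field2_eq_0: "aff a z = 0 \<Longrightarrow> aff b z = 0 \<Longrightarrow> field2 a b z = 0"
  by (simp add: field2_def)

lemma tendsto_field2:
  assumes "(f \<longlongrightarrow> a) F" "(g \<longlongrightarrow> b) F" "(h \<longlongrightarrow> z) F"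
  shows "((\<lambda>x. field2 (f x) (g x) (h x)) \<longlongrightarrow> field2 a b z) F"
  unfolding field2_def using assms by (intro tendsto_intros tendsto_aff)

section \<open>Boxes of realizations in the product topology\<close>

text \<open>The vertex type may be infinite. Pinning the coordinates outside the finite set
  \<open>V\<close> to those of \<open>p\<close> leaves finitely many radii, which have a positive
  minimum.\<close>

lemma nhds_fun_box:
  fixes p :: "'a \<Rightarrow> 'b::metric_space"
  assumes "eventually Q (nhds p)" "finite V"
  obtains r where "r > 0" "\<And>q. (\<And>v. v \<in> V \<Longrightarrow> dist (p v) (q v) < r) \<Longrightarrow> (\<And>v. v \<notin> V \<Longrightarrow> q v = p v) \<Longrightarrow> Q q"
proof -
  obtain U where U: "open U" "p \<in> U" "\<And>q. q \<in> U \<Longrightarrow> Q q"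
    using assms(1) by (auto simp: eventually_nhds)
  obtain X where X: "p \<in> Pi\<^sub>E UNIV X" "\<And>v. open (X v)" "Pi\<^sub>E UNIV X \<subseteq> U"
    using product_topology_open_contains_basis[of "\<lambda>_. euclidean" UNIV U p] U
    by (auto simp: open_fun_def)
  have "\<exists>r>0. ball (p v) r \<subseteq> X v" for v
    using X(1,2) by (auto simp: open_contains_ball PiE_iff)
  then obtain r where r: "\<And>v. r v > 0" "\<And>v. ball (p v) (r v) \<subseteq> X v" by metis
  \<comment> \<open>The inserted 1 keeps \<open>Min\<close> meaningful when \<open>V\<close> is
    empty.\<close>
  define \<rho> where "\<rho> = Min (insert 1 (r ` V))"
  have \<rho>: "\<rho> > 0" "\<And>v. v \<in> V \<Longrightarrow> \<rho> \<le> r v"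
    using assms(2) r(1) by (auto simp: \<rho>_def Min_gr_iff)
  show ?thesis
  proof (rule that[OF \<rho>(1)])
    fix q assume q: "\<And>v. v \<in> V \<Longrightarrow> dist (p v) (q v) < \<rho>" "\<And>v. v \<notin> V \<Longrightarrow> q v = p v"
    have "q v \<in> X v" for v
    proof (cases "v \<in> V")
      case True
      then have "q v \<in> ball (p v) (r v)" using q(1) \<rho>(2) by (force simp: mem_ball)
      then show ?thesis using r(2) by blast
    next
      case False
      then show ?thesis using q(2) X(1) by (auto simp: PiE_iff)
    qed
    then show "Q q" using X(3) U(3) by (auto simp: PiE_iff)
  qed
qed

text \<open>By Tychonoff's theorem, as a product of closed balls and singletons.\<close>

lemma compact_fun_box:
  fixes p :: "'a \<Rightarrow> 'b::heine_borel"
  shows "compact {q. \<forall>v. if v \<in> V then dist (p v) (q v) \<le> r else q v = p v}"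
proof -
  have "{q. \<forall>v. if v \<in> V then dist (p v) (q v) \<le> r else q v = p v} =
      Pi\<^sub>E UNIV (\<lambda>v. if v \<in> V then cball (p v) r else {p v})"
    by (auto simp: PiE_iff fun_eq_iff split: if_splits)
  then show ?thesis
    using compactin_PiE[of "\<lambda>_::'a. euclidean :: 'b topology" UNIV]
    by (simp add: euclidean_product_topology)
qed

lemma sqnorm_step:
  fixes a b :: "'b::real_inner"
  shows "(norm (a + h *\<^sub>R b))\<^sup>2 = (norm a)\<^sup>2 + 2 * h * (a \<bullet> b) + h\<^sup>2 * (norm b)\<^sup>2"
  unfolding power2_norm_eq_inner
  by (simp add: inner_add_left inner_add_right inner_commute power2_eq_square algebra_simps)

text \<open>
  The Euler polygons of an infinitesimal flex \<open>u\<close>: with step length \<open>\<tau> / N\<close> the edge lengths are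
  off by \<open>O(1 / N)\<close> only, while the length of \<open>xy\<close> grows by a fixed amount.
\<close>

lemma euler_polygon:
  fixes p :: "'a \<Rightarrow> 'b::euclidean_space"
  assumes V: "x \<in> V" "y \<in> V" "E \<subseteq> V \<times> V"
    and pos: "\<tau> > 0" "C * \<tau> \<le> r" "C \<ge> 0" "m \<ge> 0" "N > 0"
    and step: "\<And>q. (\<forall>v. if v \<in> V then dist (p v) (q v) \<le> r else q v = p v) \<Longrightarrow>
      (\<forall>v\<in>V. norm (u q v) \<le> C) \<and> (\<forall>(a, b)\<in>E. (q a - q b) \<bullet> (u q a - u q b) = 0) \<and>
      (q x - q y) \<bullet> (u q x - u q y) \<ge> m"
  shows "\<exists>q. (\<forall>v. if v \<in> V then dist (p v) (q v) \<le> r else q v = p v) \<and>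
    (\<forall>(a, b)\<in>E. \<bar>(norm (q a - q b))\<^sup>2 - (norm (p a - p b))\<^sup>2\<bar> \<le> 4 * C\<^sup>2 * \<tau>\<^sup>2 / real N) \<and>
    (norm (q x - q y))\<^sup>2 \<ge> (norm (p x - p y))\<^sup>2 + 2 * \<tau> * m"
proof -
  define h where "h = \<tau> / real N"
  have h: "h > 0" "real N * h = \<tau>" using pos by (auto simp: h_def)
  \<comment> \<open>Vertices outside \<open>V\<close> never move, so the polygon remains in the box
    on which \<open>step\<close> gives information.\<close>
  define Q where "Q = rec_nat p (\<lambda>_ q v. if v \<in> V then q v + h *\<^sub>R u q v else q v)"
  have Q: "Q 0 = p" "Q (Suc k) v = (if v \<in> V then Q k v + h *\<^sub>R u (Q k) v else Q k v)" for k v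
    by (simp_all add: Q_def)
  \<comment> \<open>Since \<open>u\<close> preserves edge lengths to first order, one step changes
    the square of an edge length only by the quadratic term, at most
    \<open>h\<^sup>2 * (2 * C)\<^sup>2\<close>, whereas the square for \<open>xy\<close> gains at
    least \<open>2 * h * m\<close>.\<close>
  have "k \<le> N \<Longrightarrow> (\<forall>v. if v \<in> V then dist (p v) (Q k v) \<le> real k * h * C else Q k v = p v) \<and>
      (\<forall>(a, b)\<in>E. \<bar>(norm (Q k a - Q k b))\<^sup>2 - (norm (p a - p b))\<^sup>2\<bar> \<le> real k * (h\<^sup>2 * (4 * C\<^sup>2))) \<and>
      (norm (Q k x - Q k y))\<^sup>2 \<ge> (norm (p x - p y))\<^sup>2 + real k * (2 * h * m)" for k
  proof (induction k)
    case 0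
    show ?case by (simp add: Q split_beta)
  next
    case (Suc k)
    let ?q = "Q k"
    note IH = Suc.IH[OF Suc_leD[OF Suc.prems]]
    have "real k * h * C \<le> real N * h * C"
      using Suc.prems h pos by (intro mult_right_mono) auto
    also have "\<dots> \<le> r" using h(2) pos(2) by (simp add: mult.commute)
    finally have kr: "real k * h * C \<le> r" .
    have box: "\<forall>v. if v \<in> V then dist (p v) (?q v) \<le> r else ?q v = p v"
    proof
      fix v
      show "if v \<in> V then dist (p v) (?q v) \<le> r else ?q v = p v"
        using conjunct1[OF IH, THEN spec, of v] kr by (auto split: if_splits)
    qed
    note s = step[OF box]
    have "if v \<in> V then dist (p v) (Q (Suc k) v) \<le> real (Suc k) * h * C else Q (Suc k) v = p v" for v
    proof (cases "v \<in> V")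
      case True
      have "dist (p v) (Q (Suc k) v) \<le> dist (p v) (?q v) + dist (?q v) (Q (Suc k) v)"
        by (rule dist_triangle)
      also have "dist (?q v) (Q (Suc k) v) = h * norm (u ?q v)"
        using True h by (simp add: Q dist_norm)
      also have "\<dots> \<le> h * C" using s True h by (intro mult_left_mono) auto
      finally show ?thesis
        using True conjunct1[OF IH, THEN spec, of v] by (simp add: algebra_simps)
    next
      case False
      then show ?thesis using box by (auto simp: Q split: if_splits)
    qed
    moreover have len: "(norm (Q (Suc k) a - Q (Suc k) b))\<^sup>2 = (norm (?q a - ?q b))\<^sup>2 +
        2 * h * ((?q a - ?q b) \<bullet> (u ?q a - u ?q b)) + h\<^sup>2 * (norm (u ?q a - u ?q b))\<^sup>2"
      if "a \<in> V" "b \<in> V" for a b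
      using sqnorm_step[of "?q a - ?q b" h "u ?q a - u ?q b"] that
      by (simp add: Q algebra_simps)
    have "\<bar>(norm (Q (Suc k) a - Q (Suc k) b))\<^sup>2 - (norm (p a - p b))\<^sup>2\<bar> \<le>
        real (Suc k) * (h\<^sup>2 * (4 * C\<^sup>2))" if ab: "(a, b) \<in> E" for a b
    proof -
      have abV: "a \<in> V" "b \<in> V" using ab V by auto
      have "norm (u ?q a) \<le> C" "norm (u ?q b) \<le> C" using s abV by auto
      then have "norm (u ?q a - u ?q b) \<le> C + C"
        using norm_triangle_ineq4[of "u ?q a" "u ?q b"] by linarith
      then have "(norm (u ?q a - u ?q b))\<^sup>2 \<le> (2 * C)\<^sup>2" by (intro power_mono) auto
      then have "h\<^sup>2 * (norm (u ?q a - u ?q b))\<^sup>2 \<le> h\<^sup>2 * (4 * C\<^sup>2)"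
        by (intro mult_left_mono) (auto simp: power_mult_distrib)
      moreover have "(norm (Q (Suc k) a - Q (Suc k) b))\<^sup>2 =
          (norm (?q a - ?q b))\<^sup>2 + h\<^sup>2 * (norm (u ?q a - u ?q b))\<^sup>2"
        using len[OF abV] s ab by auto
      moreover have "h\<^sup>2 * (norm (u ?q a - u ?q b))\<^sup>2 \<ge> 0" by simp
      moreover have "\<bar>(norm (?q a - ?q b))\<^sup>2 - (norm (p a - p b))\<^sup>2\<bar> \<le> real k * (h\<^sup>2 * (4 * C\<^sup>2))"
        using IH ab by auto
      moreover have "real (Suc k) * (h\<^sup>2 * (4 * C\<^sup>2)) = real k * (h\<^sup>2 * (4 * C\<^sup>2)) + h\<^sup>2 * (4 * C\<^sup>2)"
        by (simp add: distrib_right)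
      ultimately show ?thesis by linarith
    qed
    moreover have "(norm (Q (Suc k) x - Q (Suc k) y))\<^sup>2 \<ge> (norm (p x - p y))\<^sup>2 + real (Suc k) * (2 * h * m)"
    proof -
      have "2 * h * m \<le> 2 * h * ((?q x - ?q y) \<bullet> (u ?q x - u ?q y))"
        using s h by (intro mult_left_mono) auto
      moreover have "h\<^sup>2 * (norm (u ?q x - u ?q y))\<^sup>2 \<ge> 0" by simp
      moreover have "real (Suc k) * (2 * h * m) = real k * (2 * h * m) + 2 * h * m"
        by (simp add: distrib_right)
      ultimately show ?thesis using len[OF V(1,2)] IH by linarith
    qed
    ultimately show ?case by blast
  qed
  from this[of N] have
    1: "\<forall>v. if v \<in> V then dist (p v) (Q N v) \<le> real N * h * C else Q N v = p v" and
    2: "\<forall>(a, b)\<in>E. \<bar>(norm (Q N a - Q N b))\<^sup>2 - (norm (p a - p b))\<^sup>2\<bar> \<le> real N * (h\<^sup>2 * (4 * C\<^sup>2))" and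
    3: "(norm (Q N x - Q N y))\<^sup>2 \<ge> (norm (p x - p y))\<^sup>2 + real N * (2 * h * m)"
    by simp_all
  have "real N * h * C \<le> r" using h(2) pos(2) by (simp add: mult.commute)
  moreover have "real N * (h\<^sup>2 * (4 * C\<^sup>2)) = 4 * C\<^sup>2 * \<tau>\<^sup>2 / real N"
    using pos(5) by (simp add: h_def power_divide power2_eq_square)
  moreover have "real N * (2 * h * m) = 2 * \<tau> * m" using h(2) by (simp add: mult.assoc[symmetric] mult.commute)
  ultimately show ?thesis
    using 1 2 3 by (intro exI[of _ "Q N"]) (auto split: if_splits intro: order_trans)
qed

text \<open>
  An infinitesimal flex that is defined near \<open>p\<close> and continuous at \<open>p\<close> integrates to a flex: the
  total edge length error attains its infimum over a compact set, and the infimum is \<open>0\<close>.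
\<close>

lemma flex_from_infinitesimal_flex:
  fixes p :: "'a \<Rightarrow> 'b::euclidean_space"
  assumes V: "finite V" "x \<in> V" "y \<in> V" "E \<subseteq> V \<times> V"
    and cont: "\<And>v. v \<in> V \<Longrightarrow> ((\<lambda>q. u q v) \<longlongrightarrow> u p v) (nhds p)"
    and motion: "\<forall>\<^sub>F q in nhds p. \<forall>(a, b)\<in>E. (q a - q b) \<bullet> (u q a - u q b) = 0"
    and rate: "(p x - p y) \<bullet> (u p x - u p y) > 0"
    and \<epsilon>: "\<epsilon> > 0"
  shows "\<exists>q. (\<forall>v\<in>V. norm (p v - q v) < \<epsilon>) \<and>
    (\<forall>(a, b)\<in>E. norm (p a - p b) = norm (q a - q b)) \<and> norm (p x - p y) \<noteq> norm (q x - q y)"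
proof -
  \<comment> \<open>Half of the rate at \<open>p\<close>, so that the rate stays above
    \<open>m\<close> near \<open>p\<close>.\<close>
  define m where "m = (p x - p y) \<bullet> (u p x - u p y) / 2"
  have m: "m > 0" "m < (p x - p y) \<bullet> (u p x - u p y)" using rate by (auto simp: m_def)
  \<comment> \<open>The summand 1 makes the bound on the speeds at \<open>p\<close> strict, so that
    it persists near \<open>p\<close>.\<close>
  define C where "C = (\<Sum>v\<in>V. norm (u p v)) + 1"
  have C: "C > 0" by (auto simp: C_def intro!: add_nonneg_pos sum_nonneg)
  have uC: "norm (u p v) < C" if "v \<in> V" for v
    using member_le_sum[of v V "\<lambda>v. norm (u p v)"] V(1) that by (simp add: C_def)
  have "((\<lambda>q. (q x - q y) \<bullet> (u q x - u q y)) \<longlongrightarrow> (p x - p y) \<bullet> (u p x - u p y)) (nhds p)"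
    using V by (intro tendsto_intros tendsto_coordinate cont)
  then have "\<forall>\<^sub>F q in nhds p. m < (q x - q y) \<bullet> (u q x - u q y)"
    using m(2) by (rule order_tendstoD)
  moreover have "\<forall>\<^sub>F q in nhds p. \<forall>v\<in>V. norm (u q v) < C"
    using V(1) uC cont by (auto intro!: eventually_ball_finite order_tendstoD(2)[OF tendsto_norm])
  ultimately have "\<forall>\<^sub>F q in nhds p. (\<forall>v\<in>V. norm (u q v) \<le> C) \<and>
      (\<forall>(a, b)\<in>E. (q a - q b) \<bullet> (u q a - u q b) = 0) \<and> (q x - q y) \<bullet> (u q x - u q y) \<ge> m"
    using motion by eventually_elim auto
  then obtain r0 where r0: "r0 > 0" and near: "\<And>q. (\<And>v. v \<in> V \<Longrightarrow> dist (p v) (q v) < r0) \<Longrightarrow>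
      (\<And>v. v \<notin> V \<Longrightarrow> q v = p v) \<Longrightarrow> (\<forall>v\<in>V. norm (u q v) \<le> C) \<and>
      (\<forall>(a, b)\<in>E. (q a - q b) \<bullet> (u q a - u q b) = 0) \<and> (q x - q y) \<bullet> (u q x - u q y) \<ge> m"
    by (rule nhds_fun_box[OF _ V(1)]) blast
  define r where "r = min r0 \<epsilon> / 2"
  have r: "r > 0" "r < r0" "r < \<epsilon>" using r0 \<epsilon> by (auto simp: r_def)
  \<comment> \<open>At speed at most \<open>C\<close>, the box of radius \<open>r\<close> is not
    left before this time.\<close>
  define \<tau> where "\<tau> = r / C"
  have \<tau>: "\<tau> > 0" "C * \<tau> = r" using r C by (auto simp: \<tau>_def)
  define box where "box = {q. \<forall>v. if v \<in> V then dist (p v) (q v) \<le> r else q v = p v}"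
  \<comment> \<open>The growth condition on \<open>xy\<close> excludes \<open>p\<close> itself, at
    which \<open>F\<close> is trivially zero.\<close>
  define K where "K = box \<inter> {q. (norm (p x - p y))\<^sup>2 + 2 * \<tau> * m \<le> (norm (q x - q y))\<^sup>2}"
  define F where "F = (\<lambda>q :: 'a \<Rightarrow> 'b. \<Sum>(a, b)\<in>E. \<bar>(norm (q a - q b))\<^sup>2 - (norm (p a - p b))\<^sup>2\<bar>)"
  have finE: "finite E" using V finite_subset by blast
  have coord: "continuous_on UNIV (\<lambda>q :: 'a \<Rightarrow> 'b. q v)" for v
    by (rule continuous_on_product_coordinates)
  have "closed {q :: 'a \<Rightarrow> 'b. (norm (p x - p y))\<^sup>2 + 2 * \<tau> * m \<le> (norm (q x - q y))\<^sup>2}"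
    by (intro closed_Collect_le continuous_intros coord)
  then have compact: "compact K"
    unfolding K_def box_def using compact_fun_box by (intro compact_Int_closed)
  have approx: "\<exists>q\<in>K. F q \<le> real (card E) * (4 * C\<^sup>2 * \<tau>\<^sup>2 / real N)" if N: "N > 0" for N
  proof -
    have "\<exists>q. (\<forall>v. if v \<in> V then dist (p v) (q v) \<le> r else q v = p v) \<and>
      (\<forall>(a, b)\<in>E. \<bar>(norm (q a - q b))\<^sup>2 - (norm (p a - p b))\<^sup>2\<bar> \<le> 4 * C\<^sup>2 * \<tau>\<^sup>2 / real N) \<and>
      (norm (q x - q y))\<^sup>2 \<ge> (norm (p x - p y))\<^sup>2 + 2 * \<tau> * m"
    proof (rule euler_polygon[OF V(2,3,4)])
      fix q assume q: "\<forall>v. if v \<in> V then dist (p v) (q v) \<le> r else q v = p v"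
      show "(\<forall>v\<in>V. norm (u q v) \<le> C) \<and> (\<forall>(a, b)\<in>E. (q a - q b) \<bullet> (u q a - u q b) = 0) \<and>
          (q x - q y) \<bullet> (u q x - u q y) \<ge> m"
      proof (rule near)
        show "dist (p v) (q v) < r0" if "v \<in> V" for v
          using q[THEN spec, of v] that r by auto
        show "q v = p v" if "v \<notin> V" for v
          using q[THEN spec, of v] that by auto
      qed
    qed (use \<tau> C m N in auto)
    then obtain q where q: "q \<in> K"
      "\<forall>(a, b)\<in>E. \<bar>(norm (q a - q b))\<^sup>2 - (norm (p a - p b))\<^sup>2\<bar> \<le> 4 * C\<^sup>2 * \<tau>\<^sup>2 / real N"
      unfolding K_def box_def by blast
    have "F q \<le> real (card E) * (4 * C\<^sup>2 * \<tau>\<^sup>2 / real N)"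
      unfolding F_def using q(2) by (intro sum_bounded_above) auto
    with q(1) show ?thesis by blast
  qed
  have "continuous_on K F"
    unfolding F_def split_beta
    by (intro continuous_intros continuous_on_subset[OF coord subset_UNIV])
  moreover have "K \<noteq> {}" using approx[of 1] by auto
  ultimately obtain q where q: "q \<in> K" "\<And>q'. q' \<in> K \<Longrightarrow> F q \<le> F q'"
    using continuous_attains_inf[OF compact] by blast
  have "F q \<le> 0"
  proof (rule LIMSEQ_le_const)
    show "(\<lambda>N. real (card E) * (4 * C\<^sup>2 * \<tau>\<^sup>2 / real N)) \<longlonglongrightarrow> 0"
      by (intro tendsto_mult_right_zero lim_const_over_n)
    show "\<exists>N0. \<forall>N\<ge>N0. F q \<le> real (card E) * (4 * C\<^sup>2 * \<tau>\<^sup>2 / real N)"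
    proof (intro exI[of _ 1] allI impI)
      fix N :: nat assume "1 \<le> N"
      then obtain q' where "q' \<in> K" "F q' \<le> real (card E) * (4 * C\<^sup>2 * \<tau>\<^sup>2 / real N)"
        using approx[of N] by auto
      then show "F q \<le> real (card E) * (4 * C\<^sup>2 * \<tau>\<^sup>2 / real N)"
        using q(2)[of q'] by linarith
    qed
  qed
  moreover have "F q \<ge> 0" unfolding F_def by (intro sum_nonneg) auto
  ultimately have "F q = 0" by simp
  then have "\<forall>e\<in>E. (case e of (a, b) \<Rightarrow> \<bar>(norm (q a - q b))\<^sup>2 - (norm (p a - p b))\<^sup>2\<bar>) = 0"
    unfolding F_def using finE by (subst (asm) sum_nonneg_eq_0_iff) auto
  then have "norm (p a - p b) = norm (q a - q b)" if "(a, b) \<in> E" for a b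
    using that by (fastforce simp: power2_eq_iff_nonneg)
  moreover have "norm (p v - q v) < \<epsilon>" if "v \<in> V" for v
    using q(1) that r by (auto simp: K_def box_def dist_norm dest!: spec[of _ v])
  moreover have "2 * \<tau> * m > 0" using \<tau> m by simp
  then have "norm (p x - p y) \<noteq> norm (q x - q y)" using q(1) by (auto simp: K_def)
  ultimately show ?thesis by blast
qed

section \<open>Menger's theorem\<close>

definition walk_in :: "'a rel \<Rightarrow> 'a list \<Rightarrow> bool" where
  "walk_in E p \<longleftrightarrow> p \<noteq> [] \<and> successively (\<lambda>u v. (u, v) \<in> E) p"

definition separates :: "'a rel \<Rightarrow> 'a set \<Rightarrow> 'a set \<Rightarrow> 'a set \<Rightarrow> bool" where
  "separates E A B T \<longleftrightarrow> (\<forall>p. walk_in E p \<and> hd p \<in> A \<and> last p \<in> B \<longrightarrow> set p \<inter> T \<noteq> {})"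

text \<open>The paths are disjoint at their ends too, unlike those counted by \<open>kappa\<close>.
  A path may be a single vertex, and its inner vertices may lie in \<open>A\<close> or
  \<open>B\<close>.\<close>

definition linkage :: "'a rel \<Rightarrow> 'a set \<Rightarrow> 'a set \<Rightarrow> 'a list set \<Rightarrow> bool" where
  "linkage E A B \<P> \<longleftrightarrow>
     (\<forall>p\<in>\<P>. walk_in E p \<and> distinct p \<and> hd p \<in> A \<and> last p \<in> B) \<and>
     (\<forall>p\<in>\<P>. \<forall>q\<in>\<P>. p \<noteq> q \<longrightarrow> set p \<inter> set q = {})"

lemma walk_in_mono: "walk_in E p \<Longrightarrow> E \<subseteq> E' \<Longrightarrow> walk_in E' p"
  unfolding walk_in_def by (auto elim: successively_mono)

text \<open>The arc \<open>(x, y)\<close> can only leave an entry that has a successor, and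
  \<open>x\<close> does not occur before the last entry.\<close>

lemma successively_avoid_source:
  assumes "successively (\<lambda>u v. (u, v) \<in> insert (x, y) E) (ys @ [z])" "x \<notin> set ys"
  shows "successively (\<lambda>u v. (u, v) \<in> E) (ys @ [z])"
  using assms by (induction ys) (auto simp: successively_Cons)

lemma successively_avoid_target:
  assumes "successively (\<lambda>u v. (u, v) \<in> insert (x, y) E) (z # zs)" "y \<notin> set zs"
  shows "successively (\<lambda>u v. (u, v) \<in> E) (z # zs)"
  using assms by (induction zs arbitrary: z) (auto simp: successively_Cons)

lemma walk_in_avoid:
  assumes "walk_in (insert (x, y) E) p" "x \<notin> set p \<or> y \<notin> set p"
  shows "walk_in E p"
proof -
  have "p = butlast p @ [last p]" "p = hd p # tl p"
    using assms(1) by (simp_all add: walk_in_def)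
  then show ?thesis
    using assms successively_avoid_source[of x y E "butlast p" "last p"]
      successively_avoid_target[of x y E "hd p" "tl p"]
    unfolding walk_in_def by (metis in_set_butlastD list.set_sel(2))
qed

lemma linkage_inj:
  assumes "linkage E A B \<P>"
  shows "inj_on hd \<P>" "inj_on last \<P>"
  using assms unfolding linkage_def walk_in_def inj_on_def
  by (metis disjoint_iff hd_in_set, metis disjoint_iff last_in_set)

text \<open>Every vertex of \<open>B\<close> ends some path of the family; by disjointness a path
  that meets it is that very path.\<close>

lemma linkage_meets_target:
  assumes "linkage E A B \<P>" "last ` \<P> = B" "p \<in> \<P>" "z \<in> set p" "z \<in> B"
  shows "z = last p"
proof -
  obtain p' where p': "p' \<in> \<P>" "z = last p'" using assms by auto
  then have "z \<in> set p'" using assms(1) by (auto simp: linkage_def walk_in_def)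
  then have "p' = p" using assms p' by (auto simp: linkage_def)
  with p' show ?thesis by simp
qed

lemma linkage_meets_source:
  assumes "linkage E A B \<P>" "hd ` \<P> = A" "p \<in> \<P>" "z \<in> set p" "z \<in> A"
  shows "z = hd p"
proof -
  obtain p' where p': "p' \<in> \<P>" "z = hd p'" using assms by auto
  then have "z \<in> set p'" using assms(1) by (auto simp: linkage_def walk_in_def)
  then have "p' = p" using assms p' by (auto simp: linkage_def)
  with p' show ?thesis by simp
qed

text \<open>Switching from \<open>p\<close> to \<open>q\<close> at \<open>v\<close> gives a walk
  from \<open>A\<close> to \<open>B\<close>, which meets \<open>S\<close>. A vertex of
  \<open>S\<close> on \<open>p\<close> is its last and one on \<open>q\<close> its first, so the
  meeting point can only be \<open>v\<close>.\<close>

lemma linkages_meet_in_separator: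
  assumes sep: "separates E A B S" and "S \<subseteq> P" "S \<subseteq> Q"
    and 1: "linkage E A P \<P>" "last ` \<P> = P" "p \<in> \<P>"
    and 2: "linkage E Q B \<Q>" "hd ` \<Q> = Q" "q \<in> \<Q>"
    and v: "v \<in> set p" "v \<in> set q"
  shows "v \<in> S \<and> v = last p \<and> v = hd q"
proof -
  obtain p1 p2 where p: "p = p1 @ v # p2" using split_list[OF v(1)] by blast
  obtain q1 q2 where q: "q = q1 @ v # q2" using split_list[OF v(2)] by blast
  have pq: "walk_in E p" "distinct p" "hd p \<in> A" "walk_in E q" "distinct q" "last q \<in> B"
    using 1(1,3) 2(1,3) by (auto simp: linkage_def)
  let ?w = "p1 @ v # q2"
  have "walk_in E ?w"
    using pq p q by (auto simp: walk_in_def successively_append_iff)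
  moreover have "hd ?w = hd p" "last ?w = last q"
    using p q by (auto simp: hd_append)
  ultimately obtain z where z: "z \<in> set ?w" "z \<in> S"
    using sep pq(3,6) unfolding separates_def by (metis disjoint_iff)
  have "z = v"
  proof (rule ccontr)
    assume "z \<noteq> v"
    with z(1) consider "z \<in> set p1" | "z \<in> set q2" by auto
    then show False
    proof cases
      case 1
      then have "z = last p"
        using linkage_meets_target[of E A P \<P> p z] assms z p by auto
      then have "z \<in> set (v # p2)" using p by auto
      then show False using 1 pq(2) p by auto
    next
      case 2
      then have "z = hd q"
        using linkage_meets_source[of E Q B \<Q> q z] assms z q by auto
      then have "z \<in> set (q1 @ [v])" using q by (cases q1) auto
      then show False using 2 pq(5) q by auto
    qed
  qed
  with z(2) have "v \<in> S" by simp
  moreover have "v = last p"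
    using linkage_meets_target[of E A P \<P> p v] assms \<open>v \<in> S\<close> by auto
  moreover have "v = hd q"
    using linkage_meets_source[of E Q B \<Q> q v] assms \<open>v \<in> S\<close> by auto
  ultimately show ?thesis by simp
qed

text \<open>Goering's induction step: the two linkages of size \<open>k\<close> meet only in the separator \<open>S\<close> of
  size \<open>k - 1\<close>, and the edge \<open>xy\<close> joins the remaining ends.\<close>

lemma combine_linkages:
  assumes S: "finite S" "x \<notin> S" "y \<notin> S" and sep: "separates E A B S"
    and 1: "linkage E A (insert x S) \<P>" "finite \<P>" "card \<P> = Suc (card S)"
    and 2: "linkage E (insert y S) B \<Q>" "finite \<Q>" "card \<Q> = Suc (card S)"
  shows "\<exists>\<R>. linkage (insert (x, y) E) A B \<R> \<and> finite \<R> \<and> card \<R> = Suc (card S)"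
proof -
  \<comment> \<open>There are as many paths as elements of \<open>insert x S\<close>, and their ends
    are distinct, so every element is an end.\<close>
  have last_P: "last ` \<P> = insert x S"
    using 1 S linkage_inj(2)[OF 1(1)] by (intro card_subset_eq) (auto simp: card_image linkage_def)
  have hd_Q: "hd ` \<Q> = insert y S"
    using 2 S linkage_inj(1)[OF 2(1)] by (intro card_subset_eq) (auto simp: card_image linkage_def)
  have "\<forall>s\<in>insert x S. \<exists>p\<in>\<P>. last p = s"
    unfolding last_P[symmetric] by blast
  then obtain a where a: "\<And>s. s \<in> insert x S \<Longrightarrow> a s \<in> \<P> \<and> last (a s) = s" by metis
  have "\<forall>s\<in>insert y S. \<exists>p\<in>\<Q>. hd p = s"
    unfolding hd_Q[symmetric] by blast
  then obtain b where b: "\<And>s. s \<in> insert y S \<Longrightarrow> b s \<in> \<Q> \<and> hd (b s) = s" by metis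
  define I where "I = insert (x, y) ((\<lambda>s. (s, s)) ` S)"
  \<comment> \<open>At a vertex shared by both paths \<open>tl\<close> removes the duplicate, which
    also covers \<open>x = y\<close>; otherwise the arc \<open>(x, y)\<close> bridges the
    gap.\<close>
  define J where "J = (\<lambda>(s, t). if s = t then a s @ tl (b t) else a s @ b t)"
  have I: "s \<in> insert x S" "t \<in> insert y S" if "(s, t) \<in> I" for s t
    using that by (auto simp: I_def)
  have wa: "walk_in E (a s)" "distinct (a s)" "hd (a s) \<in> A" if "(s, t) \<in> I" for s t
    using 1(1) a[OF I(1)[OF that]] by (auto simp: linkage_def)
  have wb: "walk_in E (b t)" "distinct (b t)" "last (b t) \<in> B" if "(s, t) \<in> I" for s t
    using 2(1) b[OF I(2)[OF that]] by (auto simp: linkage_def)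
  have meet: "v \<in> S \<and> v = s \<and> v = t" if "(s, t') \<in> I" "(s', t) \<in> I" "v \<in> set (a s)" "v \<in> set (b t)"
    for s t s' t' v
    using linkages_meet_in_separator[OF sep subset_insertI subset_insertI 1(1) last_P _ 2(1) hd_Q _ that(3,4)]
      a[OF I(1)[OF that(1)]] b[OF I(2)[OF that(2)]] by auto
  have b_Cons: "b t = t # tl (b t)" if "(s, t) \<in> I" for s t
    using b[OF I(2)[OF that]] wb(1)[OF that] by (metis list.exhaust_sel walk_in_def)
  have tl_sub: "set (tl l) \<subseteq> set l" for l :: "'a list" by (cases l) auto
  have set_J: "set (J (s, t)) \<subseteq> set (a s) \<union> set (b t)" for s t
    using tl_sub[of "b t"] by (auto simp: J_def)
  have J: "walk_in (insert (x, y) E) (J i) \<and> distinct (J i) \<and> hd (J i) \<in> A \<and> last (J i) \<in> B"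
    if "i \<in> I" for i
  proof -
    obtain s t where i: "i = (s, t)" by fastforce
    with that have st: "(s, t) \<in> I" by simp
    note w = wa[OF st] wb[OF st]
    have ne: "a s \<noteq> []" "b t \<noteq> []" using w by (auto simp: walk_in_def)
    have la: "last (a s) = s" using a[OF I(1)[OF st]] by simp
    have hb: "hd (b t) = t" using b[OF I(2)[OF st]] by simp
    have wa': "walk_in (insert (x, y) E) (a s)" and wb': "walk_in (insert (x, y) E) (b t)"
      using w by (auto intro: walk_in_mono)
    show ?thesis
    proof (cases "s = t")
      case True
      have bt: "b t = s # tl (b t)" using b_Cons[OF st] True by simp
      have "set (a s) \<inter> set (tl (b t)) = {}"
      proof (rule ccontr)
        assume "set (a s) \<inter> set (tl (b t)) \<noteq> {}"
        then obtain v where v: "v \<in> set (a s)" "v \<in> set (tl (b t))" by blast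
        then have "v = s" using meet[OF st st, of v] tl_sub[of "b t"] by blast
        then show False using v(2) w(5) bt by (metis distinct.simps(2))
      qed
      moreover have "successively (\<lambda>u v. (u, v) \<in> insert (x, y) E) (s # tl (b t))"
        using wb' bt by (simp add: walk_in_def)
      ultimately show ?thesis
        using w ne True wa' la bt
        by (auto simp: i J_def walk_in_def successively_append_iff successively_Cons
            distinct_tl last_tl hd_append last_append)
    next
      case False
      then have xy: "s = x" "t = y" using st by (auto simp: I_def)
      have "set (a s) \<inter> set (b t) = {}"
        using meet[OF st st] False by blast
      then show ?thesis
        using w ne False wa' wb' la hb xy
        by (auto simp: i J_def walk_in_def successively_append_iff)
    qed
  qed
  have disj: "set (J i) \<inter> set (J j) = {}" if ij: "i \<in> I" "j \<in> I" "i \<noteq> j" for i j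
  proof -
    obtain s t where i: "i = (s, t)" by fastforce
    obtain s' t' where j: "j = (s', t')" by fastforce
    have I': "(s, t) \<in> I" "(s', t') \<in> I" using ij i j by auto
    have ne: "s \<noteq> s'" "t \<noteq> t'" using ij S i j by (auto simp: I_def)
    have "a s \<noteq> a s'" using ne a[OF I(1)[OF I'(1)]] a[OF I(1)[OF I'(2)]] by metis
    then have 11: "set (a s) \<inter> set (a s') = {}"
      using 1(1) a[OF I(1)[OF I'(1)]] a[OF I(1)[OF I'(2)]] by (auto simp: linkage_def)
    have "b t \<noteq> b t'" using ne b[OF I(2)[OF I'(1)]] b[OF I(2)[OF I'(2)]] by metis
    then have 22: "set (b t) \<inter> set (b t') = {}"
      using 2(1) b[OF I(2)[OF I'(1)]] b[OF I(2)[OF I'(2)]] by (auto simp: linkage_def)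
    have 12: "set (a s) \<inter> set (b t') = {}"
    proof (rule ccontr)
      assume "set (a s) \<inter> set (b t') \<noteq> {}"
      then obtain v where "v \<in> S" "v = s" "v = t'" using meet[OF I'] by blast
      then show False using I' ne S by (auto simp: I_def)
    qed
    have 21: "set (a s') \<inter> set (b t) = {}"
    proof (rule ccontr)
      assume "set (a s') \<inter> set (b t) \<noteq> {}"
      then obtain v where "v \<in> S" "v = s'" "v = t" using meet[OF I'(2,1)] by blast
      then show False using I' ne S by (auto simp: I_def)
    qed
    show ?thesis
      using 11 22 12 21 set_J[of s t] set_J[of s' t'] unfolding i j by blast
  qed
  have "inj_on J I"
  proof (rule inj_onI, rule ccontr)
    fix i j assume ij: "i \<in> I" "j \<in> I" "J i = J j" "i \<noteq> j"
    then have "set (J i) = {}" using disj by fastforce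
    with J[OF ij(1)] show False by (simp add: walk_in_def)
  qed
  moreover have "card I = Suc (card S)"
    using S by (auto simp: I_def card_insert_if card_image inj_on_def)
  moreover have "finite I" using S by (simp add: I_def)
  ultimately have "finite (J ` I)" "card (J ` I) = Suc (card S)" by (auto simp: card_image)
  moreover have "linkage (insert (x, y) E) A B (J ` I)"
    unfolding linkage_def using J disj by blast
  ultimately show ?thesis by blast
qed

text \<open>Induction on the arcs. If removing \<open>(x, y)\<close> admits a separator
  \<open>S\<close> with fewer than \<open>k\<close> elements, adding either end of the arc to
  \<open>S\<close> separates the whole graph again, so \<open>S\<close> has exactly
  \<open>k - 1\<close> elements. The induction hypothesis is used on both sides of it.\<close>

theorem menger_linkage:
  assumes "finite E" "finite A" "finite B" "\<And>T. finite T \<Longrightarrow> separates E A B T \<Longrightarrow> k \<le> card T"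
  shows "\<exists>\<P>. linkage E A B \<P> \<and> finite \<P> \<and> card \<P> = k"
  using assms
proof (induction E arbitrary: A B rule: finite_induct)
  case empty
  \<comment> \<open>Without arcs every walk is a single vertex.\<close>
  have "separates {} A B (A \<inter> B)"
    unfolding separates_def
  proof (intro allI impI)
    fix p :: "'a list" assume p: "walk_in {} p \<and> hd p \<in> A \<and> last p \<in> B"
    then obtain v where "p = [v]"
      by (auto simp: walk_in_def neq_Nil_conv successively_Cons)
    with p show "set p \<inter> (A \<inter> B) \<noteq> {}" by auto
  qed
  then have "k \<le> card (A \<inter> B)" using empty by auto
  then obtain K where K: "K \<subseteq> A \<inter> B" "card K = k" "finite K"
    using empty by (metis obtain_subset_with_card_n)
  have "linkage {} A B ((\<lambda>v. [v]) ` K)"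
    using K by (auto simp: linkage_def walk_in_def)
  moreover have "card ((\<lambda>v. [v]) ` K) = k" "finite ((\<lambda>v. [v]) ` K)"
    using K by (auto simp: card_image inj_on_def)
  ultimately show ?case by blast
next
  case (insert e E)
  obtain x y where e: "e = (x, y)" by fastforce
  show ?case
  proof (cases "\<forall>T. finite T \<longrightarrow> separates E A B T \<longrightarrow> k \<le> card T")
    case True
    then obtain \<P> where "linkage E A B \<P>" "finite \<P>" "card \<P> = k"
      using insert.IH insert.prems by blast
    moreover from this have "linkage (insert e E) A B \<P>"
      unfolding linkage_def using walk_in_mono[OF _ subset_insertI] by blast
    ultimately show ?thesis by blast
  next
    case False
    then obtain S where S: "finite S" "separates E A B S" "card S < k" by auto
    have sep: "separates (insert e E) A B (insert z S)" if "z = x \<or> z = y" for z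
      unfolding separates_def
    proof (intro allI impI)
      fix p assume p: "walk_in (insert e E) p \<and> hd p \<in> A \<and> last p \<in> B"
      show "set p \<inter> insert z S \<noteq> {}"
      proof (cases "z \<in> set p")
        case False
        then have "walk_in E p" using p that walk_in_avoid e by metis
        then show ?thesis using S(2) p unfolding separates_def by blast
      qed auto
    qed
    have k: "k \<le> card (insert x S)" "k \<le> card (insert y S)"
      using insert.prems(3) sep S(1) by auto
    have xy: "x \<notin> S" "y \<notin> S"
      using k S(3) by (metis insert_absorb not_le)+
    then have kS: "k = Suc (card S)"
      using k(1) S(1,3) by simp
    have "k \<le> card T" if T: "finite T" "separates E A (insert x S) T" for T
    proof (rule insert.prems(3)[OF T(1)], unfold separates_def, intro allI impI)
      fix p assume p: "walk_in (insert e E) p \<and> hd p \<in> A \<and> last p \<in> B"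
      then have "\<exists>z\<in>set p. z \<in> insert x S" using sep[of x] unfolding separates_def by blast
      \<comment> \<open>At the first vertex in \<open>insert x S\<close> the walk has not yet left
        \<open>x\<close>, so its initial part does not use the new arc and must meet
        \<open>T\<close>.\<close>
      then obtain ys z zs where z: "p = ys @ z # zs" "z \<in> insert x S" "\<forall>u\<in>set ys. u \<notin> insert x S"
        by (rule split_list_first_propE)
      have "successively (\<lambda>u v. (u, v) \<in> insert (x, y) E) (ys @ [z])"
        using p z(1) by (auto simp: e walk_in_def successively_append_iff)
      then have "walk_in E (ys @ [z])"
        using successively_avoid_source[of x y E ys z] z(3) by (auto simp: walk_in_def)
      moreover have "hd (ys @ [z]) = hd p" using z(1) by (cases ys) auto
      moreover have "last (ys @ [z]) \<in> insert x S" using z(2) by simp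
      ultimately have "set (ys @ [z]) \<inter> T \<noteq> {}"
        using T(2) p unfolding separates_def by metis
      then show "set p \<inter> T \<noteq> {}" using z(1) by auto
    qed
    then obtain \<P> where P: "linkage E A (insert x S) \<P>" "finite \<P>" "card \<P> = k"
      using insert.IH[of A "insert x S"] insert.prems(1) S(1) by auto
    have "k \<le> card T" if T: "finite T" "separates E (insert y S) B T" for T
    proof (rule insert.prems(3)[OF T(1)], unfold separates_def, intro allI impI)
      fix p assume p: "walk_in (insert e E) p \<and> hd p \<in> A \<and> last p \<in> B"
      then have "\<exists>z\<in>set p. z \<in> insert y S" using sep[of y] unfolding separates_def by blast
      then obtain ys z zs where z: "p = ys @ z # zs" "z \<in> insert y S" "\<forall>u\<in>set zs. u \<notin> insert y S"
        by (rule split_list_last_propE)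
      have "successively (\<lambda>u v. (u, v) \<in> insert (x, y) E) (z # zs)"
        using p z(1) by (auto simp: e walk_in_def successively_append_iff)
      then have "walk_in E (z # zs)"
        using successively_avoid_target[of x y E z zs] z(3) by (auto simp: walk_in_def)
      moreover have "last (z # zs) = last p" using z(1) by auto
      moreover have "hd (z # zs) \<in> insert y S" using z(2) by simp
      ultimately have "set (z # zs) \<inter> T \<noteq> {}"
        using T(2) p unfolding separates_def by metis
      then show "set p \<inter> T \<noteq> {}" using z(1) by auto
    qed
    then obtain \<Q> where Q: "linkage E (insert y S) B \<Q>" "finite \<Q>" "card \<Q> = k"
      using insert.IH[of "insert y S" B] insert.prems(2) S(1) by auto
    show ?thesis
      using combine_linkages[OF S(1) xy S(2) P(1,2) _ Q(1,2)] P(3) Q(3) kS e by auto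
  qed
qed


section \<open>Separations and local connectivity\<close>

text \<open>Naming the two sides, each a union of components of \<open>H - T\<close>, makes it
  possible to intersect the sides of two separations.\<close>

definition separation :: "'a pair_pre_digraph \<Rightarrow> 'a set \<Rightarrow> 'a set \<Rightarrow> 'a set \<Rightarrow> bool" where
  "separation H T X Y \<longleftrightarrow> X \<union> T \<union> Y = pverts H \<and> X \<inter> T = {} \<and> Y \<inter> T = {} \<and> X \<inter> Y = {} \<and>
     X \<noteq> {} \<and> Y \<noteq> {} \<and> (\<forall>u\<in>X. \<forall>v\<in>Y. (u, v) \<notin> parcs H \<and> (v, u) \<notin> parcs H)"

lemma separation_commute: "separation H T X Y \<Longrightarrow> separation H T Y X"
  by (auto simp: separation_def)

lemma separationD:
  assumes "separation H T X Y"
  shows "X \<inter> T = {}" "Y \<inter> T = {}" "X \<inter> Y = {}" "T \<subseteq> pverts H" "X \<subseteq> pverts H" "Y \<subseteq> pverts H"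
    "X \<noteq> {}" "Y \<noteq> {}"
    and "\<And>v. v \<in> pverts H \<Longrightarrow> v \<in> X \<union> T \<union> Y"
    and "\<And>u v. u \<in> X \<Longrightarrow> v \<in> Y \<Longrightarrow> (u, v) \<notin> parcs H"
    and "\<And>u v. u \<in> X \<Longrightarrow> v \<in> Y \<Longrightarrow> (v, u) \<notin> parcs H"
  using assms unfolding separation_def by blast+

section \<open>Path families and local connectivity\<close>

lemma set_vwalk_arcs_subset_iff:
  "set (vwalk_arcs p) \<subseteq> E \<longleftrightarrow> successively (\<lambda>u v. (u, v) \<in> E) p"
  by (induction p rule: vwalk_arcs.induct) auto

lemma vpath_with_proj_iff:
  "vpath p (with_proj H) \<longleftrightarrow> set p \<subseteq> pverts H \<and> walk_in (parcs H) p \<and> distinct p"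
  by (auto simp: vpath_def vwalk_def set_vwalk_arcs_subset_iff walk_in_def)

lemma disjoint_path_family_subset:
  assumes "disjoint_path_family H x y P"
  shows "P \<subseteq> {p. set p \<subseteq> pverts H \<and> distinct p}"
  using assms by (auto simp: disjoint_path_family_def vpath_with_proj_iff)

text \<open>This makes the \<open>Max\<close> in \<open>kappa\<close> a genuine maximum.\<close>

lemma finite_path_families:
  assumes "finite (pverts H)"
  shows "finite {P. disjoint_path_family H x y P}"
proof (rule finite_subset)
  show "{P. disjoint_path_family H x y P} \<subseteq> Pow {p. set p \<subseteq> pverts H \<and> distinct p}"
  proof (rule subsetI, rule PowI)
    fix P assume "P \<in> {P. disjoint_path_family H x y P}"
    then show "P \<subseteq> {p. set p \<subseteq> pverts H \<and> distinct p}"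
      by (intro disjoint_path_family_subset) (simp only: mem_Collect_eq)
  qed
  show "finite (Pow {p. set p \<subseteq> pverts H \<and> distinct p})"
    using finite_subset_distinct[OF assms] by simp
qed

lemma kappa_ge:
  assumes "finite (pverts H)" "disjoint_path_family H x y P"
  shows "card P \<le> kappa H x y"
  unfolding kappa_def using assms finite_path_families[OF assms(1)] by (intro Max_ge) auto

lemma kappa_le:
  assumes "finite (pverts H)" "\<And>P. disjoint_path_family H x y P \<Longrightarrow> card P \<le> n"
  shows "kappa H x y \<le> n"
proof -
  have "disjoint_path_family H x y {}" by (simp add: disjoint_path_family_def)
  then have "{P. disjoint_path_family H x y P} \<noteq> {}" by blast
  then show ?thesis
    unfolding kappa_def using assms finite_path_families[OF assms(1)] by (subst Max_le_iff) auto
qed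

lemma kappa_mono:
  assumes "finite (pverts H)" "pverts G = pverts H" "parcs G \<subseteq> parcs H"
  shows "kappa G x y \<le> kappa H x y"
proof (rule kappa_le)
  show "finite (pverts G)" using assms by simp
  fix P assume "disjoint_path_family G x y P"
  then have "disjoint_path_family H x y P"
    using assms walk_in_mono[OF _ assms(3)]
    by (auto simp: disjoint_path_family_def vpath_with_proj_iff)
  then show "card P \<le> kappa H x y" using assms(1) by (rule kappa_ge[rotated])
qed

lemma walk_meets_separator:
  assumes "separation H T X Y" "walk_in (parcs H) p" "set p \<subseteq> pverts H" "hd p \<in> X" "last p \<in> Y"
  shows "set p \<inter> T \<noteq> {}"
  using assms(2-)
proof (induction p)
  case (Cons u p)
  show ?case
  proof (cases "p = []")
    case True
    then show ?thesis using Cons.prems assms(1) by (auto simp: separation_def)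
  next
    case False
    then have arc: "(u, hd p) \<in> parcs H" and w: "walk_in (parcs H) p"
      using Cons.prems(1) by (auto simp: walk_in_def successively_Cons)
    have "hd p \<in> pverts H"
      using Cons.prems(2) hd_in_set[OF False] by (metis list.set_intros(2) subset_iff)
    then have "hd p \<in> X \<union> T \<union> Y"
      using assms(1) by (auto simp: separation_def)
    then consider "hd p \<in> X" | "hd p \<in> T" | "hd p \<in> Y" by blast
    then show ?thesis
    proof cases
      case 1
      then show ?thesis using Cons.IH[OF w] Cons.prems False by auto
    next
      case 2
      then show ?thesis using hd_in_set[OF False] by auto
    next
      case 3
      then show ?thesis using arc Cons.prems(3) assms(1) by (auto simp: separation_def)
    qed
  qed
qed (simp add: walk_in_def)

text \<open>Every path picks a vertex of \<open>T\<close>; two paths share only \<open>x\<close> and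
  \<open>y\<close>, neither in \<open>T\<close>, so the choice is injective.\<close>

lemma kappa_le_separation:
  assumes "separation H T X Y" "finite (pverts H)" "x \<in> X" "y \<in> Y"
  shows "kappa H x y \<le> card T"
proof (rule kappa_le[OF assms(2)])
  fix P assume P: "disjoint_path_family H x y P"
  have T: "finite T" "x \<notin> T" "y \<notin> T"
    using assms by (auto simp: separation_def intro: finite_subset[of T "pverts H"])
  have "\<forall>p\<in>P. \<exists>v. v \<in> set p \<inter> T"
    using P assms walk_meets_separator[OF assms(1)]
    by (fastforce simp: disjoint_path_family_def vpath_with_proj_iff)
  then obtain f where f: "\<And>p. p \<in> P \<Longrightarrow> f p \<in> set p \<inter> T" by metis
  have "inj_on f P"
  proof (rule inj_onI, rule ccontr)
    fix p q assume pq: "p \<in> P" "q \<in> P" "f p = f q" "p \<noteq> q"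
    then have "f p \<in> set p \<inter> set q" using f by (metis IntD1 IntI)
    then have "f p \<in> {x, y}" using P pq by (auto simp: disjoint_path_family_def)
    then show False using f[OF pq(1)] T by auto
  qed
  moreover have "f ` P \<subseteq> T" using f by blast
  ultimately show "card P \<le> card T" using T(1) by (rule card_inj_on_le)
qed

lemma walk_in_subset:
  assumes "walk_in E p" "hd p \<in> W" "E \<subseteq> W \<times> W"
  shows "set p \<subseteq> W"
  using assms
proof (induction p)
  case (Cons u p)
  then show ?case by (cases p) (auto simp: walk_in_def successively_Cons)
qed simp

text \<open>With \<open>x\<close> and \<open>y\<close> deleted, disjoint paths from the neighbours
  of \<open>x\<close> to those of \<open>y\<close> extend to internally disjoint paths. If
  \<open>k + 1\<close> of them do not exist, a small set separating the neighbourhoods gives the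
  separation; nonadjacency keeps \<open>y\<close> out of reach of \<open>x\<close>.\<close>

lemma menger_separation:
  assumes G: "pair_graph G" and xy: "x \<in> pverts G" "y \<in> pverts G" "x \<noteq> y" "(x, y) \<notin> parcs G"
    and le: "kappa G x y \<le> k"
  obtains T X Y where "separation G T X Y" "x \<in> X" "y \<in> Y" "card T \<le> k"
proof (rule ccontr)
  assume "\<not> thesis"
  with that have no_sep: "card T > k" if "separation G T X Y" "x \<in> X" "y \<in> Y" for T X Y
    by (meson that not_le)
  interpret pair_graph G by fact
  have sym: "(v, u) \<in> parcs G" if "(u, v) \<in> parcs G" for u v
    using that pair_sym_arcs by (auto simp: symmetric_def sym_def)
  have fin: "finite (pverts G)" "finite (parcs G)"
    using pair_finite_verts pair_finite_arcs by auto
  define W where "W = pverts G - {x, y}"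
  define E where "E = parcs G \<inter> W \<times> W"
  define A where "A = {v \<in> W. (x, v) \<in> parcs G}"
  define B where "B = {v \<in> W. (v, y) \<in> parcs G}"
  have "Suc k \<le> card T0" if T0: "finite T0" "separates E A B T0" for T0
  proof -
    define T where "T = T0 \<inter> W"
    \<comment> \<open>\<open>x\<close> together with everything reachable from its neighbours while
      avoiding \<open>T0\<close>. Only the part \<open>T\<close> of \<open>T0\<close> inside
      \<open>W\<close> can serve as the separator.\<close>
    define X where "X = insert x {v \<in> W - T. \<exists>p. walk_in E p \<and> hd p \<in> A \<and> last p = v \<and> set p \<inter> T0 = {}}"
    define Y where "Y = pverts G - T - X"
    have y: "y \<in> Y" using xy by (auto simp: Y_def X_def T_def W_def)
    have no_arc: "(u, v) \<notin> parcs G" if u: "u \<in> X" and v: "v \<in> Y" for u v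
    proof
      assume uv: "(u, v) \<in> parcs G"
      have v': "v \<in> pverts G" "v \<notin> T" "v \<notin> X" "v \<noteq> x" using v by (auto simp: Y_def X_def)
      show False
      proof (cases "u = x")
        case True
        then have "v \<noteq> y" using uv xy by auto
        then have "v \<in> W" "v \<in> A" using v' uv True by (auto simp: W_def A_def)
        moreover have "walk_in E [v]" by (simp add: walk_in_def)
        ultimately have "v \<in> X" using v' by (auto simp: X_def T_def intro!: exI[of _ "[v]"])
        then show False using v' by simp
      next
        case False
        then obtain p where p: "u \<in> W - T" "walk_in E p" "hd p \<in> A" "last p = u" "set p \<inter> T0 = {}"
          using u by (auto simp: X_def)
        show False
        proof (cases "v = y")
          case True
          then have "u \<in> B" using p uv by (auto simp: B_def)
          then show False using T0(2) p unfolding separates_def by blast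
        next
          case False
          then have vW: "v \<in> W" using v' by (auto simp: W_def)
          then have "(u, v) \<in> E" using p uv by (auto simp: E_def)
          then have "walk_in E (p @ [v])" using p by (auto simp: walk_in_def successively_append_iff)
          moreover have "hd (p @ [v]) = hd p" using p by (auto simp: walk_in_def)
          moreover have "set (p @ [v]) \<inter> T0 = {}" using p v' vW by (auto simp: T_def)
          ultimately have "v \<in> X"
            using p(3) vW v' unfolding X_def by (auto intro!: exI[of _ "p @ [v]"])
          then show False using v' by simp
        qed
      qed
    qed
    have X: "X \<subseteq> pverts G" "X \<inter> T = {}" "x \<in> X" "T \<subseteq> pverts G"
      using xy(1) by (auto simp: X_def T_def W_def)
    then have "X \<union> T \<union> Y = pverts G" "Y \<inter> T = {}" "X \<inter> Y = {}" by (auto simp: Y_def)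
    moreover have "\<forall>u\<in>X. \<forall>v\<in>Y. (u, v) \<notin> parcs G \<and> (v, u) \<notin> parcs G"
      using no_arc sym by blast
    ultimately have "separation G T X Y"
      unfolding separation_def using X(2,3) y by blast
    then have "k < card T" using y by (intro no_sep) (auto simp: X_def)
    also have "card T \<le> card T0" using T0(1) by (auto simp: T_def intro: card_mono)
    finally show ?thesis by simp
  qed
  moreover have "finite E" "finite A" "finite B"
    using fin by (auto simp: E_def A_def B_def W_def)
  ultimately obtain \<P> where P: "linkage E A B \<P>" "finite \<P>" "card \<P> = Suc k"
    using menger_linkage[of E A B "Suc k"] by auto
  define f where "f = (\<lambda>p. x # p @ [y])"
  have inW: "set p \<subseteq> W" if "p \<in> \<P>" for p
    using P(1) that walk_in_subset[of E p W] by (auto simp: linkage_def E_def A_def)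
  have "disjoint_path_family G x y (f ` \<P>)"
    unfolding disjoint_path_family_def
  proof (intro conjI ballI impI)
    fix r assume "r \<in> f ` \<P>"
    then obtain p where p: "p \<in> \<P>" "r = f p" by blast
    have w: "walk_in E p" "distinct p" "hd p \<in> A" "last p \<in> B"
      using P(1) p by (auto simp: linkage_def)
    have w': "walk_in (parcs G) p" using w(1) walk_in_mono[of E p "parcs G"] by (auto simp: E_def)
    have "walk_in (parcs G) r"
      using w w' p(2)
      by (auto simp: f_def walk_in_def successively_append_iff successively_Cons A_def B_def)
    then show "vpath r (with_proj G)"
      using p inW[OF p(1)] w(2) xy by (auto simp: vpath_with_proj_iff f_def W_def)
    show "hd r = x" "last r = y" using p by (auto simp: f_def)
  next
    fix r r' assume r: "r \<in> f ` \<P>" "r' \<in> f ` \<P>" "r \<noteq> r'"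
    then obtain p p' where "p \<in> \<P>" "p' \<in> \<P>" "r = f p" "r' = f p'" "p \<noteq> p'" by blast
    then have "set p \<inter> set p' = {}" "r = x # p @ [y]" "r' = x # p' @ [y]"
      using P(1) by (auto simp: linkage_def f_def)
    then show "set r \<inter> set r' = {x, y}"
      using inW[OF \<open>p \<in> \<P>\<close>] inW[OF \<open>p' \<in> \<P>\<close>] by (auto simp: W_def)
  qed
  then have "card (f ` \<P>) \<le> kappa G x y" using fin(1) by (rule kappa_ge[rotated])
  moreover have "card (f ` \<P>) = Suc k"
    using P(3) by (subst card_image) (auto simp: f_def inj_on_def)
  ultimately show False using le by simp
qed

text \<open>If \<open>v\<close> cannot be reached from \<open>u\<close> outside \<open>S\<close>,
  the vertices reachable from \<open>u\<close> form one side. Conversely, reachability never leaves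
  a side.\<close>

lemma separator_iff:
  assumes arcs: "parcs H \<subseteq> pverts H \<times> pverts H" and sym: "\<And>u v. (u, v) \<in> parcs H \<Longrightarrow> (v, u) \<in> parcs H"
  shows "separator H S \<longleftrightarrow> (\<exists>X Y. separation H S X Y)"
proof -
  let ?V = "pverts H - S"
  let ?E = "parcs H \<inter> ?V \<times> ?V"
  have E: "arcs_ends (with_proj (mk_symmetric (with_proj H \<restriction> ?V))) = ?E"
    using sym by (auto simp: parcs_mk_symmetric induce_subgraph_def)
  have conn: "Digraph_Component.connected (with_proj H \<restriction> ?V) \<longleftrightarrow>
      ?V \<noteq> {} \<and> (\<forall>u\<in>?V. \<forall>v\<in>?V. (u, v) \<in> rtrancl_on ?V ?E)"
    using E by (simp add: Digraph_Component.connected_def strongly_connected_def reachable_def)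
  show ?thesis
  proof
    assume S: "separator H S"
    then have "S \<subset> pverts H" "\<not> Digraph_Component.connected (with_proj H \<restriction> ?V)"
      by (auto simp: separator_def)
    then obtain u v where uv: "u \<in> ?V" "v \<in> ?V" "(u, v) \<notin> rtrancl_on ?V ?E"
      unfolding conn by blast
    define X where "X = {w \<in> ?V. (u, w) \<in> rtrancl_on ?V ?E}"
    have "(w, z) \<notin> parcs H" if "w \<in> X" "z \<in> ?V - X" for w z
      using that rtrancl_on_into_rtrancl_on[of u w ?V ?E z] by (auto simp: X_def)
    then have "separation H S X (?V - X)"
      unfolding separation_def using uv S sym by (auto simp: X_def separator_def)
    then show "\<exists>X Y. separation H S X Y" by blast
  next
    assume "\<exists>X Y. separation H S X Y"
    then obtain X Y where XY: "separation H S X Y" by blast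
    then obtain x y where xy: "x \<in> X" "y \<in> Y" by (auto simp: separation_def)
    have V: "?V = X \<union> Y" using XY by (auto simp: separation_def)
    have "w \<in> X" if "(x, w) \<in> rtrancl_on ?V ?E" for w
      using that
    proof (induction rule: rtrancl_on_induct)
      case base
      show ?case using xy by simp
    next
      case (step w z)
      then show ?case using XY V by (auto simp: separation_def)
    qed
    moreover have "y \<notin> X" using xy XY by (auto simp: separation_def)
    ultimately have "(x, y) \<notin> rtrancl_on ?V ?E" by blast
    then have "\<not> Digraph_Component.connected (with_proj H \<restriction> ?V)"
      unfolding conn using xy V by blast
    moreover have "S \<subset> pverts H" using XY by (auto simp: separation_def)
    ultimately show "separator H S" by (simp add: separator_def)
  qed
qed

section \<open>Separations of rigid graphs\<close>

text \<open>A neighbour of the corner \<open>A \<inter> X\<close> lies in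
  \<open>A \<union> S\<close> and in \<open>X \<union> T\<close>. As \<open>T\<close> misses
  \<open>A\<close>, it lies in the corner or in \<open>S \<inter> (X \<union> T)\<close>, which
  omits the nonempty part of \<open>S\<close> in \<open>Y\<close>.\<close>

lemma corner_separation:
  assumes 1: "separation H S A B" and 2: "separation H T X Y"
    and "T \<inter> A = {}" "A \<inter> X \<noteq> {}" "S \<inter> Y \<noteq> {}" "finite S"
  shows "separation H (S \<inter> (X \<union> T)) (A \<inter> X) (pverts H - S \<inter> (X \<union> T) - A \<inter> X)"
    and "card (S \<inter> (X \<union> T)) < card S"
proof -
  let ?R = "pverts H - S \<inter> (X \<union> T) - A \<inter> X"
  have no_arc: "(u, w) \<notin> parcs H \<and> (w, u) \<notin> parcs H" if "u \<in> A \<inter> X" "w \<in> ?R" for u w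
  proof -
    have "w \<in> A \<union> S \<union> B" "w \<in> X \<union> T \<union> Y" using that 1 2 by (auto simp: separation_def)
    then have "w \<in> B \<or> w \<in> Y" using that assms(3) by blast
    then show ?thesis
    proof
      assume "w \<in> B"
      then show ?thesis using that 1 unfolding separation_def by blast
    next
      assume "w \<in> Y"
      then show ?thesis using that 2 unfolding separation_def by blast
    qed
  qed
  have sub: "S \<inter> (X \<union> T) \<subseteq> pverts H" "A \<inter> X \<subseteq> pverts H" "A \<inter> X \<inter> S = {}"
    using 1 by (auto simp: separation_def)
  have SY: "S \<inter> Y \<subseteq> ?R" using 1 2 by (auto simp: separation_def)
  show "separation H (S \<inter> (X \<union> T)) (A \<inter> X) ?R"
    unfolding separation_def
  proof (intro conjI)
    show "A \<inter> X \<union> S \<inter> (X \<union> T) \<union> ?R = pverts H" using sub by blast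
    show "A \<inter> X \<inter> (S \<inter> (X \<union> T)) = {}" using sub by blast
    show "?R \<inter> (S \<inter> (X \<union> T)) = {}" "A \<inter> X \<inter> ?R = {}" by blast+
    show "A \<inter> X \<noteq> {}" by fact
    show "?R \<noteq> {}" using SY assms(5) by blast
    show "\<forall>u\<in>A \<inter> X. \<forall>v\<in>?R. (u, v) \<notin> parcs H \<and> (v, u) \<notin> parcs H" using no_arc by blast
  qed
  have "Y \<inter> (X \<union> T) = {}" using 2 by (auto simp: separation_def)
  then have "S \<inter> (X \<union> T) \<subset> S" using assms(5) by blast
  then show "card (S \<inter> (X \<union> T)) < card S" using assms(6) by (rule psubset_card_mono[rotated])
qed

lemma infinitesimal_flex_not_rigid:
  fixes p :: "'a \<Rightarrow> real ^ 'd::finite" and D :: "'d itself"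
  assumes "pair_graph G" "generic G p" "x \<in> pverts G" "y \<in> pverts G"
    and cont: "\<And>v. v \<in> pverts G \<Longrightarrow> ((\<lambda>q. u q v) \<longlongrightarrow> u p v) (nhds p)"
    and motion: "\<forall>\<^sub>F q in nhds p. \<forall>(a, b)\<in>parcs G. (q a - q b) \<bullet> (u q a - u q b) = 0"
    and rate: "(p x - p y) \<bullet> (u p x - u p y) \<noteq> 0"
  shows "\<not> rigid D G"
proof
  assume "rigid D G"
  then obtain \<epsilon> where \<epsilon>: "\<epsilon> > 0" "\<And>q. equivalent G p q \<Longrightarrow> (\<forall>v\<in>pverts G. norm (p v - q v) < \<epsilon>) \<Longrightarrow>
      congruent_real G p q"
    using assms(2) unfolding rigid_def by blast
  interpret pair_graph G by fact
  \<comment> \<open>Reversing the flex if its rate is negative makes the distance of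
    \<open>x\<close> and \<open>y\<close> grow.\<close>
  define s where "s = sgn ((p x - p y) \<bullet> (u p x - u p y))"
  define w where "w = (\<lambda>q v. s *\<^sub>R u q v)"
  have w: "(q a - q b) \<bullet> (w q a - w q b) = s * ((q a - q b) \<bullet> (u q a - u q b))" for q a b
    unfolding w_def by (simp add: scaleR_diff_right[symmetric])
  have "\<exists>q. (\<forall>v\<in>pverts G. norm (p v - q v) < \<epsilon>) \<and>
    (\<forall>(a, b)\<in>parcs G. norm (p a - p b) = norm (q a - q b)) \<and> norm (p x - p y) \<noteq> norm (q x - q y)"
  proof (rule flex_from_infinitesimal_flex[of "pverts G" x y "parcs G" w p])
    show "parcs G \<subseteq> pverts G \<times> pverts G" using wellformed' by auto
    show "((\<lambda>q. w q v) \<longlongrightarrow> w p v) (nhds p)" if "v \<in> pverts G" for v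
      unfolding w_def by (intro tendsto_intros cont that)
    show "\<forall>\<^sub>F q in nhds p. \<forall>(a, b)\<in>parcs G. (q a - q b) \<bullet> (w q a - w q b) = 0"
      using motion by eventually_elim (auto simp: w)
    show "(p x - p y) \<bullet> (w p x - w p y) > 0"
      using rate by (simp add: w s_def sgn_mult_self_eq abs_sgn[symmetric] mult.commute)
  qed (use assms \<epsilon>(1) pair_finite_verts in auto)
  then obtain q where "equivalent G p q" "\<forall>v\<in>pverts G. norm (p v - q v) < \<epsilon>"
    "norm (p x - p y) \<noteq> norm (q x - q y)"
    by (auto simp: equivalent_def)
  with \<epsilon>(2) assms(3,4) show False by (auto simp: congruent_real_def)
qed

text \<open>One side of a separation of order less than \<open>d\<close> can be rotated about the separator.\<close>

lemma rigid_separation_ge: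
  fixes D :: "'d::finite itself"
  assumes G: "pair_graph G" and rigid: "rigid D G" and card: "CARD('d) + 1 \<le> card (pverts G)"
    and sep: "separation G S A B"
  shows "CARD('d) \<le> card S"
proof (rule ccontr)
  assume "\<not> CARD('d) \<le> card S"
  then have S: "card S < CARD('d)" by simp
  interpret pair_graph G by fact
  obtain p :: "'a \<Rightarrow> real ^ 'd" where p: "generic G p" using generic_exists pair_finite_verts by blast
  obtain a b where ab: "a \<in> A" "b \<in> B" using sep by (auto simp: separation_def)
  have finS: "finite S" using sep pair_finite_verts by (auto simp: separation_def intro: finite_subset[of S "pverts G"])
  have ab': "a \<notin> S" "b \<notin> S" "a \<noteq> b" "b \<notin> A" and sub: "S \<union> {a, b} \<subseteq> pverts G"
    using sep ab by (auto simp: separation_def)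
  \<comment> \<open>Order at most \<open>d - 1\<close> is exactly what leaves room for both
    \<open>a\<close> and \<open>b\<close> among \<open>d + 1\<close> interpolation points.\<close>
  have "card (S \<union> {a, b}) \<le> CARD('d) + 1" using S ab' finS by simp
  then obtain P where P: "S \<union> {a, b} \<subseteq> P" "P \<subseteq> pverts G" "card P = CARD('d) + 1"
    using exists_subset_between[OF _ card sub pair_finite_verts] by blast
  show False
  proof (rule generic_interpolation[OF p P(2,3)])
    fix L :: "('a \<Rightarrow> real ^ 'd) \<Rightarrow> ('a \<Rightarrow> real) \<Rightarrow> (real ^ 'd) \<times> real"
    assume L: "\<forall>\<^sub>F q in nhds p. \<forall>g. \<forall>v\<in>P. aff (L q g) (q v) = g v"
      and L_cont: "\<And>g. (\<And>v. v \<in> P \<Longrightarrow> ((\<lambda>q. g q v) \<longlongrightarrow> g p v) (nhds p)) \<Longrightarrow>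
       ((\<lambda>q. L q (g q)) \<longlongrightarrow> L p (g p)) (nhds p)"
    \<comment> \<open>Both functionals vanish on \<open>S\<close>, hence so does
      \<open>field2\<close> of them, and the moving side fits the resting one along
      \<open>S\<close>. Their values at \<open>a\<close> and \<open>b\<close> form an identity
      matrix, so the rate is nonzero.\<close>
    define \<alpha> where "\<alpha> = (\<lambda>q. L q (\<lambda>v. if v = a then 1 else 0))"
    define \<beta> where "\<beta> = (\<lambda>q. L q (\<lambda>v. if v = b then 1 else 0))"
    have cont: "(\<alpha> \<longlongrightarrow> \<alpha> p) (nhds p)" "(\<beta> \<longlongrightarrow> \<beta> p) (nhds p)"
      unfolding \<alpha>_def \<beta>_def
      by (rule L_cont[of "\<lambda>_ v. if v = a then 1 else 0"], rule tendsto_const,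
          rule L_cont[of "\<lambda>_ v. if v = b then 1 else 0"], rule tendsto_const)
    define u where "u = (\<lambda>q v. if v \<in> A then field2 (\<alpha> q) (\<beta> q) (q v) else 0)"
    have "\<not> rigid D G"
    proof (rule infinitesimal_flex_not_rigid[OF G p, of a b u])
      show "a \<in> pverts G" "b \<in> pverts G" using sub by auto
      show "((\<lambda>q. u q v) \<longlongrightarrow> u p v) (nhds p)" for v
        unfolding u_def by (auto intro!: tendsto_field2 cont tendsto_coordinate)
      show "\<forall>\<^sub>F q in nhds p. \<forall>(v, w)\<in>parcs G. (q v - q w) \<bullet> (u q v - u q w) = 0"
        using L
      proof eventually_elim
        fix q assume L: "\<forall>g. \<forall>v\<in>P. aff (L q g) (q v) = g v"
        have L1: "aff (L q g) (q v) = g v" if "v \<in> P" for g v using L that by blast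
        have 0: "aff (\<alpha> q) (q v) = 0" "aff (\<beta> q) (q v) = 0" if "v \<in> S" for v
          unfolding \<alpha>_def \<beta>_def by (subst L1; use P(1) that ab' in auto)+
        have u: "u q v = field2 (\<alpha> q) (\<beta> q) (q v)" if "v \<in> A \<union> S" for v
          using that 0 by (auto simp: u_def field2_eq_0)
        show "\<forall>(v, w)\<in>parcs G. (q v - q w) \<bullet> (u q v - u q w) = 0"
        proof (intro ballI, clarify)
          fix v w assume vw: "(v, w) \<in> parcs G"
          have "v \<in> A \<union> S \<union> B" "w \<in> A \<union> S \<union> B"
            using wellformed'[OF vw] sep by (auto simp: separation_def)
          then consider "v \<in> A \<union> S" "w \<in> A \<union> S" | "v \<notin> A" "w \<notin> A"
            using vw sep by (auto simp: separation_def)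
          then show "(q v - q w) \<bullet> (u q v - u q w) = 0"
          proof cases
            case 1
            then show ?thesis by (simp add: u field2_isometry)
          next
            case 2
            then show ?thesis by (simp add: u_def)
          qed
        qed
      qed
      have L1: "aff (L p g) (p v) = g v" if "v \<in> P" for g v
        using eventually_nhds_x_imp_x[OF L] that by blast
      have "aff (\<alpha> p) (p a) = 1" "aff (\<alpha> p) (p b) = 0" "aff (\<beta> p) (p a) = 0" "aff (\<beta> p) (p b) = 1"
        unfolding \<alpha>_def \<beta>_def by (subst L1; use P(1) ab' in auto)+
      then show "(p a - p b) \<bullet> (u p a - u p b) \<noteq> 0"
        using ab ab' by (simp add: u_def inner_field2' form2_def)
    qed
    with rigid show False by simp
  qed
qed

lemma field2_diff_right: "field2 a (b - c) z = field2 a b z - field2 a c z"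
  by (simp add: field2_def aff_diff algebra_simps)

lemma field2_swap: "field2 b a z = - field2 a b z"
  by (simp add: field2_def)

lemma field2_sum_isometry:
  "(z - z') \<bullet> (field2 a b z + field2 c d z - (field2 a b z' + field2 c d z')) = 0"
proof -
  have "(z - z') \<bullet> (field2 a b z + field2 c d z - (field2 a b z' + field2 c d z')) =
      (z - z') \<bullet> (field2 a b z - field2 a b z') + (z - z') \<bullet> (field2 c d z - field2 c d z')"
    by (simp add: inner_diff_right inner_add_right)
  then show ?thesis by (simp only: field2_isometry)
qed

text \<open>
  Two crossing separators of size \<open>d\<close> cut the graph into four corners, which move as a four-bar
  linkage. If \<open>\<alpha>\<close> and \<open>\<beta>\<close> vanish on \<open>S\<close> and \<open>T\<close>, split \<open>\<beta> = \<beta>\<^sub>1 + \<beta>\<^sub>2\<close> with \<open>\<beta>\<^sub>1\<close> vanishing on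
  \<open>S - Y\<close> and \<open>\<beta>\<^sub>2\<close> on \<open>S - X\<close>, and split \<open>\<alpha> = \<alpha>\<^sub>1 + \<alpha>\<^sub>2\<close> likewise along \<open>T\<close>. The relative
  motions of consecutive corners are the two-forms \<open>\<alpha> \<and> \<beta>\<^sub>2\<close>, \<open>\<beta> \<and> \<alpha>\<^sub>1\<close>, \<open>\<alpha> \<and> \<beta>\<^sub>1\<close>, \<open>\<beta> \<and> \<alpha>\<^sub>2\<close>:
  each vanishes where its two corners meet, and their sum is \<open>\<alpha> \<and> \<beta> + \<beta> \<and> \<alpha> = 0\<close>.
\<close>

lemma crossing_separations_not_rigid:
  fixes D :: "'d::finite itself"
  assumes G: "pair_graph G" and S: "separation G S A B" "card S = CARD('d)"
    and T: "separation G T X Y" "card T = CARD('d)"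
    and cross: "S \<inter> X \<noteq> {}" "S \<inter> Y \<noteq> {}" "T \<inter> A \<noteq> {}" "T \<inter> B \<noteq> {}"
  shows "\<not> rigid D G"
proof -
  interpret pair_graph G by fact
  obtain p :: "'a \<Rightarrow> real ^ 'd" where p: "generic G p" using generic_exists pair_finite_verts by blast
  obtain v0 w0 where v0: "v0 \<in> T \<inter> A" and w0: "w0 \<in> S \<inter> X" using cross by blast
  have dj: "A \<inter> S = {}" "A \<inter> B = {}" "B \<inter> S = {}" "X \<inter> T = {}" "X \<inter> Y = {}" "Y \<inter> T = {}"
    by (fact separationD[OF S(1)] separationD[OF T(1)])+
  have ST: "v \<in> A \<union> S \<union> B" "v \<in> X \<union> T \<union> Y" if "v \<in> pverts G" for v
    using separationD(9)[OF S(1) that] separationD(9)[OF T(1) that] by blast+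
  have sub: "S \<subseteq> pverts G" "T \<subseteq> pverts G" by (fact separationD[OF S(1)] separationD[OF T(1)])+
  then have fin: "finite S" "finite T" using pair_finite_verts finite_subset by blast+
  have disj: "v0 \<notin> S" "w0 \<notin> T" using v0 w0 dj by blast+
  have PS: "insert v0 S \<subseteq> pverts G" "card (insert v0 S) = CARD('d) + 1"
    and PT: "insert w0 T \<subseteq> pverts G" "card (insert w0 T) = CARD('d) + 1"
    using sub v0 w0 fin disj S T by auto
  show ?thesis
  proof (rule generic_interpolation[OF p PS], rule generic_interpolation[OF p PT])
    fix L M :: "('a \<Rightarrow> real ^ 'd) \<Rightarrow> ('a \<Rightarrow> real) \<Rightarrow> (real ^ 'd) \<times> real"
    assume L: "\<forall>\<^sub>F q in nhds p. \<forall>g. \<forall>v\<in>insert v0 S. aff (L q g) (q v) = g v"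
      and L_cont: "\<And>g. (\<And>v. v \<in> insert v0 S \<Longrightarrow> ((\<lambda>q. g q v) \<longlongrightarrow> g p v) (nhds p)) \<Longrightarrow>
       ((\<lambda>q. L q (g q)) \<longlongrightarrow> L p (g p)) (nhds p)"
      and M: "\<forall>\<^sub>F q in nhds p. \<forall>g. \<forall>v\<in>insert w0 T. aff (M q g) (q v) = g v"
      and M_cont: "\<And>g. (\<And>v. v \<in> insert w0 T \<Longrightarrow> ((\<lambda>q. g q v) \<longlongrightarrow> g p v) (nhds p)) \<Longrightarrow>
       ((\<lambda>q. M q (g q)) \<longlongrightarrow> M p (g p)) (nhds p)"
    define \<alpha> where "\<alpha> = (\<lambda>q. L q (\<lambda>v. if v = v0 then 1 else 0))"
    define \<beta> where "\<beta> = (\<lambda>q. M q (\<lambda>v. if v = w0 then 1 else 0))"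
    \<comment> \<open>The values on \<open>S\<close> are split between its two parts; where
      \<open>S\<close> meets \<open>T\<close>, \<open>\<beta>\<close> itself vanishes, so both
      summands vanish there.\<close>
    define \<beta>1 where "\<beta>1 = (\<lambda>q. L q (\<lambda>v. if v \<in> S \<inter> Y then aff (\<beta> q) (q v) else 0))"
    define \<beta>2 where "\<beta>2 = (\<lambda>q. \<beta> q - \<beta>1 q)"
    define \<alpha>1 where "\<alpha>1 = (\<lambda>q. M q (\<lambda>v. if v \<in> T \<inter> B then aff (\<alpha> q) (q v) else 0))"
    define \<alpha>2 where "\<alpha>2 = (\<lambda>q. \<alpha> q - \<alpha>1 q)"
    have c\<alpha>: "(\<alpha> \<longlongrightarrow> \<alpha> p) (nhds p)"
      unfolding \<alpha>_def by (rule L_cont[of "\<lambda>_ v. if v = v0 then 1 else 0"], rule tendsto_const)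
    have c\<beta>: "(\<beta> \<longlongrightarrow> \<beta> p) (nhds p)"
      unfolding \<beta>_def by (rule M_cont[of "\<lambda>_ v. if v = w0 then 1 else 0"], rule tendsto_const)
    have c\<beta>1: "(\<beta>1 \<longlongrightarrow> \<beta>1 p) (nhds p)"
      unfolding \<beta>1_def
      by (rule L_cont[of "\<lambda>q v. if v \<in> S \<inter> Y then aff (\<beta> q) (q v) else 0"])
         (auto intro!: tendsto_aff tendsto_coordinate c\<beta>)
    have c\<alpha>1: "(\<alpha>1 \<longlongrightarrow> \<alpha>1 p) (nhds p)"
      unfolding \<alpha>1_def
      by (rule M_cont[of "\<lambda>q v. if v \<in> T \<inter> B then aff (\<alpha> q) (q v) else 0"])
         (auto intro!: tendsto_aff tendsto_coordinate c\<alpha>)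
    have cont: "(\<alpha> \<longlongrightarrow> \<alpha> p) (nhds p)" "(\<beta> \<longlongrightarrow> \<beta> p) (nhds p)"
      "(\<beta>2 \<longlongrightarrow> \<beta>2 p) (nhds p)" "(\<alpha>1 \<longlongrightarrow> \<alpha>1 p) (nhds p)" "(\<alpha>2 \<longlongrightarrow> \<alpha>2 p) (nhds p)"
      unfolding \<beta>2_def \<alpha>2_def by (auto intro!: tendsto_diff c\<alpha> c\<beta> c\<alpha>1 c\<beta>1)
    let ?ra = "\<lambda>q. field2 (\<alpha> q) (\<beta>1 q)" and ?rb = "\<lambda>q. field2 (\<alpha> q) (\<beta>2 q)"
    let ?rc = "\<lambda>q. field2 (\<beta> q) (\<alpha>1 q)" and ?re = "\<lambda>q. field2 (\<beta> q) (\<alpha>2 q)"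
    have sum0: "?rb q z + ?rc q z + ?ra q z + ?re q z = 0" for q z
      by (simp add: \<alpha>2_def \<beta>2_def field2_diff_right field2_swap[of "\<beta> q" "\<alpha> q"])
    \<comment> \<open>The corner of \<open>B\<close> and \<open>Y\<close> rests. Going round through
      \<open>A\<close>, \<open>Y\<close> and \<open>A\<close>, \<open>X\<close> adds
      \<open>?rb\<close> and \<open>?rc\<close>; the corner of \<open>B\<close> and \<open>X\<close>
      gets \<open>- ?re\<close>, which by \<open>sum0\<close> is the result of adding
      \<open>?ra\<close> as well.\<close>
    define u where "u = (\<lambda>q v. if v \<in> Y \<union> T then (if v \<in> A then ?rb q (q v) else 0)
      else (if v \<in> A then ?rb q (q v) + ?rc q (q v) else - ?re q (q v)))"
    have vals: "aff (\<alpha> q) (q v0) = 1" "aff (\<beta> q) (q w0) = 1"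
        "\<And>v. v \<in> S \<Longrightarrow> aff (\<alpha> q) (q v) = 0" "\<And>v. v \<in> T \<Longrightarrow> aff (\<beta> q) (q v) = 0"
        "\<And>v. v \<in> S \<inter> (X \<union> T) \<Longrightarrow> aff (\<beta>1 q) (q v) = 0"
        "\<And>v. v \<in> S \<inter> (Y \<union> T) \<Longrightarrow> aff (\<beta>2 q) (q v) = 0"
        "\<And>v. v \<in> T \<inter> (A \<union> S) \<Longrightarrow> aff (\<alpha>1 q) (q v) = 0"
        "\<And>v. v \<in> T \<inter> (B \<union> S) \<Longrightarrow> aff (\<alpha>2 q) (q v) = 0"
      if "\<forall>g. \<forall>v\<in>insert v0 S. aff (L q g) (q v) = g v"
        "\<forall>g. \<forall>v\<in>insert w0 T. aff (M q g) (q v) = g v" for q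
    proof -
      have L1: "aff (L q g) (q v) = g v" if "v \<in> insert v0 S" for g v
        using \<open>\<forall>g. \<forall>v\<in>insert v0 S. aff (L q g) (q v) = g v\<close> that by blast
      have M1: "aff (M q g) (q v) = g v" if "v \<in> insert w0 T" for g v
        using \<open>\<forall>g. \<forall>v\<in>insert w0 T. aff (M q g) (q v) = g v\<close> that by blast
      show "aff (\<alpha> q) (q v0) = 1" unfolding \<alpha>_def by (subst L1) auto
      show "aff (\<beta> q) (q w0) = 1" unfolding \<beta>_def by (subst M1) auto
      show 2: "aff (\<alpha> q) (q v) = 0" if "v \<in> S" for v
        unfolding \<alpha>_def by (subst L1) (use that disj in auto)
      show 3: "aff (\<beta> q) (q v) = 0" if "v \<in> T" for v
        unfolding \<beta>_def by (subst M1) (use that disj in auto)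
      have 4: "aff (\<beta>1 q) (q v) = (if v \<in> Y then aff (\<beta> q) (q v) else 0)" if "v \<in> S" for v
        unfolding \<beta>1_def by (subst L1) (use that in auto)
      have 5: "aff (\<alpha>1 q) (q v) = (if v \<in> B then aff (\<alpha> q) (q v) else 0)" if "v \<in> T" for v
        unfolding \<alpha>1_def by (subst M1) (use that in auto)
      show "aff (\<beta>1 q) (q v) = 0" if "v \<in> S \<inter> (X \<union> T)" for v
        using 3 4[of v] that dj by auto
      show "aff (\<beta>2 q) (q v) = 0" if "v \<in> S \<inter> (Y \<union> T)" for v
        using 3 4[of v] that dj by (auto simp: \<beta>2_def aff_diff)
      show "aff (\<alpha>1 q) (q v) = 0" if "v \<in> T \<inter> (A \<union> S)" for v
        using 2 5[of v] that dj by auto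
      show "aff (\<alpha>2 q) (q v) = 0" if "v \<in> T \<inter> (B \<union> S)" for v
        using 2 5[of v] that dj by (auto simp: \<alpha>2_def aff_diff)
    qed
    have vals_p: "\<forall>g. \<forall>v\<in>insert v0 S. aff (L p g) (p v) = g v"
      "\<forall>g. \<forall>v\<in>insert w0 T. aff (M p g) (p v) = g v"
      by (rule eventually_nhds_x_imp_x[OF L], rule eventually_nhds_x_imp_x[OF M])
    note vp = vals[OF vals_p]
    \<comment> \<open>If all these values were zero, \<open>\<alpha>2\<close> would equal a fixed
      multiple of \<open>\<beta>\<close> on \<open>S\<close>, and also at \<open>z0\<close> off the
      hyperplane through \<open>S\<close>, hence everywhere. At \<open>v0\<close>, however,
      \<open>\<alpha>2\<close> is 1 and \<open>\<beta>\<close> is 0.\<close>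
    obtain x y where xy: "x \<in> S \<inter> X" "y \<in> S \<inter> Y" "form2 (\<beta> p) (\<alpha>2 p) (p x) (p y) \<noteq> 0"
    proof (rule ccontr)
      assume "\<not> thesis"
      with that have all0: "form2 (\<beta> p) (\<alpha>2 p) (p x) (p y) = 0" if "x \<in> S \<inter> X" "y \<in> S \<inter> Y" for x y
        using that by blast
      obtain y0 z0 where y0: "y0 \<in> S \<inter> Y" and z0: "z0 \<in> T \<inter> B" using cross by blast
      have \<beta>0: "\<beta> p \<noteq> 0" using vp(2) by auto
      have \<beta>y0: "aff (\<beta> p) (p y0) \<noteq> 0"
        using generic_aff_nonzero[OF p sub(2) fin(2) T(2) vp(4) \<beta>0] y0 sub dj by blast
      define k where "k = aff (\<alpha>2 p) (p w0)"
      have Y: "aff (\<alpha>2 p) (p y) = k * aff (\<beta> p) (p y)" if "y \<in> S \<inter> Y" for y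
        using all0[OF w0 that] vp(2) by (simp add: form2_def k_def mult.commute)
      have X: "aff (\<alpha>2 p) (p x) = k * aff (\<beta> p) (p x)" if "x \<in> S \<inter> X" for x
      proof -
        have "aff (\<beta> p) (p x) * (k * aff (\<beta> p) (p y0)) = aff (\<beta> p) (p y0) * aff (\<alpha>2 p) (p x)"
          using all0[OF that y0] Y[OF y0] by (simp add: form2_def)
        then show ?thesis using \<beta>y0 by (simp add: mult.commute mult.left_commute)
      qed
      define c where "c = \<alpha>2 p - k *\<^sub>R \<beta> p"
      have c: "aff c z = aff (\<alpha>2 p) z - k * aff (\<beta> p) z" for z
        by (simp add: c_def aff_diff aff_scaleR)
      have "aff c (p v) = 0" if "v \<in> S" for v
      proof -
        have "v \<in> X \<union> T \<union> Y" using that sub ST by blast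
        then show ?thesis using X[of v] Y[of v] vp(4,8) that by (auto simp: c)
      qed
      moreover have "aff c (p z0) = 0" using vp(4,8) z0 by (auto simp: c)
      moreover have "z0 \<in> pverts G" "z0 \<notin> S" using z0 sub dj by auto
      ultimately have "c = 0"
        using generic_aff_nonzero[OF p sub(1) fin(1) S(2), of c z0] by blast
      then have "aff c (p v0) = 0" by simp
      moreover have "aff c (p v0) = 1"
        using vp(1) vp(4)[of v0] vp(7)[of v0] v0 by (simp add: c \<alpha>2_def aff_diff)
      ultimately show False by simp
    qed
    show ?thesis
    proof (rule infinitesimal_flex_not_rigid[OF G p, of x y u])
      show "x \<in> pverts G" "y \<in> pverts G" using xy sub by auto
      show "((\<lambda>q. u q v) \<longlongrightarrow> u p v) (nhds p)" for v
        unfolding u_def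
        by (auto intro!: tendsto_intros tendsto_field2 cont tendsto_coordinate)
      show "\<forall>\<^sub>F q in nhds p. \<forall>(v, w)\<in>parcs G. (q v - q w) \<bullet> (u q v - u q w) = 0"
        using L M
      proof eventually_elim
        fix q
        assume q: "\<forall>g. \<forall>v\<in>insert v0 S. aff (L q g) (q v) = g v"
          "\<forall>g. \<forall>v\<in>insert w0 T. aff (M q g) (q v) = g v"
        note vq = vals[OF q]
        have ra: "?ra q (q v) = 0" if "v \<in> S \<inter> (X \<union> T)" for v
          using vq(3,5) that by (intro field2_eq_0) auto
        have rb: "?rb q (q v) = 0" if "v \<in> S \<inter> (Y \<union> T)" for v
          using vq(3,6) that by (intro field2_eq_0) auto
        have rc: "?rc q (q v) = 0" if "v \<in> T \<inter> (A \<union> S)" for v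
          using vq(4,7) that by (intro field2_eq_0) auto
        have re: "?re q (q v) = 0" if "v \<in> T \<inter> (B \<union> S)" for v
          using vq(4,8) that by (intro field2_eq_0) auto
        have AY: "u q v = ?rb q (q v)" if "v \<in> A \<union> S" "v \<in> Y \<union> T" for v
          using that rb dj by (auto simp: u_def)
        have BY: "u q v = 0" if "v \<in> B \<union> S" "v \<in> Y \<union> T" for v
          using that dj by (auto simp: u_def)
        have AX: "u q v = ?rb q (q v) + ?rc q (q v)" if "v \<in> A \<union> S" "v \<in> X \<union> T" for v
        proof (cases "v \<in> T")
          case True
          then show ?thesis using that rc[of v] rb[of v] dj by (auto simp: u_def)
        next
          case False
          then have "v \<in> X" "v \<notin> Y \<union> T" using that dj by auto
          show ?thesis
          proof (cases "v \<in> A")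
            case True
            then show ?thesis using \<open>v \<notin> Y \<union> T\<close> by (simp add: u_def)
          next
            case False
            \<comment> \<open>On \<open>S \<inter> X\<close> the definition of \<open>u\<close> uses
              the formula of the other side; \<open>sum0\<close> identifies the two where
              \<open>?ra\<close> vanishes.\<close>
            then have "?ra q (q v) = 0" using ra \<open>v \<in> X\<close> that by auto
            then have "?rb q (q v) + ?rc q (q v) + ?re q (q v) = 0"
              using sum0[of q "q v"] by simp
            then have "?rb q (q v) + ?rc q (q v) = - ?re q (q v)"
              by (simp only: eq_neg_iff_add_eq_0)
            then show ?thesis using False \<open>v \<notin> Y \<union> T\<close> by (simp add: u_def)
          qed
        qed
        have BX: "u q v = - ?re q (q v)" if "v \<in> B \<union> S" "v \<in> X \<union> T" for v
          using that re[of v] dj by (auto simp: u_def)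
        show "\<forall>(v, w)\<in>parcs G. (q v - q w) \<bullet> (u q v - u q w) = 0"
        proof (intro ballI, clarify)
          fix v w assume vw: "(v, w) \<in> parcs G"
          \<comment> \<open>No arc crosses either separation, so both its ends lie in one closed
            corner, where \<open>u\<close> is a single infinitesimal isometry.\<close>
          have "v \<in> A \<union> S \<and> w \<in> A \<union> S \<or> v \<in> B \<union> S \<and> w \<in> B \<union> S"
            using ST(1)[OF wellformed'(1)[OF vw]] ST(1)[OF wellformed'(2)[OF vw]] vw
              separationD(10,11)[OF S(1)] by blast
          moreover have "v \<in> X \<union> T \<and> w \<in> X \<union> T \<or> v \<in> Y \<union> T \<and> w \<in> Y \<union> T"
            using ST(2)[OF wellformed'(1)[OF vw]] ST(2)[OF wellformed'(2)[OF vw]] vw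
              separationD(10,11)[OF T(1)] by blast
          ultimately consider
              "v \<in> A \<union> S" "v \<in> Y \<union> T" "w \<in> A \<union> S" "w \<in> Y \<union> T"
            | "v \<in> B \<union> S" "v \<in> Y \<union> T" "w \<in> B \<union> S" "w \<in> Y \<union> T"
            | "v \<in> A \<union> S" "v \<in> X \<union> T" "w \<in> A \<union> S" "w \<in> X \<union> T"
            | "v \<in> B \<union> S" "v \<in> X \<union> T" "w \<in> B \<union> S" "w \<in> X \<union> T"
            by blast
          then show "(q v - q w) \<bullet> (u q v - u q w) = 0"
          proof cases
            case 1
            show ?thesis unfolding AY[OF 1(1,2)] AY[OF 1(3,4)] by (rule field2_isometry)
          next
            case 2
            show ?thesis unfolding BY[OF 2(1,2)] BY[OF 2(3,4)] by simp
          next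
            case 3
            show ?thesis unfolding AX[OF 3(1,2)] AX[OF 3(3,4)] by (rule field2_sum_isometry)
          next
            case 4
            show ?thesis
              unfolding BX[OF 4(1,2)] BX[OF 4(3,4)] field2_swap[of "\<alpha>2 q" "\<beta> q", symmetric]
              by (rule field2_isometry)
          qed
        qed
      qed
      have "u p x = - ?re p (p x)" "u p y = 0" using xy dj by (auto simp: u_def)
      then show "(p x - p y) \<bullet> (u p x - u p y) \<noteq> 0"
        using xy(3) by (simp add: inner_field2')
    qed
  qed
qed

text \<open>If \<open>S\<close> met both sides of \<open>T\<close> while \<open>T\<close> missed a
  side \<open>A'\<close> of \<open>S\<close>, a nonempty corner of \<open>A'\<close> would be cut
  off by fewer than \<open>d\<close> vertices. Both corners empty would put \<open>A'\<close> inside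
  \<open>T\<close>, so \<open>T\<close> meets both sides of \<open>S\<close> and the separations
  cross.\<close>

lemma rigid_separations_nested:
  fixes D :: "'d::finite itself"
  assumes G: "pair_graph G" and rigid: "rigid D G" and card: "CARD('d) + 1 \<le> card (pverts G)"
    and S: "separation G S A B" "card S = CARD('d)"
    and T: "separation G T X Y" "card T = CARD('d)"
  shows "S \<inter> X = {} \<or> S \<inter> Y = {}"
proof (rule ccontr)
  assume "\<not> ?thesis"
  then have XY: "S \<inter> X \<noteq> {}" "S \<inter> Y \<noteq> {}" by auto
  interpret pair_graph G by fact
  have finS: "finite S" using S pair_finite_verts by (auto simp: separation_def intro: finite_subset[of S "pverts G"])
  have meets: "T \<inter> A' \<noteq> {}" if S': "separation G S A' B'" for A' B'
  proof
    assume 0: "T \<inter> A' = {}"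
    have "A' \<inter> X = {}"
    proof (rule ccontr)
      assume "A' \<inter> X \<noteq> {}"
      from corner_separation[OF S' T(1) 0 this XY(2) finS] rigid_separation_ge[OF G rigid card] S(2)
      show False by (metis not_le)
    qed
    moreover have "A' \<inter> Y = {}"
    proof (rule ccontr)
      assume "A' \<inter> Y \<noteq> {}"
      from corner_separation[OF S' separation_commute[OF T(1)] 0 this XY(1) finS]
        rigid_separation_ge[OF G rigid card] S(2)
      show False by (metis not_le)
    qed
    moreover have "A' \<subseteq> X \<union> T \<union> Y" using separationD(5)[OF S'] separationD(9)[OF T(1)] by blast
    ultimately show False using separationD(7)[OF S'] 0 by blast
  qed
  show False
    using crossing_separations_not_rigid[OF G S T XY meets[OF S(1)] meets[OF separation_commute[OF S(1)]], of D]
      rigid by simp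
qed

section \<open>Gluing along a clique separator\<close>

text \<open>Indexed families match the vectors of two realizations by vertex, and independence of a
  family excludes repeated vectors.\<close>

definition indep_family :: "'i set \<Rightarrow> ('i \<Rightarrow> 'b::real_vector) \<Rightarrow> bool" where
  "indep_family I f \<longleftrightarrow> (\<forall>c. (\<Sum>i\<in>I. c i *\<^sub>R f i) = 0 \<longrightarrow> (\<forall>i\<in>I. c i = 0))"

lemma indep_family_inj_on:
  assumes "finite I" "indep_family I f"
  shows "inj_on f I"
proof (rule inj_onI, rule ccontr)
  fix s t assume st: "s \<in> I" "t \<in> I" "f s = f t" "s \<noteq> t"
  define c :: "'a \<Rightarrow> real" where "c = (\<lambda>i. of_bool (i = s) - of_bool (i = t))"
  have "(\<Sum>i\<in>I. c i *\<^sub>R f i) = (\<Sum>i\<in>I. if i = s then f i else 0) - (\<Sum>i\<in>I. if i = t then f i else 0)"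
    by (subst sum_subtractf[symmetric], intro sum.cong) (auto simp: c_def)
  also have "\<dots> = 0" using st assms(1) by simp
  finally have "c s = 0" using assms(2) st(1) unfolding indep_family_def by blast
  then show False using st(4) by (simp add: c_def)
qed

lemma indep_family_independent:
  assumes "finite I" "indep_family I f"
  shows "independent (f ` I)"
proof (rule independent_if_scalars_zero)
  fix u x assume u: "(\<Sum>x\<in>f ` I. u x *\<^sub>R x) = 0" and x: "x \<in> f ` I"
  have "(\<Sum>i\<in>I. u (f i) *\<^sub>R f i) = 0"
    using u sum.reindex[OF indep_family_inj_on[OF assms], of "\<lambda>x. u x *\<^sub>R x"] by (simp add: o_def)
  then have "\<forall>i\<in>I. u (f i) = 0"
    using assms(2) unfolding indep_family_def by (elim allE[of _ "\<lambda>i. u (f i)"] mp)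
  then show "u x = 0" using x by blast
qed (use assms in simp)

text \<open>The orthogonal complement is a line, on which the Cauchy-Schwarz inequality is an
  equality.\<close>

lemma orthogonal_to_hyperplane_parallel:
  fixes f :: "'i \<Rightarrow> 'b::euclidean_space"
  assumes I: "finite I" "card I + 1 = DIM('b)" "indep_family I f"
    and "\<And>i. i \<in> I \<Longrightarrow> r \<bullet> f i = 0" "\<And>i. i \<in> I \<Longrightarrow> s \<bullet> f i = 0"
  shows "(r \<bullet> s)\<^sup>2 = (norm r)\<^sup>2 * (norm s)\<^sup>2"
proof (cases "r = 0")
  case False
  define W where "W = {y \<in> UNIV. \<forall>x\<in>span (f ` I). orthogonal x y}"
  have "dim (span (f ` I)) = card I"
    using I indep_family_independent[OF I(1,3)] indep_family_inj_on[OF I(1,3)]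
    by (simp add: dim_span dim_eq_card_independent card_image)
  moreover have "dim W + dim (span (f ` I)) = dim (UNIV :: 'b set)"
    unfolding W_def by (rule dim_subspace_orthogonal_to_vectors) auto
  ultimately have "dim W = 1" using I(2) by simp
  moreover have W: "z \<in> W" if "\<And>i. i \<in> I \<Longrightarrow> z \<bullet> f i = 0" for z
  proof -
    have "orthogonal z x" if "x \<in> span (f ` I)" for x
      using that by (rule orthogonal_to_span) (use \<open>\<And>i. i \<in> I \<Longrightarrow> z \<bullet> f i = 0\<close> in \<open>auto simp: orthogonal_def\<close>)
    then show ?thesis by (simp add: W_def orthogonal_commute)
  qed
  ultimately have "W \<subseteq> span {r}"
    using False W[of r] assms(4) by (intro card_ge_dim_independent) auto
  then obtain k where "s = k *\<^sub>R r"
    using W[of s] assms(5) by (auto simp: span_singleton)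
  then show ?thesis
    unfolding power2_norm_eq_inner by (simp add: power2_eq_square)
qed simp

lemma projection_coefficients:
  fixes e :: "'i \<Rightarrow> 'b::euclidean_space"
  assumes "finite I" "indep_family I e"
  obtains c where "\<And>i. i \<in> I \<Longrightarrow> (w - (\<Sum>j\<in>I. c j *\<^sub>R e j)) \<bullet> e i = 0"
proof -
  obtain y z where yz: "y \<in> span (e ` I)" "\<And>v. v \<in> span (e ` I) \<Longrightarrow> orthogonal z v" "w = y + z"
    using orthogonal_subspace_decomp_exists[of "e ` I" w] by metis
  obtain u where "y = (\<Sum>v\<in>e ` I. u v *\<^sub>R v)"
    using yz(1) assms(1) by (auto simp: span_finite)
  then have "y = (\<Sum>j\<in>I. u (e j) *\<^sub>R e j)"
    using sum.reindex[OF indep_family_inj_on[OF assms], of "\<lambda>x. u x *\<^sub>R x"] by (simp add: o_def)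
  then have "(w - (\<Sum>j\<in>I. u (e j) *\<^sub>R e j)) \<bullet> e i = 0" if "i \<in> I" for i
    using yz(2)[of "e i"] yz(3) that by (simp add: span_base orthogonal_def)
  then show ?thesis by (rule that)
qed

lemma inner_combinations_eq:
  assumes "\<And>i j. i \<in> I \<Longrightarrow> j \<in> I \<Longrightarrow> f i \<bullet> f j = e i \<bullet> (e j :: 'b::real_inner)"
  shows "(\<Sum>i\<in>I. a i *\<^sub>R f i) \<bullet> (\<Sum>i\<in>I. b i *\<^sub>R f i) = (\<Sum>i\<in>I. a i *\<^sub>R e i) \<bullet> (\<Sum>i\<in>I. b i *\<^sub>R e i)"
  using assms by (auto simp: inner_sum_left inner_sum_right intro!: sum.cong)

text \<open>The length of a linear combination is determined by the Gram matrix.\<close>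

lemma indep_family_gram:
  fixes e f :: "'i \<Rightarrow> 'b::real_inner"
  assumes "indep_family I e" "\<And>i j. i \<in> I \<Longrightarrow> j \<in> I \<Longrightarrow> f i \<bullet> f j = e i \<bullet> e j"
  shows "indep_family I f"
  unfolding indep_family_def
proof (intro allI impI)
  fix c assume "(\<Sum>i\<in>I. c i *\<^sub>R f i) = 0"
  then have "(\<Sum>i\<in>I. c i *\<^sub>R e i) \<bullet> (\<Sum>i\<in>I. c i *\<^sub>R e i) = 0"
    using inner_combinations_eq[of I f e c c] assms(2) by simp
  then show "\<forall>i\<in>I. c i = 0" using assms(1) by (simp add: indep_family_def)
qed

text \<open>
  Relative to a spanning set of a hyperplane a vector is determined up to reflection, so the inner
  product of two such vectors takes one of two values.
\<close>

lemma inner_two_values: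
  fixes e :: "'i \<Rightarrow> 'b::euclidean_space"
  assumes I: "finite I" "card I + 1 = DIM('b)" "indep_family I e"
  shows "\<exists>k. \<forall>(f :: 'i \<Rightarrow> 'b) v' w'. (\<forall>i\<in>I. \<forall>j\<in>I. f i \<bullet> f j = e i \<bullet> e j) \<and>
    (\<forall>i\<in>I. v' \<bullet> f i = v \<bullet> e i) \<and> (\<forall>i\<in>I. w' \<bullet> f i = w \<bullet> e i) \<and> norm v' = norm v \<and> norm w' = norm w
    \<longrightarrow> v' \<bullet> w' = v \<bullet> w \<or> v' \<bullet> w' = (k :: real)"
proof -
  obtain a where a: "\<And>i. i \<in> I \<Longrightarrow> (v - (\<Sum>j\<in>I. a j *\<^sub>R e j)) \<bullet> e i = 0"
    using projection_coefficients[OF I(1,3), of v] by blast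
  obtain b where b: "\<And>i. i \<in> I \<Longrightarrow> (w - (\<Sum>j\<in>I. b j *\<^sub>R e j)) \<bullet> e i = 0"
    using projection_coefficients[OF I(1,3), of w] by blast
  define E where "E = (\<lambda>c. \<Sum>j\<in>I. c j *\<^sub>R e j)"
  define r where "r = v - E a"
  define s where "s = w - E b"
  have orthE: "r \<bullet> E c = 0" "s \<bullet> E c = 0" for c
    using a b by (simp_all add: r_def s_def E_def inner_sum_right[where A = I])
  have v: "v = E a + r" and w: "w = E b + s" by (simp_all add: r_def s_def)
  have rs: "(r \<bullet> s)\<^sup>2 = (norm r)\<^sup>2 * (norm s)\<^sup>2"
    using a b by (intro orthogonal_to_hyperplane_parallel[OF I]) (auto simp: r_def s_def E_def)
  show ?thesis
  \<comment> \<open>The second value comes from reversing the sign of the product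
    \<open>r \<bullet> s\<close> of the components orthogonal to the hyperplane.\<close>
  proof (intro exI[of _ "v \<bullet> w - 2 * (r \<bullet> s)"] allI impI, elim conjE)
    fix f :: "'i \<Rightarrow> 'b" and v' w'
    assume f: "\<forall>i\<in>I. \<forall>j\<in>I. f i \<bullet> f j = e i \<bullet> e j" and v': "\<forall>i\<in>I. v' \<bullet> f i = v \<bullet> e i" "norm v' = norm v"
      and w': "\<forall>i\<in>I. w' \<bullet> f i = w \<bullet> e i" "norm w' = norm w"
    define F where "F = (\<lambda>c. \<Sum>j\<in>I. c j *\<^sub>R f j)"
    \<comment> \<open>The coefficients found for \<open>e\<close> serve for \<open>f\<close> as
      well, because the equations defining them involve inner products only.\<close>
    define r' where "r' = v' - F a"
    define s' where "s' = w' - F b"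
    have FE: "F c \<bullet> F c' = E c \<bullet> E c'" for c c'
      unfolding F_def E_def using f by (intro inner_combinations_eq) auto
    have Ff: "F c \<bullet> f i = E c \<bullet> e i" if "i \<in> I" for c i
      using f that by (auto simp: F_def E_def inner_sum_left intro!: sum.cong)
    have r'f: "r' \<bullet> f i = 0" and s'f: "s' \<bullet> f i = 0" if "i \<in> I" for i
      using a[OF that] b[OF that] v'(1) w'(1) Ff[OF that] that
      by (simp_all add: r'_def s'_def E_def inner_diff_left)
    have orthF: "r' \<bullet> F c = 0" "s' \<bullet> F c = 0" for c
      using r'f s'f by (simp_all add: F_def inner_sum_right[where A = I])
    have v'': "v' = F a + r'" and w'': "w' = F b + s'" by (simp_all add: r'_def s'_def)
    have "(norm v')\<^sup>2 = F a \<bullet> F a + (norm r')\<^sup>2" "(norm v)\<^sup>2 = E a \<bullet> E a + (norm r)\<^sup>2"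
      unfolding power2_norm_eq_inner v v'' using orthE orthF
      by (simp_all add: inner_add_left inner_add_right inner_commute[of "F _" r'] inner_commute[of "E _" r])
    then have nr: "(norm r')\<^sup>2 = (norm r)\<^sup>2" using v'(2) FE by simp
    have "(norm w')\<^sup>2 = F b \<bullet> F b + (norm s')\<^sup>2" "(norm w)\<^sup>2 = E b \<bullet> E b + (norm s)\<^sup>2"
      unfolding power2_norm_eq_inner w w'' using orthE orthF
      by (simp_all add: inner_add_left inner_add_right inner_commute[of "F _" s'] inner_commute[of "E _" s])
    then have ns: "(norm s')\<^sup>2 = (norm s)\<^sup>2" using w'(2) FE by simp
    have "indep_family I f" by (rule indep_family_gram[OF I(3)]) (use f in blast)
    then have "(r' \<bullet> s')\<^sup>2 = (norm r')\<^sup>2 * (norm s')\<^sup>2"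
      using r'f s'f by (intro orthogonal_to_hyperplane_parallel[OF I(1,2)])
    then have "(r' \<bullet> s')\<^sup>2 = (r \<bullet> s)\<^sup>2" using rs nr ns by simp
    then have "r' \<bullet> s' = r \<bullet> s \<or> r' \<bullet> s' = - (r \<bullet> s)" by (simp add: power2_eq_iff)
    moreover have "v' \<bullet> w' = E a \<bullet> E b + r' \<bullet> s'" "v \<bullet> w = E a \<bullet> E b + r \<bullet> s"
      unfolding v w v'' w'' using orthE orthF FE
      by (simp_all add: inner_add_left inner_add_right inner_commute[of "F _" s'] inner_commute[of "E _" s])
    ultimately show "v' \<bullet> w' = v \<bullet> w \<or> v' \<bullet> w' = v \<bullet> w - 2 * (r \<bullet> s)" by auto
  qed
qed

lemma inner_eq_norms: "(a :: 'b::real_inner) \<bullet> b = ((norm a)\<^sup>2 + (norm b)\<^sup>2 - (norm (a - b))\<^sup>2) / 2"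
  by (simp add: power2_norm_eq_inner inner_diff_left inner_diff_right inner_commute)

text \<open>With \<open>t0\<close> as origin, distances become inner products, and general position
  makes the \<open>d - 1\<close> remaining vectors of \<open>T\<close> span a hyperplane. The second
  distance \<open>k\<close> depends on \<open>p\<close> but not on \<open>q\<close>, so one
  threshold can exclude it for all \<open>q\<close>.\<close>

lemma generic_glue:
  fixes p :: "'a \<Rightarrow> real ^ 'd::finite"
  assumes p: "generic G p" and T: "T \<subseteq> pverts G" "finite T" "card T = CARD('d)"
    and x: "x \<in> pverts G" "x \<notin> T"
  obtains k where "\<And>q :: 'a \<Rightarrow> real ^ 'd. (\<And>s t. s \<in> T \<Longrightarrow> t \<in> T \<Longrightarrow> norm (p s - p t) = norm (q s - q t)) \<Longrightarrow>
    (\<And>t. t \<in> T \<Longrightarrow> norm (p x - p t) = norm (q x - q t)) \<Longrightarrow>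
    (\<And>t. t \<in> T \<Longrightarrow> norm (p y - p t) = norm (q y - q t)) \<Longrightarrow>
    norm (q x - q y) = norm (p x - p y) \<or> norm (q x - q y) = k"
proof -
  have "T \<noteq> {}" using T(3) by auto
  then obtain t0 where t0: "t0 \<in> T" by blast
  define I where "I = T - {t0}"
  have I: "finite I" "card I + 1 = DIM(real ^ 'd)"
    using card_Suc_Diff1[OF T(2) t0] T(2,3) by (simp_all add: I_def)
  define e where "e = (\<lambda>(r :: 'a \<Rightarrow> real ^ 'd) i. r i - r t0)"
  have P: "insert x T \<subseteq> pverts G" "card (insert x T) = CARD('d) + 1" using T x by auto
  have indep: "indep_family I (e p)"
    unfolding indep_family_def
  proof (intro allI impI ballI)
    fix c t assume c: "(\<Sum>i\<in>I. c i *\<^sub>R e p i) = 0" and t: "t \<in> I"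
    \<comment> \<open>The linear part of this functional reads off the coefficient of
      \<open>t\<close>.\<close>
    obtain a where a: "\<And>v. v \<in> insert x T \<Longrightarrow> aff a (p v) = (if v = t then 1 else 0)"
      using generic_interpolate[OF p P, of "\<lambda>v. if v = t then 1 else 0"] by blast
    have "fst a \<bullet> e p i = (if i = t then 1 else 0)" if "i \<in> I" for i
    proof -
      have "fst a \<bullet> e p i = aff a (p i) - aff a (p t0)" by (simp add: aff_def e_def inner_diff_right)
      then show ?thesis using a[of i] a[of t0] that t t0 by (auto simp: I_def)
    qed
    then have "fst a \<bullet> (\<Sum>i\<in>I. c i *\<^sub>R e p i) = (\<Sum>i\<in>I. if i = t then c i else 0)"
      by (auto simp: inner_sum_right intro!: sum.cong)
    then show "c t = 0" using c t I(1) by simp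
  qed
  obtain k where k: "\<forall>(f :: 'a \<Rightarrow> real ^ 'd) v' w'. (\<forall>i\<in>I. \<forall>j\<in>I. f i \<bullet> f j = e p i \<bullet> e p j) \<and>
    (\<forall>i\<in>I. v' \<bullet> f i = e p x \<bullet> e p i) \<and> (\<forall>i\<in>I. w' \<bullet> f i = e p y \<bullet> e p i) \<and>
    norm v' = norm (e p x) \<and> norm w' = norm (e p y) \<longrightarrow>
    v' \<bullet> w' = e p x \<bullet> e p y \<or> v' \<bullet> w' = k"
    using inner_two_values[OF I indep, of "e p x" "e p y"] by (rule exE)
  have diff: "e r u - e r v = r u - r v" for r u v by (simp add: e_def)
  show ?thesis
  proof (rule that[of "sqrt ((norm (e p x))\<^sup>2 + (norm (e p y))\<^sup>2 - 2 * k)"])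
    fix q :: "'a \<Rightarrow> real ^ 'd"
    assume TT: "\<And>s t. s \<in> T \<Longrightarrow> t \<in> T \<Longrightarrow> norm (p s - p t) = norm (q s - q t)"
      and xT: "\<And>t. t \<in> T \<Longrightarrow> norm (p x - p t) = norm (q x - q t)"
      and yT: "\<And>t. t \<in> T \<Longrightarrow> norm (p y - p t) = norm (q y - q t)"
    have n: "norm (e q i) = norm (e p i)" if "i \<in> T" for i
      using TT[OF that t0] by (simp add: e_def)
    have nx: "norm (e q x) = norm (e p x)" and ny: "norm (e q y) = norm (e p y)"
      using xT[OF t0] yT[OF t0] by (simp_all add: e_def)
    have "(\<forall>i\<in>I. \<forall>j\<in>I. e q i \<bullet> e q j = e p i \<bullet> e p j) \<and>
        (\<forall>i\<in>I. e q x \<bullet> e q i = e p x \<bullet> e p i) \<and> (\<forall>i\<in>I. e q y \<bullet> e q i = e p y \<bullet> e p i) \<and>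
        norm (e q x) = norm (e p x) \<and> norm (e q y) = norm (e p y)"
      using n nx ny TT xT yT by (simp add: inner_eq_norms[of "e _ _"] diff I_def)
    then have "e q x \<bullet> e q y = e p x \<bullet> e p y \<or> e q x \<bullet> e q y = k"
      by (rule k[THEN spec, THEN spec, THEN spec, THEN mp])
    moreover have 1: "(norm (r x - r y))\<^sup>2 = (norm (e r x))\<^sup>2 + (norm (e r y))\<^sup>2 - 2 * (e r x \<bullet> e r y)" for r
      by (simp add: inner_eq_norms[of "e r x" "e r y"] diff field_simps)
    ultimately have "(norm (q x - q y))\<^sup>2 = (norm (p x - p y))\<^sup>2 \<or>
        (norm (q x - q y))\<^sup>2 = (norm (e p x))\<^sup>2 + (norm (e p y))\<^sup>2 - 2 * k"
      unfolding 1 nx ny by auto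
    then show "norm (q x - q y) = norm (p x - p y) \<or>
        norm (q x - q y) = sqrt ((norm (e p x))\<^sup>2 + (norm (e p y))\<^sup>2 - 2 * k)"
      by (metis norm_ge_zero power2_eq_iff_nonneg real_sqrt_abs abs_norm_cancel)
  qed
qed

section \<open>Counting the clique separators between two vertices\<close>

text \<open>A clique cannot meet both sides of \<open>T\<close>. If \<open>T'\<close> missed
  \<open>X\<close>, or missed \<open>Y\<close> while \<open>y\<close> is not in \<open>Y'\<close>, a
  corner would be cut off by a part of \<open>T\<close> that omits \<open>t\<close>, hence by fewer
  than \<open>k\<close> vertices.\<close>

lemma clique_separations_nested:
  assumes conn: "\<And>S A B. separation H S A B \<Longrightarrow> k \<le> card S" and fin: "finite (pverts H)"
    and T: "separation H T X Y" "card T = k" "x \<in> X" "y \<in> Y" "t \<in> T"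
    and T': "separation H T' X' Y'" "clique H T'" "x \<in> X'" "t \<in> Y'"
  shows "y \<in> Y'"
proof (rule ccontr)
  assume y: "y \<notin> Y'"
  have finT: "finite T" using separationD(4)[OF T(1)] fin finite_subset by blast
  have "T' \<inter> X \<noteq> {}"
  proof
    assume "T' \<inter> X = {}"
    then have "k \<le> card (T \<inter> (X' \<union> T'))" "card (T \<inter> (X' \<union> T')) < card T"
      using corner_separation[OF T(1) T'(1) _ _ _ finT] conn T T' by blast+
    then show False using T(2) by simp
  qed
  moreover have "T' \<inter> Y \<noteq> {}"
  proof
    assume 0: "T' \<inter> Y = {}"
    have "y \<in> X'" using 0 y T(4) separationD(9)[OF T'(1), of y] separationD(6)[OF T(1)] by blast
    with 0 have "k \<le> card (T \<inter> (X' \<union> T'))" "card (T \<inter> (X' \<union> T')) < card T"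
      using corner_separation[OF separation_commute[OF T(1)] T'(1) _ _ _ finT] conn T T' by blast+
    then show False using T(2) by simp
  qed
  ultimately obtain u v where uv: "u \<in> T'" "u \<in> X" "v \<in> T'" "v \<in> Y" by blast
  then have "u \<noteq> v" using separationD(3)[OF T(1)] by blast
  then have "(u, v) \<in> parcs H" using T'(2) uv by (auto simp: clique_def)
  then show False using separationD(10)[OF T(1)] uv by blast
qed

definition separators_between :: "nat \<Rightarrow> 'a pair_pre_digraph \<Rightarrow> 'a \<Rightarrow> 'a \<Rightarrow> 'a set set" where
  "separators_between k H x y =
     {T. \<exists>X Y. separation H T X Y \<and> card T = k \<and> x \<in> X \<and> y \<in> Y}"

lemma separators_between_commute: "separators_between k H x y = separators_between k H y x"
  unfolding separators_between_def using separation_commute by blast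

text \<open>By nestedness every separator between \<open>x\<close> and \<open>t\<close> also lies
  between \<open>x\<close> and \<open>y\<close>. \<open>T\<close> itself is lost, since
  \<open>t\<close> belongs to it.\<close>

lemma separators_between_less:
  assumes conn: "\<And>S A B. separation H S A B \<Longrightarrow> k \<le> card S" and fin: "finite (pverts H)"
    and cliq: "\<And>S A B. separation H S A B \<Longrightarrow> card S = k \<Longrightarrow> clique H S"
    and T: "separation H T X Y" "card T = k" "x \<in> X" "y \<in> Y" "t \<in> T"
  shows "card (separators_between k H x t) < card (separators_between k H x y)"
proof (rule psubset_card_mono)
  have "separators_between k H x y \<subseteq> Pow (pverts H)"
    unfolding separators_between_def using separationD(4) by blast
  then show "finite (separators_between k H x y)" using fin finite_subset by blast
  have "separators_between k H x t \<subseteq> separators_between k H x y"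
  proof
    fix T' assume "T' \<in> separators_between k H x t"
    then obtain X' Y' where T': "separation H T' X' Y'" "card T' = k" "x \<in> X'" "t \<in> Y'"
      by (auto simp: separators_between_def)
    have "y \<in> Y'"
      by (rule clique_separations_nested[OF conn fin T T'(1) cliq[OF T'(1,2)] T'(3,4)])
    with T' show "T' \<in> separators_between k H x y" by (auto simp: separators_between_def)
  qed
  moreover have "T \<in> separators_between k H x y" using T by (auto simp: separators_between_def)
  moreover have "T \<notin> separators_between k H x t"
    using T(5) separationD(2) by (fastforce simp: separators_between_def)
  ultimately show "separators_between k H x t \<subset> separators_between k H x y" by blast
qed

text \<open>
  A nonadjacent pair \<open>x\<close>, \<open>y\<close> is glued along a clique separator \<open>T\<close>; the pairs \<open>x\<close>, \<open>t\<close> and \<open>y\<close>,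
  \<open>t\<close> with \<open>t \<in> T\<close> have fewer separators between them. The threshold \<open>\<epsilon>\<close> excludes the reflected
  position.
\<close>

lemma clique_sum_locally_rigid:
  fixes p :: "'a \<Rightarrow> real ^ 'd::finite"
  assumes p: "generic H p" and fin: "finite (pverts H)"
    and conn: "\<And>S A B. separation H S A B \<Longrightarrow> CARD('d) \<le> card S"
    and cliq: "\<And>S A B. separation H S A B \<Longrightarrow> card S = CARD('d) \<Longrightarrow> clique H S"
    and adj: "\<And>x y. x \<in> pverts H \<Longrightarrow> y \<in> pverts H \<Longrightarrow> x \<noteq> y \<Longrightarrow> (x, y) \<notin> parcs H \<Longrightarrow>
      \<exists>T X Y. separation H T X Y \<and> card T = CARD('d) \<and> x \<in> X \<and> y \<in> Y"
  shows "\<exists>\<epsilon>>0. \<forall>q. equivalent H p q \<and> (\<forall>x\<in>pverts H. norm (p x - q x) < \<epsilon>) \<longrightarrow> congruent_real H p q"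
proof -
  define good where "good = (\<lambda>\<epsilon> x y. \<forall>q. equivalent H p q \<and> (\<forall>x\<in>pverts H. norm (p x - q x) < \<epsilon>) \<longrightarrow>
    norm (p x - p y) = norm (q x - q y))"
  have good_mono: "good \<epsilon> x y" if "good \<epsilon>' x y" "\<epsilon> \<le> \<epsilon>'" for \<epsilon> \<epsilon>' x y
    using that unfolding good_def by (meson less_le_trans)
  have good_finite: "\<exists>\<epsilon>>0. \<forall>(x, y)\<in>A. good \<epsilon> x y"
    if "finite A" "\<And>x y. (x, y) \<in> A \<Longrightarrow> \<exists>\<epsilon>>0. good \<epsilon> x y" for A :: "('a \<times> 'a) set"
    using that
  proof (induction A rule: finite_induct)
    case empty
    show ?case by (auto intro!: exI[of _ 1])
  next
    case (insert a A)
    obtain x y where a: "a = (x, y)" by fastforce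
    obtain \<epsilon> where \<epsilon>: "\<epsilon> > 0" "\<forall>(x, y)\<in>A. good \<epsilon> x y" using insert by blast
    obtain \<epsilon>' where \<epsilon>': "\<epsilon>' > 0" "good \<epsilon>' x y" using insert.prems a by blast
    have "\<forall>(x, y)\<in>insert a A. good (min \<epsilon> \<epsilon>') x y"
      using \<epsilon>(2) \<epsilon>'(2) good_mono[of \<epsilon> _ _ "min \<epsilon> \<epsilon>'"] good_mono[of \<epsilon>' x y "min \<epsilon> \<epsilon>'"] a by auto
    then show ?case using \<epsilon>(1) \<epsilon>'(1) by (intro exI[of _ "min \<epsilon> \<epsilon>'"]) simp
  qed
  have "\<exists>\<epsilon>>0. good \<epsilon> x y" if "x \<in> pverts H" "y \<in> pverts H" for x y
    using that
  proof (induction "card (separators_between CARD('d) H x y)" arbitrary: x y rule: less_induct)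
    case less
    show ?case
    proof (cases "x = y \<or> (x, y) \<in> parcs H")
      case True
      then have "good 1 x y" by (auto simp: good_def equivalent_def)
      then show ?thesis by (intro exI[of _ 1]) simp
    next
      case False
      then obtain T X Y where T: "separation H T X Y" "card T = CARD('d)" and xy: "x \<in> X" "y \<in> Y"
        using adj less.prems by blast
      have sub: "T \<subseteq> pverts H" by (rule separationD(4)[OF T(1)])
      then have finT: "finite T" using fin finite_subset by blast
      have "\<exists>\<epsilon>>0. \<forall>(x, t)\<in>{x} \<times> T. good \<epsilon> x t"
      proof (rule good_finite)
        fix x' t assume t: "(x', t) \<in> {x} \<times> T"
        then have "card (separators_between CARD('d) H x t) < card (separators_between CARD('d) H x y)"
          by (intro separators_between_less[OF conn fin cliq T xy]) auto
        then show "\<exists>\<epsilon>>0. good \<epsilon> x' t" using less.hyps[of x t] less.prems sub t by auto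
      qed (use finT in simp)
      moreover have "\<exists>\<epsilon>>0. \<forall>(y, t)\<in>{y} \<times> T. good \<epsilon> y t"
      proof (rule good_finite)
        fix y' t assume t: "(y', t) \<in> {y} \<times> T"
        then have "card (separators_between CARD('d) H y t) < card (separators_between CARD('d) H y x)"
          by (intro separators_between_less[OF conn fin cliq separation_commute[OF T(1)] T(2) xy(2,1)]) auto
        then show "\<exists>\<epsilon>>0. good \<epsilon> y' t"
          using less.hyps[of y t] less.prems sub t by (auto simp: separators_between_commute[of _ _ x y])
      qed (use finT in simp)
      ultimately obtain \<epsilon>1 \<epsilon>2 where \<epsilon>12: "\<epsilon>1 > 0" "\<forall>t\<in>T. good \<epsilon>1 x t" "\<epsilon>2 > 0" "\<forall>t\<in>T. good \<epsilon>2 y t"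
        by auto
      have "x \<notin> T" using xy separationD(1)[OF T(1)] by blast
      then obtain k where k: "\<And>q :: 'a \<Rightarrow> real ^ 'd. (\<And>s t. s \<in> T \<Longrightarrow> t \<in> T \<Longrightarrow> norm (p s - p t) = norm (q s - q t)) \<Longrightarrow>
        (\<And>t. t \<in> T \<Longrightarrow> norm (p x - p t) = norm (q x - q t)) \<Longrightarrow>
        (\<And>t. t \<in> T \<Longrightarrow> norm (p y - p t) = norm (q y - q t)) \<Longrightarrow>
        norm (q x - q y) = norm (p x - p y) \<or> norm (q x - q y) = k"
        using generic_glue[OF p sub finT T(2) less.prems(1), of y] by blast
      \<comment> \<open>Half of the gap between the two possible distances: moving both ends by less
        than this changes their distance by less than the gap. If the two values coincide, any
        positive number will do.\<close>
      define \<epsilon>3 where "\<epsilon>3 = (if k = norm (p x - p y) then 1 else \<bar>k - norm (p x - p y)\<bar> / 2)"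
      define \<epsilon> where "\<epsilon> = min \<epsilon>3 (min \<epsilon>1 \<epsilon>2)"
      have "\<epsilon> > 0" using \<epsilon>12 by (auto simp: \<epsilon>_def \<epsilon>3_def)
      moreover have "good \<epsilon> x y"
        unfolding good_def
      proof (intro allI impI, elim conjE)
        fix q assume q: "equivalent H p q" "\<forall>x\<in>pverts H. norm (p x - q x) < \<epsilon>"
        have xt: "norm (p x - p t) = norm (q x - q t)" "norm (p y - p t) = norm (q y - q t)" if "t \<in> T" for t
          using good_mono[of \<epsilon>1 x t \<epsilon>] good_mono[of \<epsilon>2 y t \<epsilon>] \<epsilon>12 that q
          unfolding good_def by (auto simp: \<epsilon>_def)
        have "norm (p s - p t) = norm (q s - q t)" if "s \<in> T" "t \<in> T" for s t
          using cliq[OF T] q(1) that by (cases "s = t") (auto simp: clique_def equivalent_def)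
        with xt have or: "norm (q x - q y) = norm (p x - p y) \<or> norm (q x - q y) = k"
          by (intro k) auto
        have "\<bar>norm (q x - q y) - norm (p x - p y)\<bar> \<le> norm ((q x - q y) - (p x - p y))"
          by (rule norm_triangle_ineq3)
        also have "\<dots> = norm ((p y - q y) - (p x - q x))" by (simp add: algebra_simps)
        also have "\<dots> \<le> norm (p y - q y) + norm (p x - q x)" by (rule norm_triangle_ineq4)
        also have "\<dots> < \<epsilon>3 + \<epsilon>3"
          using q(2) less.prems by (intro add_strict_mono) (auto simp: \<epsilon>_def)
        finally show "norm (p x - p y) = norm (q x - q y)"
          using or by (auto simp: \<epsilon>3_def split: if_splits)
      qed
      ultimately show ?thesis by blast
    qed
  qed
  then have "\<exists>\<epsilon>>0. \<forall>(x, y)\<in>pverts H \<times> pverts H. good \<epsilon> x y"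
    using fin by (intro good_finite) auto
  then obtain \<epsilon> where "\<epsilon> > 0" "\<And>x y. x \<in> pverts H \<Longrightarrow> y \<in> pverts H \<Longrightarrow> good \<epsilon> x y" by auto
  then show ?thesis
    by (intro exI[of _ \<epsilon>]) (auto simp: congruent_real_def good_def)
qed

section \<open>Globally linked pairs and reflections\<close>

text \<open>For a nonzero linear part, the mirror image in the hyperplane where \<open>c\<close>
  vanishes; the normal is not assumed to have length 1.\<close>

definition reflection :: "'b::real_inner \<times> real \<Rightarrow> 'b \<Rightarrow> 'b" where
  "reflection c z = z + (- 2 * aff c z / (norm (fst c))\<^sup>2) *\<^sub>R fst c"

lemma norm_reflection_diff:
  assumes "fst c \<noteq> 0"
  shows "norm (reflection c z - reflection c z') = norm (z - z')"
proof -
  let ?h = "- 2 * (aff c z - aff c z') / (norm (fst c))\<^sup>2"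
  have "reflection c z - reflection c z' = (z - z') + ?h *\<^sub>R fst c"
    by (simp add: reflection_def algebra_simps diff_divide_distrib)
  moreover have "(z - z') \<bullet> fst c = aff c z - aff c z'"
    by (simp add: aff_def inner_diff_left inner_commute[of "fst c"])
  ultimately have "(norm (reflection c z - reflection c z'))\<^sup>2 =
      (norm (z - z'))\<^sup>2 + (2 * ?h * (aff c z - aff c z') + ?h\<^sup>2 * (norm (fst c))\<^sup>2)"
    by (simp only: sqnorm_step add.assoc)
  moreover have "2 * ?h * (aff c z - aff c z') + ?h\<^sup>2 * (norm (fst c))\<^sup>2 = 0"
    using assms by (simp add: power2_eq_square field_simps)
  ultimately have "(norm (reflection c z - reflection c z'))\<^sup>2 = (norm (z - z'))\<^sup>2" by simp
  then show ?thesis by (simp add: power2_eq_iff_nonneg)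
qed

text \<open>Reflecting only \<open>z\<close> changes the squared distance by
  \<open>4 * aff c z * aff c z' / (norm (fst c))\<^sup>2\<close>.\<close>

lemma norm_reflection_neq:
  assumes "fst c \<noteq> 0" "aff c z \<noteq> 0" "aff c z' \<noteq> 0"
  shows "norm (reflection c z - z') \<noteq> norm (z - z')"
proof
  assume eq: "norm (reflection c z - z') = norm (z - z')"
  let ?h = "- 2 * aff c z / (norm (fst c))\<^sup>2"
  have "reflection c z - z' = (z - z') + ?h *\<^sub>R fst c"
    by (simp add: reflection_def)
  moreover have "(z - z') \<bullet> fst c = aff c z - aff c z'"
    by (simp add: aff_def inner_diff_left inner_commute[of "fst c"])
  ultimately have "(norm (reflection c z - z'))\<^sup>2 =
      (norm (z - z'))\<^sup>2 + (2 * ?h * (aff c z - aff c z') + ?h\<^sup>2 * (norm (fst c))\<^sup>2)"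
    by (simp only: sqnorm_step add.assoc)
  then have "2 * ?h * (aff c z - aff c z') + ?h\<^sup>2 * (norm (fst c))\<^sup>2 = 0"
    unfolding eq by linarith
  moreover have "2 * ?h * (aff c z - aff c z') + ?h\<^sup>2 * (norm (fst c))\<^sup>2 =
      4 * aff c z * aff c z' / (norm (fst c))\<^sup>2"
    using assms(1) by (simp add: power2_eq_square field_simps)
  ultimately show False using assms by simp
qed

text \<open>Reflecting the side \<open>X\<close> in a hyperplane through \<open>T\<close> that
  misses \<open>x\<close> and \<open>y\<close> keeps all edge lengths but changes the distance of
  \<open>x\<close> and \<open>y\<close>.\<close>

lemma separated_not_globally_linked:
  fixes D :: "'d::finite itself"
  assumes G: "pair_graph G" and card: "CARD('d) + 1 \<le> card (pverts G)"
    and sep: "separation G T X Y" "card T \<le> CARD('d)" "x \<in> X" "y \<in> Y"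
  shows "\<not> globally_linked D G x y"
proof
  assume gl: "globally_linked D G x y"
  interpret pair_graph G by fact
  obtain p :: "'a \<Rightarrow> real ^ 'd" where p: "generic G p" using generic_exists pair_finite_verts by blast
  have sub: "T \<subseteq> pverts G" "x \<in> pverts G" "y \<in> pverts G"
    using separationD(4-6)[OF sep(1)] sep(3,4) by blast+
  have finT: "finite T" using sub(1) pair_finite_verts finite_subset by blast
  have ne: "x \<notin> T" "y \<notin> T" "x \<noteq> y" using separationD(1-3)[OF sep(1)] sep(3,4) by blast+
  obtain c where c: "fst c \<noteq> 0" "\<And>t. t \<in> T \<Longrightarrow> aff c (p t) = 0" "aff c (p x) \<noteq> 0" "aff c (p y) \<noteq> 0"
  proof (cases "card T = CARD('d)")
    case True
    have P: "insert x T \<subseteq> pverts G" "card (insert x T) = CARD('d) + 1"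
      using sub ne finT True by auto
    obtain c where "\<And>v. v \<in> insert x T \<Longrightarrow> aff c (p v) = (if v = x then 1 else 0)"
      using generic_interpolate[OF p P, of "\<lambda>v. if v = x then 1 else 0"] by blast
    then have c: "\<And>t. t \<in> T \<Longrightarrow> aff c (p t) = 0" "aff c (p x) = 1" using ne by force+
    then have "c \<noteq> 0" by auto
    then have "aff c (p y) \<noteq> 0"
      using generic_aff_nonzero[OF p sub(1) finT True c(1) _ sub(3) ne(2)] by blast
    moreover have "fst c \<noteq> 0"
    proof
      assume "fst c = 0"
      moreover obtain t where "t \<in> T" using True by fastforce
      ultimately show False using c(1)[of t] c(2) by (simp add: aff_def)
    qed
    ultimately show thesis using that c by simp
  next
    case False
    then have le: "card (T \<union> {x, y}) \<le> CARD('d) + 1" using sep(2) ne finT by simp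
    have "T \<union> {x, y} \<subseteq> pverts G" using sub by simp
    then obtain P where P: "T \<union> {x, y} \<subseteq> P" "P \<subseteq> pverts G" "card P = CARD('d) + 1"
      using exists_subset_between[OF le card _ pair_finite_verts] by metis
    \<comment> \<open>Different values at \<open>x\<close> and \<open>y\<close> guarantee a nonzero
      linear part, even when \<open>T\<close> is empty.\<close>
    let ?g = "\<lambda>v. if v = x then 1 else if v = y then 2 else 0 :: real"
    obtain c where "\<And>v. v \<in> P \<Longrightarrow> aff c (p v) = ?g v"
      using generic_interpolate[OF p P(2,3), of ?g] by blast
    then have c: "\<And>v. v \<in> T \<union> {x, y} \<Longrightarrow> aff c (p v) = ?g v" using P(1) by blast
    have "aff c (p x) = 1" "aff c (p y) = 2" using c[of x] c[of y] ne by auto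
    moreover from this have "fst c \<noteq> 0" by (auto simp: aff_def)
    moreover have "aff c (p t) = 0" if "t \<in> T" for t using c[of t] that ne by auto
    ultimately show thesis using that by simp
  qed
  define q where "q = (\<lambda>v. if v \<in> X then reflection c (p v) else p v)"
  have q: "q v = reflection c (p v)" if "v \<in> X \<union> T" for v
    using that c(2) by (auto simp: q_def reflection_def)
  have "norm (p u - p v) = norm (q u - q v)" if uv: "(u, v) \<in> parcs G" for u v
  proof -
    have "u \<in> X \<union> T \<and> v \<in> X \<union> T \<or> u \<notin> X \<and> v \<notin> X"
      using separationD(9)[OF sep(1) in_arcsD1[OF uv]] separationD(9)[OF sep(1) in_arcsD2[OF uv]]
        separationD(10,11)[OF sep(1)] uv by blast
    then show ?thesis
    proof
      assume "u \<in> X \<union> T \<and> v \<in> X \<union> T"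
      then show ?thesis using q c(1) by (simp add: norm_reflection_diff)
    qed (simp add: q_def)
  qed
  then have "equivalent G p q" by (auto simp: equivalent_def)
  then have "norm (p x - p y) = norm (q x - q y)"
    using gl p unfolding globally_linked_def by blast
  moreover have "y \<notin> X" using separationD(3)[OF sep(1)] sep(4) by blast
  ultimately show False
    using norm_reflection_neq[OF c(1,3,4)] sep(3) by (simp add: q_def)
qed

section \<open>The characterization\<close>

lemma pverts_gl_closure [simp]: "pverts (gl_closure D G) = pverts G"
  by (simp add: gl_closure_def)

lemma parcs_subset_gl_closure: "parcs G \<subseteq> parcs (gl_closure D G)"
  by (auto simp: gl_closure_def)

lemma globally_linked_commute: "globally_linked D G x y \<longleftrightarrow> globally_linked D G y x"
  unfolding globally_linked_def by (simp add: norm_minus_commute)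

lemma pair_graph_gl_closure:
  assumes "pair_graph G"
  shows "pair_graph (gl_closure D G)"
proof -
  interpret pair_graph G by fact
  have arcs: "parcs (gl_closure D G) \<subseteq> pverts G \<times> pverts G"
    using wellformed' by (auto simp: gl_closure_def)
  have sym: "(v, u) \<in> parcs G" if "(u, v) \<in> parcs G" for u v
    using that pair_sym_arcs by (auto simp: symmetric_def sym_def)
  have loops: "u \<noteq> v" if "(u, v) \<in> parcs G" for u v
    using pair_no_loops[OF that] by simp
  show ?thesis
  proof
    show "finite (parcs (gl_closure D G))"
      using arcs pair_finite_verts finite_subset by blast
    show "symmetric (with_proj (gl_closure D G))"
      using sym globally_linked_commute[of D G]
      by (auto simp: symmetric_def gl_closure_def intro!: symI)
  qed (use arcs pair_finite_verts loops in \<open>auto simp: gl_closure_def\<close>)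
qed

lemma separation_subgraph:
  "separation H T X Y \<Longrightarrow> pverts G = pverts H \<Longrightarrow> parcs G \<subseteq> parcs H \<Longrightarrow> separation G T X Y"
  unfolding separation_def by blast

lemma pair_graph_separator_iff:
  assumes "pair_graph H"
  shows "separator H S \<longleftrightarrow> (\<exists>X Y. separation H S X Y)"
proof (rule separator_iff)
  interpret pair_graph H by fact
  show "parcs H \<subseteq> pverts H \<times> pverts H" using wellformed' by auto
  show "(v, u) \<in> parcs H" if "(u, v) \<in> parcs H" for u v
    using that pair_sym_arcs by (auto simp: symmetric_def sym_def)
qed

text \<open>The pair extends to a maximal linked set, which is a block. Linkedness demands the bound
  on \<open>kappa\<close> in both orders; for nonadjacent vertices the reverse order follows from
  Menger's theorem and its easy converse.\<close>

lemma blocks_cliques_adjacent: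
  assumes H: "pair_graph H" and blocks: "\<And>B. k_block (k + 1) H B \<Longrightarrow> clique H B"
    and xy: "x \<in> pverts H" "y \<in> pverts H" "x \<noteq> y" and kappa: "k + 1 \<le> kappa H x y"
  shows "(x, y) \<in> parcs H"
proof (rule ccontr)
  assume nadj: "(x, y) \<notin> parcs H"
  interpret pair_graph H by fact
  have nadj': "(y, x) \<notin> parcs H"
    using nadj pair_sym_arcs by (auto simp: symmetric_def sym_def)
  have "k + 1 \<le> kappa H y x"
  proof (rule ccontr)
    assume "\<not> k + 1 \<le> kappa H y x"
    then have "kappa H y x \<le> k" by simp
    then obtain T X Y where T: "separation H T X Y" "y \<in> X" "x \<in> Y" "card T \<le> k"
      by (rule menger_separation[OF H xy(2,1) xy(3)[symmetric] nadj'])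
    have "kappa H x y \<le> card T"
      by (rule kappa_le_separation[OF separation_commute[OF T(1)] pair_finite_verts T(3,2)])
    with T(4) kappa show False by simp
  qed
  then have linked: "pairwise_k_linked (k + 1) H {x, y}"
    using xy kappa by (auto simp: pairwise_k_linked_def)
  let ?F = "{B. pairwise_k_linked (k + 1) H B}"
  have "?F \<subseteq> Pow (pverts H)" by (auto simp: pairwise_k_linked_def)
  then have "finite ?F" using pair_finite_verts finite_subset by blast
  then obtain B where B: "B \<in> ?F" "{x, y} \<subseteq> B" "\<forall>B'\<in>?F. B \<subseteq> B' \<longrightarrow> B = B'"
    using finite_has_maximal2[of ?F "{x, y}"] linked by auto
  then have "k_block (k + 1) H B" by (auto simp: k_block_def)
  then have "clique H B" by (rule blocks)
  then show False using B(2) xy(3) nadj by (auto simp: clique_def)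
qed

theorem theorem4p3:
  fixes G :: "'a pair_pre_digraph" and D :: "'d::finite itself"
  assumes "pair_graph G"
  shows "d_joined D G \<longleftrightarrow>
    k_connected CARD('d) (gl_closure D G) \<and>
    (\<forall>S. k_separator CARD('d) (gl_closure D G) S \<longrightarrow> clique (gl_closure D G) S) \<and>
    (\<forall>B. k_block (CARD('d) + 1) (gl_closure D G) B \<longrightarrow> clique (gl_closure D G) B)"
proof -
  interpret pair_graph G by fact
  define H where "H = gl_closure D G"
  have V: "pverts H = pverts G" and GH: "parcs G \<subseteq> parcs H"
    by (simp_all add: H_def parcs_subset_gl_closure)
  have H: "pair_graph H" unfolding H_def by (rule pair_graph_gl_closure[OF assms])
  have finV: "finite (pverts G)" by (rule pair_finite_verts)
  have H_arc: "(x, y) \<in> parcs H \<longleftrightarrow> (x, y) \<in> parcs G \<or> globally_linked D G x y"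
    if "x \<in> pverts G" "y \<in> pverts G" "x \<noteq> y" for x y
    using that by (auto simp: H_def gl_closure_def)
  have sepHG: "separation G T X Y" if "separation H T X Y" for T X Y
    using separation_subgraph[OF that _ GH] V by simp
  note sep_iff = pair_graph_separator_iff[OF H]
  have "d_joined D G \<longleftrightarrow> k_connected CARD('d) H \<and>
    (\<forall>S. k_separator CARD('d) H S \<longrightarrow> clique H S) \<and>
    (\<forall>B. k_block (CARD('d) + 1) H B \<longrightarrow> clique H B)"
  proof (intro iffI conjI allI impI)
    assume joined: "d_joined D G"
    then have card: "CARD('d) + 1 \<le> card (pverts G)" and rigid: "rigid D G"
      and linked: "\<And>x y. x \<in> pverts G \<Longrightarrow> y \<in> pverts G \<Longrightarrow> x \<noteq> y \<Longrightarrow>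
        globally_linked D G x y \<longleftrightarrow> (x, y) \<in> parcs G \<or> CARD('d) + 1 \<le> kappa G x y"
      by (auto simp: d_joined_def)
    have conn: "CARD('d) \<le> card S" if "separation G S A B" for S A B
      by (rule rigid_separation_ge[OF assms rigid card that])
    have sep: "\<exists>T X Y. separation G T X Y \<and> card T \<le> CARD('d) \<and> x \<in> X \<and> y \<in> Y"
      if xy: "x \<in> pverts G" "y \<in> pverts G" "x \<noteq> y" "(x, y) \<notin> parcs H" for x y
    proof -
      have nadj: "(x, y) \<notin> parcs G" and le: "kappa G x y \<le> CARD('d)"
        using H_arc[OF xy(1-3)] linked[OF xy(1-3)] xy(4) by auto
      obtain T X Y where "separation G T X Y" "x \<in> X" "y \<in> Y" "card T \<le> CARD('d)"
        by (rule menger_separation[OF assms xy(1-3) nadj le])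
      then show ?thesis by blast
    qed
    show "k_connected CARD('d) H"
      unfolding k_connected_def
    proof (intro conjI notI)
      assume "\<exists>S. separator H S \<and> card S < CARD('d)"
      then obtain S X Y where "separation H S X Y" "card S < CARD('d)" using sep_iff by blast
      then show False using conn[OF sepHG] by fastforce
    qed (use card V in simp)
    show "clique H S" if S: "k_separator CARD('d) H S" for S
      unfolding clique_def
    proof (intro conjI ballI impI)
      have "separator H S" and cardS: "card S = CARD('d)" using S by (auto simp: k_separator_def)
      then obtain A B where "separation H S A B" using sep_iff by blast
      \<comment> \<open>Separations of the closure are separations of its subgraph \<open>G\<close>,
        to which rigidity applies.\<close>
      then have AB: "separation G S A B" "card S = CARD('d)" using sepHG cardS by blast+
      then show "S \<subseteq> pverts H" using separationD(4) V by metis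
      fix x y assume xy: "x \<in> S" "y \<in> S" "x \<noteq> y"
      show "(x, y) \<in> parcs H"
      proof (rule ccontr)
        assume "(x, y) \<notin> parcs H"
        then obtain T X Y where T: "separation G T X Y" "card T \<le> CARD('d)" "x \<in> X" "y \<in> Y"
          using sep xy separationD(4)[OF AB(1)] by blast
        then have "card T = CARD('d)" using conn[OF T(1)] by simp
        then show False
          using rigid_separations_nested[OF assms rigid card AB T(1)] T(3,4) xy by blast
      qed
    qed
    show "clique H B" if B: "k_block (CARD('d) + 1) H B" for B
      unfolding clique_def
    proof (intro conjI ballI impI)
      show BV: "B \<subseteq> pverts H" using B by (simp add: k_block_def pairwise_k_linked_def)
      fix x y assume xy: "x \<in> B" "y \<in> B" "x \<noteq> y"
      show "(x, y) \<in> parcs H"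
      proof (rule ccontr)
        assume nadj: "(x, y) \<notin> parcs H"
        then have kappa: "CARD('d) + 1 \<le> kappa H x y"
          using B xy by (auto simp: k_block_def pairwise_k_linked_def)
        obtain T X Y where T: "separation G T X Y" "card T \<le> CARD('d)" "x \<in> X" "y \<in> Y"
          using sep[OF _ _ xy(3) nadj] xy BV V by blast
        \<comment> \<open>The separation bounds \<open>kappa\<close> in \<open>G\<close> by
          \<open>d\<close> for every pair across it, so being \<open>d\<close>-joined rules out that
          any such pair is globally linked.\<close>
        have "(u, v) \<notin> parcs H \<and> (v, u) \<notin> parcs H" if uv: "u \<in> X" "v \<in> Y" for u v
        proof -
          have sub: "u \<in> pverts G" "v \<in> pverts G" "u \<noteq> v"
            using uv separationD(3,5,6)[OF T(1)] by blast+
          have "\<not> CARD('d) + 1 \<le> kappa G u v"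
            using kappa_le_separation[OF T(1) finV uv] T(2) by simp
          then have "\<not> globally_linked D G u v"
            using linked[OF sub] separationD(10)[OF T(1) uv] by simp
          then show ?thesis
            using H_arc[OF sub] H_arc[OF sub(2,1)] sub(3) separationD(10,11)[OF T(1) uv]
              globally_linked_commute[of D G u v] by auto
        qed
        then have "separation H T X Y"
          using T(1) V unfolding separation_def by simp
        then have "kappa H x y \<le> card T"
          using kappa_le_separation T(3,4) finV V by metis
        then show False using T(2) kappa by simp
      qed
    qed
  next
    assume R: "k_connected CARD('d) H \<and> (\<forall>S. k_separator CARD('d) H S \<longrightarrow> clique H S) \<and>
      (\<forall>B. k_block (CARD('d) + 1) H B \<longrightarrow> clique H B)"
    then have card: "CARD('d) + 1 \<le> card (pverts G)"
      by (simp add: k_connected_def V)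
    have conn: "CARD('d) \<le> card S" if "separation H S A B" for S A B
    proof -
      have "separator H S" using sep_iff that by blast
      then show ?thesis using R unfolding k_connected_def by (meson not_le)
    qed
    have cliq: "clique H S" if "separation H S A B" "card S = CARD('d)" for S A B
      using R sep_iff that by (auto simp: k_separator_def)
    have blocks: "clique H B" if "k_block (CARD('d) + 1) H B" for B
      using R that by blast
    have arcI: "(x, y) \<in> parcs H"
      if "x \<in> pverts G" "y \<in> pverts G" "x \<noteq> y" "CARD('d) + 1 \<le> kappa H x y" for x y
      by (rule blocks_cliques_adjacent[OF H blocks]) (use that V in auto)
    have "rigid D G"
      unfolding rigid_def
    proof (intro allI impI)
      fix p :: "'a \<Rightarrow> real ^ 'd" assume p: "generic G p"
      then have "generic H p" by (simp add: generic_def V)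
      moreover have "\<exists>T X Y. separation H T X Y \<and> card T = CARD('d) \<and> x \<in> X \<and> y \<in> Y"
        if xy: "x \<in> pverts H" "y \<in> pverts H" "x \<noteq> y" "(x, y) \<notin> parcs H" for x y
      proof -
        have "kappa H x y \<le> CARD('d)"
        proof (rule ccontr)
          assume "\<not> ?thesis"
          then show False using arcI[of x y] xy V by simp
        qed
        then obtain T X Y where T: "separation H T X Y" "x \<in> X" "y \<in> Y" "card T \<le> CARD('d)"
          by (rule menger_separation[OF H xy])
        then have "card T = CARD('d)" using conn[OF T(1)] by simp
        with T show ?thesis by blast
      qed
      ultimately have "\<exists>\<epsilon>>0. \<forall>q. equivalent H p q \<and> (\<forall>x\<in>pverts H. norm (p x - q x) < \<epsilon>) \<longrightarrow>
          congruent_real H p q"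
        using finV V conn cliq by (intro clique_sum_locally_rigid) auto
      then obtain \<epsilon> where \<epsilon>: "\<epsilon> > 0" "\<And>q. equivalent H p q \<Longrightarrow>
          (\<forall>x\<in>pverts H. norm (p x - q x) < \<epsilon>) \<Longrightarrow> congruent_real H p q"
        by blast
      have "equivalent H p q" if "equivalent G p q" for q
        using that p
        by (auto simp: equivalent_def H_def gl_closure_def globally_linked_def)
      then show "\<exists>\<epsilon>>0. \<forall>q. equivalent G p q \<and> (\<forall>x\<in>pverts G. norm (p x - q x) < \<epsilon>) \<longrightarrow>
          congruent_real G p q"
        using \<epsilon> V by (intro exI[of _ \<epsilon>]) (auto simp: congruent_real_def)
    qed
    moreover have "globally_linked D G x y \<longleftrightarrow> (x, y) \<in> parcs G \<or> CARD('d) + 1 \<le> kappa G x y"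
      if xy: "x \<in> pverts G" "y \<in> pverts G" "x \<noteq> y" for x y
    proof (intro iffI)
      assume gl: "globally_linked D G x y"
      show "(x, y) \<in> parcs G \<or> CARD('d) + 1 \<le> kappa G x y"
      proof (rule ccontr)
        assume "\<not> ?thesis"
        then have nadj: "(x, y) \<notin> parcs G" and le: "kappa G x y \<le> CARD('d)" by auto
        obtain T X Y where T: "separation G T X Y" "x \<in> X" "y \<in> Y" "card T \<le> CARD('d)"
          by (rule menger_separation[OF assms xy nadj le])
        then show False using separated_not_globally_linked[OF assms card T(1,4,2,3)] gl by blast
      qed
    next
      assume or: "(x, y) \<in> parcs G \<or> CARD('d) + 1 \<le> kappa G x y"
      show "globally_linked D G x y"
      proof (cases "(x, y) \<in> parcs G")
        case True
        then show ?thesis by (auto simp: globally_linked_def equivalent_def)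
      next
        case False
        have "kappa G x y \<le> kappa H x y"
          by (rule kappa_mono[OF _ V[symmetric] GH]) (simp add: V finV)
        then have "CARD('d) + 1 \<le> kappa H x y" using or False by linarith
        then have "(x, y) \<in> parcs H" by (rule arcI[OF xy])
        \<comment> \<open>An arc of the closure that is not in \<open>G\<close> was added for a
          globally linked pair.\<close>
        then show ?thesis using H_arc[OF xy] False by blast
      qed
    qed
    ultimately show "d_joined D G" using card unfolding d_joined_def by blast
  qed
  then show ?thesis by (simp add: H_def)
qed

end
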